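(* Let $(X,d)$ be a complete separable metric space, $n\ge1$, and let $(\xi_k)_{k=1}^n$ be a stochastic process with state space $X$, initial distribution $P^{(1)}$ and conditional laws $p_k(\cdot\mid x^{(k-1)})$ of $\xi_k$ given $\xi^{(k-1)}=x^{(k-1)}$. Let $1\le s\le2$ and suppose there exist $\alpha>0$, $M>0$ and $0\le\rho_\ell\le M$ ($\ell=1,\dots,n$) such that: (i) $P^{(1)}$ and $p_k(\cdot\mid x^{(k-1)})$ ($k=2,\dots,n$, $x^{(k-1)}\in X^{k-1}$) satisfy $T_s(\alpha)$ on $(X,d)$; (ii) for $k=2,\dots,n$ and all $x^{(k-1)},y^{(k-1)}\in X^{k-1}$, $$W_s\bigl(p_k(\cdot\mid x^{(k-1)}),p_k(\cdot\mid y^{(k-1)})\bigr)^s\le\sum_{j=1}^{k-1}\rho_{k-j}\,d(x_j,y_j)^s.$$ Then the joint law $P^{(n)}$ satisfies $T_s(\alpha_n)$ on $(X^n,d^{(s)})$ with $$\alpha_n=\alpha\Bigl(\frac{(ne)^{1-s}M}{(1+M)^n}\Bigr)^{2/s}.$$ If moreover (iii) $\sum_{j=1}^n\rho_j\le R$ for some $R\ge0$, then $P^{(n)}$ satisfies $T_s(\alpha_n)$ with $$\alpha_n=\begin{cases} n^{1-2/s}(1-R^{1/s})^2\alpha & \text{if } R<1,\\ e^{(2/s)-2}(n+1)^{-(2/s)-1}\alpha & \text{if } R=1,\\ \Bigl(\dfrac{R-1}{e^{s-1}R^n}\Bigr)^{2/s}\dfrac{\alpha}{n+1} & \text{if } 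R>1.\end{cases}$$
   Context: $x^{(k)}=(x_1,\dots,x_k)\in X^k$. The joint law is $P^{(n)}(dx^{(n)})=p_n(dx_n\mid x^{(n-1)})\cdots p_2(dx_2\mid x_1)P^{(1)}(dx_1)$. $\mathrm{Prob}_s(X)$ is the set of Borel probability measures with finite $s$-th moment; $W_s(\mu,\nu)=\inf_\pi\bigl(\iint d(x,y)^s\pi(dx\,dy)\bigr)^{1/s}$ over couplings $\pi$ of $\mu,\nu$. $\mathrm{Ent}(\nu\mid\mu)=\int\log\frac{d\nu}{d\mu}d\nu$ if $\nu\ll\mu$, else $+\infty$. A measure $\mu$ satisfies $T_s(\alpha)$ if $W_s(\nu,\mu)\le(\frac2\alpha\mathrm{Ent}(\nu\mid\mu))^{1/2}$ for all $\nu\in\mathrm{Prob}_s$. On $X^k$, $d^{(s)}(x^{(k)},y^{(k)})=(\sum_{j=1}^kd(x_j,y_j)^s)^{1/s}$. *)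

theory Defs
  imports "HOL-Probability.Probability"
begin

definition epowr :: "ereal \<Rightarrow> real \<Rightarrow> ereal" where
  "epowr x p = (case x of ereal r \<Rightarrow> ereal (r powr p) | _ \<Rightarrow> \<infinity>)"

definition Prob_s :: "'b measure \<Rightarrow> ('b \<Rightarrow> 'b \<Rightarrow> real) \<Rightarrow> real \<Rightarrow> 'b measure set" where
  "Prob_s Mb d s = {\<mu>. prob_space \<mu> \<and> sets \<mu> = sets Mb \<and>
      (\<exists>x0\<in>space Mb. (\<integral>\<^sup>+ x. ennreal (d x x0 powr s) \<partial>\<mu>) < \<infinity>)}"

definition couplings :: "'b measure \<Rightarrow> 'b measure \<Rightarrow> 'b measure \<Rightarrow> ('b \<times> 'b) measure set" where
  "couplings Mb \<mu> \<nu> = {\<pi>. prob_space \<pi> \<and> sets \<pi> = sets (Mb \<Otimes>\<^sub>M Mb) \<and>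
      distr \<pi> Mb fst = \<mu> \<and> distr \<pi> Mb snd = \<nu>}"

definition Wcost :: "'b measure \<Rightarrow> ('b \<Rightarrow> 'b \<Rightarrow> real) \<Rightarrow> real \<Rightarrow> 'b measure \<Rightarrow> 'b measure \<Rightarrow> ennreal" where
  "Wcost Mb d s \<mu> \<nu> = (INF \<pi>\<in>couplings Mb \<mu> \<nu>. \<integral>\<^sup>+ z. ennreal (d (fst z) (snd z) powr s) \<partial>\<pi>)"

definition Wass :: "'b measure \<Rightarrow> ('b \<Rightarrow> 'b \<Rightarrow> real) \<Rightarrow> real \<Rightarrow> 'b measure \<Rightarrow> 'b measure \<Rightarrow> ereal" where
  "Wass Mb d s \<mu> \<nu> = (if Wcost Mb d s \<mu> \<nu> = \<infinity> then \<infinity>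
      else ereal (enn2real (Wcost Mb d s \<mu> \<nu>) powr (1 / s)))"

text \<open>Relative entropy \<open>Ent(\<nu> | \<mu>)\<close>: \<open>\<integral> log(d\<nu>/d\<mu>) d\<nu>\<close> if \<open>\<nu> \<ll> \<mu>\<close>, else \<open>+\<infinity>\<close>.
 For probability measures the negative part of the integrand is always \<nu>-integrable, so the
 integral is \<open>+\<infinity>\<close> exactly when the integrand is not integrable.\<close>
definition Ent :: "'b measure \<Rightarrow> 'b measure \<Rightarrow> ereal" where
  "Ent \<nu> \<mu> = (if sets \<nu> = sets \<mu> \<and> absolutely_continuous \<mu> \<nu> \<and>
                  integrable \<nu> (\<lambda>x. ln (enn2real (RN_deriv \<mu> \<nu> x)))
               then ereal (\<integral>x. ln (enn2real (RN_deriv \<mu> \<nu> x)) \<partial>\<nu>)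
               else \<infinity>)"

definition T_ineq :: "'b measure \<Rightarrow> ('b \<Rightarrow> 'b \<Rightarrow> real) \<Rightarrow> real \<Rightarrow> real \<Rightarrow> 'b measure \<Rightarrow> bool" where
  "T_ineq Mb d s \<alpha> \<mu> \<longleftrightarrow>
     (\<forall>\<nu>\<in>Prob_s Mb d s. Wass Mb d s \<nu> \<mu> \<le> epowr (ereal (2 / \<alpha>) * Ent \<nu> \<mu>) (1 / 2))"

definition Xsp :: "nat \<Rightarrow> (nat \<Rightarrow> 'a::topological_space) measure" where
  "Xsp k = PiM {1..k} (\<lambda>_. borel)"

definition dS :: "real \<Rightarrow> nat \<Rightarrow> (nat \<Rightarrow> 'a::metric_space) \<Rightarrow> (nat \<Rightarrow> 'a) \<Rightarrow> real" where
  "dS s k x y = (\<Sum>j=1..k. dist (x j) (y j) powr s) powr (1 / s)"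

fun joint :: "'a::topological_space measure \<Rightarrow> (nat \<Rightarrow> (nat \<Rightarrow> 'a) \<Rightarrow> 'a measure) \<Rightarrow> nat
              \<Rightarrow> (nat \<Rightarrow> 'a) measure" where
  "joint P1 p 0 = return (Xsp 0) (\<lambda>_. undefined)"
| "joint P1 p (Suc 0) = distr P1 (Xsp 1) (\<lambda>x. (\<lambda>i\<in>{1::nat}. x))"
| "joint P1 p (Suc (Suc k)) =
     joint P1 p (Suc k) \<bind> (\<lambda>x. distr (p (Suc (Suc k)) x) (Xsp (Suc (Suc k))) (\<lambda>y. x(Suc (Suc k) := y)))"

end

theory Submission
  imports Defs
begin

text \<open>A coupling of \<open>\<nu> = f P\<^sup>(\<^sup>n\<^sup>)\<close> and \<open>P\<^sup>(\<^sup>n\<^sup>)\<close> is built one coordinate at a time: given the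
  first \<open>k - 1\<close> coordinates \<open>(x, y)\<close> of the two processes, couple the conditional laws
  \<open>\<nu>\<^sub>k(\<cdot> | x)\<close> and \<open>p\<^sub>k(\<cdot> | y)\<close> almost optimally, passing through \<open>p\<^sub>k(\<cdot> | x)\<close>. The first leg
  is paid for by \<open>T\<^sub>s(\<alpha>)\<close>, the second by the dependence hypothesis. With \<open>a\<^sub>k\<close> the expected cost
  of the \<open>k\<close>-th coordinate and \<open>h\<^sub>k\<close> the \<open>k\<close>-th summand of the entropy in the chain rule, convexity
  of \<open>t\<^sup>s\<close> gives, for every \<open>\<gamma> > 0\<close> and up to an arbitrarily small error,
  \<open>a\<^sub>k \<le> (1 + \<gamma>)\<^sup>s\<^sup>-\<^sup>1 \<Sum>\<^sub>j\<^sub><\<^sub>k \<rho>\<^sub>k\<^sub>-\<^sub>j a\<^sub>j + (1 + 1/\<gamma>)\<^sup>s\<^sup>-\<^sup>1 (2 h\<^sub>k / \<alpha>)\<^sup>s\<^sup>/\<^sup>2\<close>. Summing this discrete Gronwall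
  inequality and choosing \<open>\<gamma>\<close> well yields every constant of the theorem.

  The almost optimal couplings must depend measurably on \<open>(x, y)\<close>. Both laws are discretised on a
  countable partition into cells of small diameter; a coupling of the discretised laws is approximated
  from below by a finite matrix with rational entries and completed by the independent coupling of the
  residual masses. Only countably many matrices occur, so the first good one is a measurable choice.\<close>

section \<open>Convexity and discrete Gronwall inequalities\<close>

text \<open>The detour through \<open>p\<^sub>k(\<cdot> | x)\<close> is forced: T_s compares a
  conditional law of \<nu> only with the conditional law of P at the same past x. Hypothesis (ii)
  then moves x to y, and its integral over the coupling built so far consists of the earlier costs
  a_j, because extending a coupling leaves them unchanged. The entropy leg is integrated by Jensen
  for t^(s/2), concave as s \<le> 2. The two legs are joined on cells, where gluing amounts to
  conditioning a discrete law. The residual mass left by a finite matrix is paired blindly, so its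
  cost must be controlled by s-th moments. These start from \<nu>, pass to its conditional laws
  almost everywhere, and travel along couplings of finite cost to the kernels. Two groups of
  constants arise because the powers of h_k are used in two ways: each is bounded by the power of
  the full entropy, or they are summed by concavity, which costs n^(1 - s/2). A bound W^s \<le> Q (2
  Ent / \<alpha>)^(s/2) is T_s(\<alpha> Q^(-2/s)), so every constant is a bound for Q.\<close>

text \<open>The sum x + y is the convex combination of (1 + 1/\<gamma>) x and (1 + \<gamma>) y whose
  weights are the reciprocals of these two factors; they add up to 1 for every \<gamma> > 0.\<close>

lemma powr_add_split:
  fixes x y s \<gamma> :: real
  assumes s: "1 \<le> s" and x: "0 \<le> x" and y: "0 \<le> y" and \<gamma>: "0 < \<gamma>"
  shows "(x + y) powr s \<le> (1 + 1 / \<gamma>) powr (s - 1) * x powr s + (1 + \<gamma>) powr (s - 1) * y powr s"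
proof (cases "x = 0 \<or> y = 0")
  case True
  have "1 \<le> (1 + 1 / \<gamma>) powr (s - 1)" "1 \<le> (1 + \<gamma>) powr (s - 1)"
    using s \<gamma> by (auto intro!: ge_one_powr_ge_zero)
  then show ?thesis
    using True s x y mult_right_mono[of 1 "(1 + 1 / \<gamma>) powr (s - 1)" "x powr s"]
      mult_right_mono[of 1 "(1 + \<gamma>) powr (s - 1)" "y powr s"] by auto
next
  case False
  then have pos: "0 < x" "0 < y" using x y by auto
  let ?a = "1 + 1 / \<gamma>" and ?b = "1 + \<gamma>"
  have ab: "0 < ?a" "0 < ?b" "1 / ?a = 1 - 1 / ?b"
    using \<gamma> by (auto simp: field_simps add_pos_pos)
  have "((1 - 1 / ?b) *\<^sub>R (?a * x) + (1 / ?b) *\<^sub>R (?b * y)) powr s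
      \<le> (1 - 1 / ?b) * (?a * x) powr s + (1 / ?b) * (?b * y) powr s"
    using pos ab \<gamma> by (intro convex_onD[OF powr_convex[OF s]]) auto
  also have "(1 - 1 / ?b) *\<^sub>R (?a * x) + (1 / ?b) *\<^sub>R (?b * y) = x + y"
    unfolding ab(3)[symmetric] using ab(1,2) by auto
  also have "(1 - 1 / ?b) * (?a * x) powr s = ?a powr (s - 1) * x powr s"
    unfolding ab(3)[symmetric] using ab(1,2) pos by (simp add: powr_mult powr_diff)
  also have "(1 / ?b) * (?b * y) powr s = ?b powr (s - 1) * y powr s"
    using ab pos by (simp add: powr_mult powr_diff)
  finally show ?thesis .
qed

text \<open>Taking the perturbation h itself as Young parameter gives (1 + 1/h)^(s-1) h^s = (1 +
  h)^(s-1) h, and s \<le> 2 bounds (1 + h)^(s-1) by 1 + h. It absorbs the error of replacing points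
  by cell centres.\<close>

lemma powr_add_small:
  fixes z h s :: real
  assumes s: "1 \<le> s" "s \<le> 2" and z: "0 \<le> z" and h: "0 < h" "h \<le> 1"
  shows "(z + h) powr s \<le> (1 + h) * z powr s + 2 * h"
proof -
  have "(h + z) powr s \<le> (1 + 1 / h) powr (s - 1) * h powr s + (1 + h) powr (s - 1) * z powr s"
    using powr_add_split[OF s(1) _ z h(1), of h] h by simp
  also have "(1 + 1 / h) powr (s - 1) * h powr s = (1 + h) powr (s - 1) * h"
  proof -
    have "1 + 1 / h = (1 + h) / h" using h by (simp add: field_simps)
    then show ?thesis using h by (simp add: powr_divide powr_diff)
  qed
  also have le: "(1 + h) powr (s - 1) \<le> (1 + h) powr 1"
    using s h by (intro powr_mono) auto
  then have "(1 + h) powr (s - 1) * h + (1 + h) powr (s - 1) * z powr s \<le> (1 + h) * h + (1 + h) * z powr s"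
    using h by (intro add_mono mult_right_mono) auto
  also have "(1 + h) * h \<le> 2 * h"
    using h by (intro mult_right_mono) auto
  finally show ?thesis by (simp add: add.commute)
qed

text \<open>The right side is the tangent at m of the concave function t^\<theta>, which lies above
  the graph by Young's inequality. Jensen's inequality for sums and for integrals is derived from
  this line below.\<close>

lemma powr_weighted_le:
  fixes x m \<theta> :: real
  assumes "0 \<le> x" "0 < m" "0 < \<theta>" "\<theta> \<le> 1"
  shows "x powr \<theta> \<le> m powr \<theta> * (\<theta> * (x / m) + (1 - \<theta>))"
proof (cases "x = 0")
  case False
  have "(x / m) powr \<theta> * 1 powr (1 - \<theta>) \<le> \<theta> * (x / m) + (1 - \<theta>) * 1"
    using assms False by (intro Youngs_inequality_0) auto
  then have "m powr \<theta> * (x / m) powr \<theta> \<le> m powr \<theta> * (\<theta> * (x / m) + (1 - \<theta>))"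
    by (intro mult_left_mono) auto
  then show ?thesis
    using assms by (simp add: powr_divide)
qed (use assms in auto)

text \<open>Jensen for t^\<theta>: the tangent is taken at the mean of the h i.\<close>

lemma sum_powr_le_powr_sum:
  fixes h :: "'i \<Rightarrow> real" and \<theta> :: real
  assumes I: "finite I" and h: "\<And>i. i \<in> I \<Longrightarrow> 0 \<le> h i" and \<theta>: "0 < \<theta>" "\<theta> \<le> 1"
  shows "(\<Sum>i\<in>I. h i powr \<theta>) \<le> real (card I) powr (1 - \<theta>) * (\<Sum>i\<in>I. h i) powr \<theta>"
proof (cases "(\<Sum>i\<in>I. h i) = 0")
  case True
  then show ?thesis
    using I h by (auto simp: sum_nonneg_eq_0_iff)
next
  case False
  define H where "H = (\<Sum>i\<in>I. h i)"
  have H: "0 < H" using False sum_nonneg[of I h] h by (auto simp: H_def)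
  have c: "0 < real (card I)" using I False by (auto simp: card_gt_0_iff)
  define m where "m = H / real (card I)"
  have m: "0 < m" using H c by (simp add: m_def)
  have "(\<Sum>i\<in>I. h i powr \<theta>) \<le> (\<Sum>i\<in>I. m powr \<theta> * (\<theta> * (h i / m) + (1 - \<theta>)))"
    using h m \<theta> by (intro sum_mono powr_weighted_le) auto
  also have "\<dots> = m powr \<theta> * (\<theta> * (H / m) + (1 - \<theta>) * card I)"
    by (simp add: sum_distrib_left[symmetric] sum.distrib sum_divide_distrib[symmetric] H_def)
  also have "H / m = card I"
    using H c by (simp add: m_def)
  also have "m powr \<theta> * (\<theta> * card I + (1 - \<theta>) * card I) = real (card I) powr (1 - \<theta>) * H powr \<theta>"
    using H c by (simp add: m_def powr_divide powr_diff algebra_simps)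
  finally show ?thesis by (simp add: H_def)
qed

section \<open>Sums of sequences satisfying a recurrence with memory\<close>

lemma linear_recurrence_bound:
  fixes S :: "nat \<Rightarrow> real"
  assumes "S 0 = 0" "0 \<le> q" "\<And>k. k < n \<Longrightarrow> S (Suc k) \<le> q * S k + t"
  shows "S n \<le> t * (\<Sum>i<n. q ^ i)"
  using assms(3)
proof (induction n)
  case (Suc n)
  have "S (Suc n) \<le> q * S n + t" using Suc.prems by auto
  also have "\<dots> \<le> q * (t * (\<Sum>i<n. q ^ i)) + t"
    using Suc assms(2) by (auto intro!: mult_left_mono)
  also have "\<dots> = t * (\<Sum>i<Suc n. q ^ i)"
    by (simp add: sum.lessThan_Suc_shift sum_distrib_left algebra_simps del: sum.lessThan_Suc)
  finally show ?case .
qed (use assms in auto)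

text \<open>After exchanging the sums, each a_j is charged at most the total weight R. The right
  side stops at m although k runs to m + 1, because the k-th term involves only j < k; this shift
  yields a one-step recurrence for partial sums.\<close>

lemma sum_convolution_le:
  fixes \<rho> a :: "nat \<Rightarrow> real"
  assumes \<rho>: "\<And>l. l \<in> {1..n} \<Longrightarrow> 0 \<le> \<rho> l" and a: "\<And>k. k \<in> {1..n} \<Longrightarrow> 0 \<le> a k"
    and R: "(\<Sum>l=1..n. \<rho> l) \<le> R" and m: "m < n"
  shows "(\<Sum>k=1..Suc m. \<Sum>j=1..k-1. \<rho> (k - j) * a j) \<le> R * (\<Sum>j=1..m. a j)"
proof -
  have "(\<Sum>k=1..Suc m. \<Sum>j=1..k-1. \<rho> (k - j) * a j)
      = (\<Sum>k=1..Suc m. \<Sum>j=1..m. if j < k then \<rho> (k - j) * a j else 0)"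
    by (intro sum.cong refl sum.mono_neutral_cong_left) (auto split: if_splits)
  also have "\<dots> = (\<Sum>j=1..m. \<Sum>k=1..Suc m. if j < k then \<rho> (k - j) * a j else 0)"
    by (rule sum.swap)
  also have "\<dots> \<le> (\<Sum>j=1..m. R * a j)"
  proof (rule sum_mono)
    fix j assume j: "j \<in> {1..m}"
    have "(\<Sum>k=1..Suc m. if j < k then \<rho> (k - j) * a j else 0) = (\<Sum>k\<in>{j<..Suc m}. \<rho> (k - j) * a j)"
      using j by (intro sum.mono_neutral_cong_right) auto
    also have "\<dots> = (\<Sum>l\<in>{1..Suc m - j}. \<rho> l * a j)"
      using j by (intro sum.reindex_bij_witness[of _ "\<lambda>l. l + j" "\<lambda>k. k - j"]) auto
    also have "\<dots> \<le> (\<Sum>l=1..n. \<rho> l * a j)"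
      using m j \<rho> a by (intro sum_mono2) auto
    also have "\<dots> = (\<Sum>l=1..n. \<rho> l) * a j" by (simp add: sum_distrib_right)
    also have "\<dots> \<le> R * a j" using R a[of j] j m by (intro mult_right_mono) auto
    finally show "(\<Sum>k=1..Suc m. if j < k then \<rho> (k - j) * a j else 0) \<le> R * a j" .
  qed
  finally show ?thesis by (simp add: sum_distrib_left)
qed

text \<open>With every weight replaced by M, the memory term at k + 1 is at most l M times the
  partial sum S_k, so S_{k+1} \<le> (1 + l M) S_k + t.\<close>

lemma sum_bound_of_bounded_recurrence:
  fixes \<rho> a :: "nat \<Rightarrow> real"
  assumes \<rho>: "\<And>l. l \<in> {1..n} \<Longrightarrow> 0 \<le> \<rho> l \<and> \<rho> l \<le> M" and a: "\<And>k. k \<in> {1..n} \<Longrightarrow> 0 \<le> a k"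
    and M: "0 \<le> M" and l: "0 \<le> l"
    and rec: "\<And>k. k \<in> {1..n} \<Longrightarrow> a k \<le> l * (\<Sum>j=1..k-1. \<rho> (k - j) * a j) + t"
  shows "(\<Sum>k=1..n. a k) \<le> t * (\<Sum>i<n. (1 + l * M) ^ i)"
proof (rule linear_recurrence_bound)
  fix k assume k: "k < n"
  have "(\<Sum>j=1..k. \<rho> (Suc k - j) * a j) \<le> (\<Sum>j=1..k. M * a j)"
  proof (intro sum_mono mult_right_mono)
    fix j assume "j \<in> {1..k}"
    then have "Suc k - j \<in> {1..n}" "j \<in> {1..n}" using k by auto
    then show "\<rho> (Suc k - j) \<le> M" "0 \<le> a j" using \<rho> a by blast+
  qed
  then have "l * (\<Sum>j=1..k. \<rho> (Suc k - j) * a j) \<le> l * (M * (\<Sum>j=1..k. a j))"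
    using l by (intro mult_left_mono) (auto simp: sum_distrib_left)
  then show "(\<Sum>k=1..Suc k. a k) \<le> (1 + l * M) * (\<Sum>k=1..k. a k) + t"
    using rec[of "Suc k"] k by (simp add: algebra_simps)
qed (use M l in auto)

text \<open>Here the inequalities are summed first and then iterated, so the ratio is l R instead of
  1 + l R; this is what allows a bound uniform in the number of terms when l R < 1. The price is
  that the sum of all b_k enters at every step.\<close>

lemma sum_bound_of_summable_recurrence:
  fixes \<rho> a b :: "nat \<Rightarrow> real"
  assumes \<rho>: "\<And>l. l \<in> {1..n} \<Longrightarrow> 0 \<le> \<rho> l" and a: "\<And>k. k \<in> {1..n} \<Longrightarrow> 0 \<le> a k"
    and R: "(\<Sum>l=1..n. \<rho> l) \<le> R" and l: "0 \<le> l" and b: "\<And>k. k \<in> {1..n} \<Longrightarrow> 0 \<le> b k"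
    and rec: "\<And>k. k \<in> {1..n} \<Longrightarrow> a k \<le> l * (\<Sum>j=1..k-1. \<rho> (k - j) * a j) + b k"
  shows "(\<Sum>k=1..n. a k) \<le> (\<Sum>k=1..n. b k) * (\<Sum>i<n. (l * R) ^ i)"
proof (rule linear_recurrence_bound)
  have "0 \<le> (\<Sum>l=1..n. \<rho> l)" using \<rho> by (intro sum_nonneg) auto
  then show "0 \<le> l * R" using R l by auto
  fix m assume m: "m < n"
  have "(\<Sum>k=1..Suc m. a k) \<le> (\<Sum>k=1..Suc m. l * (\<Sum>j=1..k-1. \<rho> (k - j) * a j) + b k)"
    using m by (intro sum_mono rec) auto
  also have "\<dots> = l * (\<Sum>k=1..Suc m. \<Sum>j=1..k-1. \<rho> (k - j) * a j) + (\<Sum>k=1..Suc m. b k)"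
    by (simp only: sum.distrib sum_distrib_left)
  also have "\<dots> \<le> l * (R * (\<Sum>j=1..m. a j)) + (\<Sum>k=1..n. b k)"
    using sum_convolution_le[of n \<rho> a R m] \<rho> a b R m l
    by (intro add_mono mult_left_mono sum_mono2) auto
  finally show "(\<Sum>k=1..Suc m. a k) \<le> l * R * (\<Sum>k=1..m. a k) + (\<Sum>k=1..n. b k)"
    by (simp only: mult.assoc)
qed auto

section \<open>Geometric sums and the choice of the Young parameter\<close>

lemma geometric_sum_le:
  fixes q :: real
  assumes "1 < q"
  shows "(\<Sum>i<n. q ^ i) \<le> q ^ n / (q - 1)"
  using assms by (simp add: geometric_sum divide_right_mono)

lemma geometric_sum_le_lt_1:
  fixes q :: real
  assumes "0 \<le> q" "q < 1"
  shows "(\<Sum>i<n. q ^ i) \<le> 1 / (1 - q)"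
proof -
  have "(\<Sum>i<n. q ^ i) = (1 - q ^ n) / (1 - q)"
    using assms by (simp add: geometric_sum field_simps)
  also have "\<dots> \<le> 1 / (1 - q)"
    using assms by (intro divide_right_mono) auto
  finally show ?thesis .
qed

text \<open>This is (1 + 1/m)^i \<le> e^(i/m) \<le> e raised to the power s - 1, the origin of the
  powers of e in the constants.\<close>

lemma one_plus_inverse_powr_power_le:
  fixes s :: real
  assumes "1 \<le> s" "0 < m" "i \<le> m"
  shows "((1 + 1 / real m) powr (s - 1)) ^ i \<le> exp (s - 1)"
proof -
  have "(1 + 1 / real m) \<le> exp (1 / real m)"
    by (rule exp_ge_add_one_self)
  then have "(1 + 1 / real m) powr (s - 1) \<le> exp (1 / real m) powr (s - 1)"
    using assms by (intro powr_mono2) auto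
  then have "((1 + 1 / real m) powr (s - 1)) ^ i \<le> (exp (1 / real m) powr (s - 1)) ^ i"
    by (intro power_mono) auto
  also have "\<dots> = exp (real i / real m * (s - 1))"
    by (simp add: powr_def exp_of_nat_mult[symmetric] mult_ac)
  also have "\<dots> \<le> exp (s - 1)"
    using assms mult_right_mono[of "real i / real m" 1 "s - 1"] by simp
  finally show ?thesis .
qed

lemma sum_scaled_power_le:
  fixes s q :: real
  assumes "1 \<le> s" "0 < m" "n \<le> Suc m" "0 \<le> q"
  shows "(\<Sum>i<n. ((1 + 1 / real m) powr (s - 1) * q) ^ i) \<le> exp (s - 1) * (\<Sum>i<n. q ^ i)"
  unfolding power_mult_distrib sum_distrib_left using assms
  by (intro sum_mono mult_right_mono one_plus_inverse_powr_power_le) auto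

text \<open>The Young parameter \<open>1 / (n - 1)\<close> is the choice that produces the factor \<open>(n e)\<^sup>s\<^sup>-\<^sup>1\<close>.\<close>

lemma young_parameter_bounded:
  fixes s M :: real
  assumes s: "1 \<le> s" and n: "1 \<le> n" and M: "0 < M"
  obtains \<gamma> where "0 < \<gamma>"
    "(1 + 1 / \<gamma>) powr (s - 1) * (\<Sum>i<n. (1 + (1 + \<gamma>) powr (s - 1) * M) ^ i)
       \<le> (real n * exp 1) powr (s - 1) * ((1 + M) ^ n / M)"
\<comment> \<open>For n = 1 the value 1/(n - 1) does not exist; \<gamma> = 1 works, since the sum
  has a single term and 2 \<le> e.\<close>
proof (cases "n = 1")
  case True
  have "(2::real) powr (s - 1) \<le> exp 1 powr (s - 1)"
    using s exp_ge_add_one_self[of 1] by (intro powr_mono2) auto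
  then have "(2::real) powr (s - 1) * 1 \<le> exp 1 powr (s - 1) * ((1 + M) / M)"
    using M by (intro mult_mono) auto
  then show ?thesis using True by (intro that[of 1]) auto
next
  case False
  define m where "m = n - 1"
  have m: "0 < m" "n = Suc m" using n False by (auto simp: m_def)
  let ?l = "(1 + 1 / real m) powr (s - 1)"
  have l: "1 \<le> ?l" using s by (intro ge_one_powr_ge_zero) auto
  \<comment> \<open>As l \<ge> 1, the base 1 + l M is at most l (1 + M). The powers of l are then
    absorbed by e^(s-1), because the exponents do not exceed m = n - 1.\<close>
  have "(\<Sum>i<n. (1 + ?l * M) ^ i) \<le> (\<Sum>i<n. (?l * (1 + M)) ^ i)"
    using l M by (intro sum_mono power_mono) (auto simp: algebra_simps)
  also have "\<dots> \<le> exp (s - 1) * (\<Sum>i<n. (1 + M) ^ i)"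
    using s m M by (intro sum_scaled_power_le) auto
  also have "\<dots> \<le> exp (s - 1) * ((1 + M) ^ n / M)"
    using geometric_sum_le[of "1 + M" n] M by (intro mult_left_mono) auto
  finally have "real n powr (s - 1) * (\<Sum>i<n. (1 + ?l * M) ^ i) \<le> real n powr (s - 1) * (exp (s - 1) * ((1 + M) ^ n / M))"
    by (intro mult_left_mono) auto
  also have "\<dots> = (real n * exp 1) powr (s - 1) * ((1 + M) ^ n / M)"
    by (simp add: powr_mult exp_powr_real)
  finally show ?thesis
    using m by (intro that[of "1 / real m"]) auto
qed

text \<open>The choice \<gamma> = 1/n treats n = 1 like every other n and turns 1 + 1/\<gamma> into
  n + 1, the origin of n + 1 in the constants for R \<ge> 1.\<close>

lemma young_parameter_ge_1:
  fixes s R :: real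
  assumes s: "1 \<le> s" and n: "1 \<le> n" and R: "0 \<le> R"
  obtains \<gamma> where "0 < \<gamma>"
    "(1 + 1 / \<gamma>) powr (s - 1) * (\<Sum>i<n. ((1 + \<gamma>) powr (s - 1) * R) ^ i)
       \<le> real (n + 1) powr (s - 1) * (exp (s - 1) * (\<Sum>i<n. R ^ i))"
  using sum_scaled_power_le[of s n n R] assms
  by (intro that[of "1 / real n"]) (auto intro!: mult_left_mono simp: add.commute)

text \<open>With q = R^(1/s) and 1 + \<gamma> = 1/q the ratio (1 + \<gamma>)^(s-1) R collapses to q
  < 1, while 1 + 1/\<gamma> = 1/(1 - q). Prefactor and geometric series combine to (1 - q)^(-s). The
  value R = 0 would correspond to infinite \<gamma>.\<close>

lemma young_parameter_lt_1:
  fixes s R :: real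
  assumes s: "1 \<le> s" and R: "0 < R" "R < 1"
  obtains \<gamma> where "0 < \<gamma>"
    "(1 + 1 / \<gamma>) powr (s - 1) * (\<Sum>i<n. ((1 + \<gamma>) powr (s - 1) * R) ^ i) \<le> (1 - R powr (1 / s)) powr (- s)"
proof -
  define q where "q = R powr (1 / s)"
  have q: "0 < q" "q < 1"
    using R s powr_less_mono2[of "1 / s" R 1] by (auto simp: q_def)
  have Rq: "R = q powr s" using R s by (simp add: q_def powr_powr)
  define \<gamma> where "\<gamma> = 1 / q - 1"
  have \<gamma>: "0 < \<gamma>" using q by (simp add: \<gamma>_def)
  have "(1 + \<gamma>) powr (s - 1) * R = q"
    using q by (simp add: \<gamma>_def Rq powr_divide powr_diff)
  moreover have "1 + 1 / \<gamma> = 1 / (1 - q)"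
    using q by (simp add: \<gamma>_def field_simps)
  moreover have "(1 / (1 - q)) powr (s - 1) * (\<Sum>i<n. q ^ i) \<le> (1 / (1 - q)) powr (s - 1) * (1 / (1 - q))"
    using q by (intro mult_left_mono geometric_sum_le_lt_1) auto
  moreover have "(1 / (1 - q)) powr (s - 1) * (1 / (1 - q)) = (1 - q) powr (- s)"
    using q by (simp add: powr_divide powr_diff powr_minus field_simps)
  ultimately show ?thesis
    using \<gamma> by (intro that[of \<gamma>]) (auto simp: q_def)
qed

section \<open>Kernels and couplings given by densities\<close>

lemma nn_integral_prob_kernel[measurable (raw)]:
  assumes "(\<lambda>(x, y). f x y) \<in> borel_measurable (M \<Otimes>\<^sub>M N)" "K \<in> M \<rightarrow>\<^sub>M prob_algebra N"
  shows "(\<lambda>x. \<integral>\<^sup>+y. f x y \<partial>K x) \<in> borel_measurable M"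
  using assms by (intro nn_integral_measurable_subprob_algebra2 measurable_prob_algebraD)

lemma prob_kernelD:
  assumes "K \<in> M \<rightarrow>\<^sub>M prob_algebra N" "x \<in> space M"
  shows "prob_space (K x)" "sets (K x) = sets N" "space (K x) = space N"
  using measurable_space[OF assms] sets_eq_imp_space_eq by (auto simp: space_prob_algebra)

lemma measurable_density_kernel:
  assumes f: "(\<lambda>(x, y). f x y) \<in> borel_measurable (M \<Otimes>\<^sub>M N)" and K: "K \<in> M \<rightarrow>\<^sub>M prob_algebra N"
    and f1: "\<And>x. x \<in> space M \<Longrightarrow> (\<integral>\<^sup>+y. f x y \<partial>K x) = 1"
  shows "(\<lambda>x. density (K x) (f x)) \<in> M \<rightarrow>\<^sub>M prob_algebra N"
\<comment> \<open>The whole sigma-algebra serves as its own intersection-stable generator, so what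
  remains is measurability of each \<open>emeasure\<close>.\<close>
proof (rule measurable_prob_algebra_generated[OF sets.sigma_sets_eq[symmetric] sets.Int_stable sets.space_closed])
  note [measurable] = f K
  have m[measurable]: "f x \<in> borel_measurable (K x)" if "x \<in> space M" for x
  proof -
    have "(\<lambda>y. case (x, y) of (x, y) \<Rightarrow> f x y) \<in> borel_measurable N"
      using that f by (intro measurable_compose[OF _ f]) auto
    then show ?thesis
      using prob_kernelD[OF K that] by (simp cong: measurable_cong_sets)
  qed
  fix x assume x: "x \<in> space M"
  show "prob_space (density (K x) (f x))"
    using x f1[OF x] by (intro prob_spaceI) (simp add: emeasure_density cong: nn_integral_cong_simp)
  show "sets (density (K x) (f x)) = sets N"
    using prob_kernelD[OF K x] by simp
next
  fix A assume A[measurable]: "A \<in> sets N"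
  note [measurable] = f K
  have "(\<lambda>x. \<integral>\<^sup>+y. f x y * indicator A y \<partial>K x) \<in> borel_measurable M"
    by measurable
  moreover have "emeasure (density (K x) (f x)) A = (\<integral>\<^sup>+y. f x y * indicator A y \<partial>K x)" if x: "x \<in> space M" for x
  proof -
    have "(\<lambda>y. case (x, y) of (x, y) \<Rightarrow> f x y) \<in> borel_measurable N"
      using that f by (intro measurable_compose[OF _ f]) auto
    then show ?thesis
      using prob_kernelD[OF K x] A by (subst emeasure_density) (auto cong: measurable_cong_sets)
  qed
  ultimately show "(\<lambda>x. emeasure (density (K x) (f x)) A) \<in> borel_measurable M"
    by (simp cong: measurable_cong)
qed

text \<open>An infimum of countably many measurable functions is measurable, hence so is the first
  index that comes within e of it. The slack e guarantees that such an index exists even if the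
  infimum is not attained.\<close>

lemma kernel_almost_minimal_choice:
  fixes K :: "'i::countable \<Rightarrow> 'z \<Rightarrow> 'b measure"
  assumes K: "\<And>i. K i \<in> M \<rightarrow>\<^sub>M prob_algebra N" and c[measurable]: "c \<in> borel_measurable N"
    and e: "0 < (e::real)"
  obtains \<iota> where "(\<lambda>z. K (\<iota> z) z) \<in> M \<rightarrow>\<^sub>M prob_algebra N"
    "\<And>z i. z \<in> space M \<Longrightarrow> (\<integral>\<^sup>+y. c y \<partial>K (\<iota> z) z) \<le> (\<integral>\<^sup>+y. c y \<partial>K i z) + ennreal e"
proof -
  note [measurable] = K
  define F where "F i z = (\<integral>\<^sup>+y. c y \<partial>K i z)" for i z
  have [measurable]: "F i \<in> borel_measurable M" for i
    unfolding F_def by measurable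
  define I where "I z = (INF i. F i z)" for z
  have [measurable]: "I \<in> borel_measurable M"
    unfolding I_def by measurable
  define \<kappa> where "\<kappa> z = (LEAST n. F (from_nat n) z \<le> I z + ennreal e)" for z
  have [measurable]: "\<kappa> \<in> M \<rightarrow>\<^sub>M count_space UNIV"
    unfolding \<kappa>_def by measurable
  have ex: "\<exists>n. F (from_nat n) z \<le> I z + ennreal e" for z
  proof (cases "I z = \<top>")
    case False
    then have "I z < I z + ennreal e" using e by (simp add: less_top)
    then obtain i where "F i z < I z + ennreal e" unfolding I_def by (auto simp: INF_less_iff)
    then show ?thesis by (intro exI[of _ "to_nat i"]) auto
  qed auto
  have "F (from_nat (\<kappa> z)) z \<le> I z + ennreal e" for z
    unfolding \<kappa>_def by (rule LeastI_ex[OF ex])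
  moreover have "I z \<le> F i z" for z i
    unfolding I_def by (rule INF_lower) simp
  ultimately have "F (from_nat (\<kappa> z)) z \<le> F i z + ennreal e" for z i
    by (meson add_right_mono order_trans)
  moreover have "(\<lambda>z. K (from_nat (\<kappa> z)) z) \<in> M \<rightarrow>\<^sub>M prob_algebra N"
    by (rule measurable_compose_countable[where f="\<lambda>n. K (from_nat n)"]) measurable
  ultimately show ?thesis
    by (intro that[of "\<lambda>z. from_nat (\<kappa> z)"]) (auto simp: F_def)
qed

section \<open>Cells of a countable partition and densities constant on products of cells\<close>

definition cell :: "'b measure \<Rightarrow> ('b \<Rightarrow> nat) \<Rightarrow> nat \<Rightarrow> real" where
  "cell \<mu> idx i = measure \<mu> (idx -` {i} \<inter> space \<mu>)"

lemma cell_nonneg [simp]: "0 \<le> cell \<mu> idx i"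
  by (simp add: cell_def)

text \<open>Countably many cells of mass zero form a null set, so division by cell masses is
  harmless almost everywhere.\<close>

lemma AE_cell_pos:
  assumes "prob_space \<mu>" and [measurable]: "idx \<in> \<mu> \<rightarrow>\<^sub>M count_space UNIV"
  shows "AE u in \<mu>. 0 < cell \<mu> idx (idx u)"
proof -
  interpret prob_space \<mu> by fact
  have "AE u in \<mu>. idx u = i \<longrightarrow> 0 < cell \<mu> idx i" for i
  proof (cases "cell \<mu> idx i = 0")
    case True
    then have "idx -` {i} \<inter> space \<mu> \<in> null_sets \<mu>"
      by (auto simp: null_sets_def cell_def emeasure_eq_measure)
    then show ?thesis by (rule AE_I') (use True in auto)
  qed (simp add: less_le)
  then have "AE u in \<mu>. \<forall>i. idx u = i \<longrightarrow> 0 < cell \<mu> idx i"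
    by (intro AE_all_countable[THEN iffD2] allI)
  then show ?thesis by eventually_elim auto
qed

text \<open>Spreads the weights g over the cells proportionally to \<mu>. The weight must vanish on
  cells of mass zero, where the quotient has the default value 0 and would lose it.\<close>

lemma cell_integral:
  fixes g :: "nat \<Rightarrow> real"
  assumes "prob_space \<mu>" and [measurable]: "idx \<in> \<mu> \<rightarrow>\<^sub>M count_space UNIV"
    and g0: "\<And>j. t \<le> j \<Longrightarrow> g j = 0" "\<And>j. cell \<mu> idx j = 0 \<Longrightarrow> g j = 0"
  shows cell_integrable: "integrable \<mu> (\<lambda>u. g (idx u) / cell \<mu> idx (idx u))"
    and cell_integral_eq: "(\<integral>u. g (idx u) / cell \<mu> idx (idx u) \<partial>\<mu>) = (\<Sum>j<t. g j)"
proof -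
  interpret prob_space \<mu> by fact
  have eq: "g (idx u) / cell \<mu> idx (idx u)
      = (\<Sum>j<t. g j / cell \<mu> idx j * indicator (idx -` {j} \<inter> space \<mu>) u)" if "u \<in> space \<mu>" for u
  proof -
    have "(\<Sum>j<t. g j / cell \<mu> idx j * indicator (idx -` {j} \<inter> space \<mu>) u)
        = (\<Sum>j<t. if j = idx u then g (idx u) / cell \<mu> idx (idx u) else 0)"
      using that by (intro sum.cong) (auto split: split_indicator)
    then show ?thesis using g0(1)[of "idx u"] by (auto simp: sum.delta)
  qed
  have i: "integrable \<mu> (\<lambda>u. \<Sum>j<t. g j / cell \<mu> idx j * indicator (idx -` {j} \<inter> space \<mu>) u)"
    by (intro Bochner_Integration.integrable_sum integrable_mult_right integrable_real_indicator)
       (auto simp: less_top[symmetric])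
  then show "integrable \<mu> (\<lambda>u. g (idx u) / cell \<mu> idx (idx u))"
    by (subst Bochner_Integration.integrable_cong[OF refl eq])
  have "(\<integral>u. g (idx u) / cell \<mu> idx (idx u) \<partial>\<mu>)
      = (\<integral>u. (\<Sum>j<t. g j / cell \<mu> idx j * indicator (idx -` {j} \<inter> space \<mu>) u) \<partial>\<mu>)"
    by (intro Bochner_Integration.integral_cong refl eq)
  also have "\<dots> = (\<Sum>j<t. g j / cell \<mu> idx j * cell \<mu> idx j)"
    by (subst Bochner_Integration.integral_sum)
       (auto simp: cell_def less_top[symmetric] intro!: integrable_real_indicator)
  also have "\<dots> = (\<Sum>j<t. g j)"
    using g0(2) by (intro sum.cong) auto
  finally show "(\<integral>u. g (idx u) / cell \<mu> idx (idx u) \<partial>\<mu>) = (\<Sum>j<t. g j)" .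
qed

text \<open>By Tonelli the marginals only see the two partial integrals of w, and normalisation
  almost everywhere suffices. This matters because the densities used below are not normalised on
  cells of mass zero.\<close>

lemma density_in_couplings:
  assumes \<mu>: "prob_space \<mu>" "sets \<mu> = sets N" and \<nu>: "prob_space \<nu>" "sets \<nu> = sets N"
    and w: "w \<in> borel_measurable (N \<Otimes>\<^sub>M N)"
    and w1: "AE u in \<mu>. (\<integral>\<^sup>+v. w (u, v) \<partial>\<nu>) = 1" and w2: "AE v in \<nu>. (\<integral>\<^sup>+u. w (u, v) \<partial>\<mu>) = 1"
  shows "density (\<mu> \<Otimes>\<^sub>M \<nu>) w \<in> couplings N \<mu> \<nu>"
proof -
  interpret \<mu>: prob_space \<mu> by fact
  interpret \<nu>: prob_space \<nu> by fact
  interpret P: pair_prob_space \<mu> \<nu> ..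
  have s: "sets (\<mu> \<Otimes>\<^sub>M \<nu>) = sets (N \<Otimes>\<^sub>M N)"
    using \<mu> \<nu> by (intro sets_pair_measure_cong) auto
  note [measurable_cong] = \<mu>(2) \<nu>(2)
  have [measurable]: "w \<in> borel_measurable (\<mu> \<Otimes>\<^sub>M \<nu>)"
    using w s by (simp cong: measurable_cong_sets)
  have sp: "space \<mu> = space N" "space \<nu> = space N"
    using \<mu> \<nu> by (auto dest: sets_eq_imp_space_eq)
  let ?D = "density (\<mu> \<Otimes>\<^sub>M \<nu>) w"
  have sD: "sets ?D = sets (N \<Otimes>\<^sub>M N)" using s by simp
  have 1: "distr ?D N fst = \<mu>"
  proof (rule measure_eqI)
    fix A assume "A \<in> sets (distr ?D N fst)"
    then have A[measurable]: "A \<in> sets \<mu>" using \<mu> by simp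
    have "emeasure (distr ?D N fst) A = emeasure ?D (fst -` A \<inter> space ?D)"
      using A \<mu> sD by (subst emeasure_distr) (auto cong: measurable_cong_sets)
    also have "\<dots> = (\<integral>\<^sup>+z. w z * indicator A (fst z) \<partial>(\<mu> \<Otimes>\<^sub>M \<nu>))"
      by (subst emeasure_density) (auto intro!: nn_integral_cong split: split_indicator)
    also have "\<dots> = (\<integral>\<^sup>+u. \<integral>\<^sup>+v. w (u, v) * indicator A u \<partial>\<nu> \<partial>\<mu>)"
      by (subst \<nu>.nn_integral_fst[symmetric]) auto
    also have "\<dots> = (\<integral>\<^sup>+u. (\<integral>\<^sup>+v. w (u, v) \<partial>\<nu>) * indicator A u \<partial>\<mu>)"
      by (intro nn_integral_cong nn_integral_multc) auto
    also have "\<dots> = (\<integral>\<^sup>+u. indicator A u \<partial>\<mu>)"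
      using w1 by (intro nn_integral_cong_AE) (auto elim!: eventually_mono)
    finally show "emeasure (distr ?D N fst) A = emeasure \<mu> A" by simp
  qed (simp add: \<mu>)
  have 2: "distr ?D N snd = \<nu>"
  proof (rule measure_eqI)
    fix A assume "A \<in> sets (distr ?D N snd)"
    then have A[measurable]: "A \<in> sets \<nu>" using \<nu> by simp
    have "emeasure (distr ?D N snd) A = emeasure ?D (snd -` A \<inter> space ?D)"
      using A \<nu> sD by (subst emeasure_distr) (auto cong: measurable_cong_sets)
    also have "\<dots> = (\<integral>\<^sup>+z. w z * indicator A (snd z) \<partial>(\<mu> \<Otimes>\<^sub>M \<nu>))"
      by (subst emeasure_density) (auto intro!: nn_integral_cong split: split_indicator)
    also have "\<dots> = (\<integral>\<^sup>+v. \<integral>\<^sup>+u. w (u, v) * indicator A v \<partial>\<mu> \<partial>\<nu>)"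
      by (subst P.nn_integral_snd[symmetric]) auto
    also have "\<dots> = (\<integral>\<^sup>+v. (\<integral>\<^sup>+u. w (u, v) \<partial>\<mu>) * indicator A v \<partial>\<nu>)"
      by (intro nn_integral_cong nn_integral_multc) auto
    also have "\<dots> = (\<integral>\<^sup>+v. indicator A v \<partial>\<nu>)"
      using w2 by (intro nn_integral_cong_AE) (auto elim!: eventually_mono)
    finally show "emeasure (distr ?D N snd) A = emeasure \<nu> A" by simp
  qed (simp add: \<nu>)
  have "emeasure ?D (space ?D) = emeasure (distr ?D N fst) (space N)"
    using sD by (subst emeasure_distr) (auto cong: measurable_cong_sets simp: sp space_pair_measure intro!: arg_cong[where f="emeasure _"])
  also have "\<dots> = 1" unfolding 1 sp[symmetric] by (rule \<mu>.emeasure_space_1)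
  finally have "prob_space ?D" by (rule prob_spaceI)
  then show ?thesis using 1 2 sD by (simp add: couplings_def)
qed

text \<open>A sub-coupling \<open>c\<close> of two probability vectors \<open>p\<close>, \<open>q\<close>, supported on \<open>{..<t}\<times>{..<t}\<close>,
  is completed by the independent coupling of the residual masses; \<open>completion_density\<close> is the density
  of the result with respect to the product of \<open>p\<close> and \<open>q\<close>.\<close>

definition row_sum :: "nat \<Rightarrow> (nat \<Rightarrow> nat \<Rightarrow> real) \<Rightarrow> nat \<Rightarrow> real" where
  "row_sum t c i = (\<Sum>j<t. c i j)"

definition completion_density ::
  "nat \<Rightarrow> (nat \<Rightarrow> nat \<Rightarrow> real) \<Rightarrow> (nat \<Rightarrow> real) \<Rightarrow> (nat \<Rightarrow> real) \<Rightarrow> nat \<Rightarrow> nat \<Rightarrow> real" where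
  "completion_density t c p q i j = c i j / (p i * q j)
     + (1 - row_sum t c i / p i) * (1 - row_sum t (\<lambda>j i. c i j) j / q j) / (1 - (\<Sum>i<t. row_sum t c i))"

text \<open>The strict inequality for the total mass keeps the denominator in
  \<open>completion_density\<close> positive, so that an exhausted residual never has to be treated
  separately.\<close>

definition sub_coupling :: "nat \<Rightarrow> (nat \<Rightarrow> nat \<Rightarrow> real) \<Rightarrow> (nat \<Rightarrow> real) \<Rightarrow> (nat \<Rightarrow> real) \<Rightarrow> bool" where
  "sub_coupling t c p q \<longleftrightarrow> (\<forall>i j. 0 \<le> c i j) \<and> (\<forall>i j. t \<le> i \<or> t \<le> j \<longrightarrow> c i j = 0) \<and>
     (\<forall>i<t. row_sum t c i \<le> p i) \<and> (\<forall>j<t. row_sum t (\<lambda>j i. c i j) j \<le> q j) \<and> (\<Sum>i<t. row_sum t c i) < 1"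

lemma sum_row_sum_swap: "(\<Sum>i<t. row_sum t (\<lambda>j i. c i j) i) = (\<Sum>i<t. row_sum t c i)"
  unfolding row_sum_def by (rule sum.swap)

lemma sub_coupling_swap: "sub_coupling t c p q \<Longrightarrow> sub_coupling t (\<lambda>j i. c i j) q p"
  unfolding sub_coupling_def by (auto simp: sum_row_sum_swap[of t c])

lemma completion_swap: "completion_density t (\<lambda>j i. c i j) q p j i = completion_density t c p q i j"
  by (simp add: completion_density_def sum_row_sum_swap[of t c] mult.commute)

lemma sub_couplingD:
  assumes "sub_coupling t c p q" and pos: "\<And>i. 0 \<le> p i" "\<And>j. 0 \<le> q j"
  shows "\<And>i j. 0 \<le> c i j" "\<And>i j. t \<le> i \<Longrightarrow> c i j = 0" "\<And>i j. t \<le> j \<Longrightarrow> c i j = 0"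
    "\<And>i. 0 \<le> row_sum t c i" "\<And>i. row_sum t c i \<le> p i" "\<And>i. t \<le> i \<Longrightarrow> row_sum t c i = 0" "(\<Sum>i<t. row_sum t c i) < 1"
    "\<And>i j. p i = 0 \<Longrightarrow> c i j = 0"
proof -
  show *: "\<And>i j. 0 \<le> c i j" "\<And>i j. t \<le> i \<Longrightarrow> c i j = 0" "\<And>i j. t \<le> j \<Longrightarrow> c i j = 0"
    "(\<Sum>i<t. row_sum t c i) < 1"
    using assms(1) by (auto simp: sub_coupling_def)
  then show "\<And>i. 0 \<le> row_sum t c i" "\<And>i. t \<le> i \<Longrightarrow> row_sum t c i = 0" by (auto simp: row_sum_def intro!: sum_nonneg)
  show **: "\<And>i. row_sum t c i \<le> p i"
    subgoal for i using assms(1) *(2) pos(1)[of i] by (cases "i < t") (auto simp: sub_coupling_def row_sum_def) done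
  show "c i j = 0" if "p i = 0" for i j
  proof (cases "j < t")
    case True
    have "c i j \<le> row_sum t c i" unfolding row_sum_def using True * by (intro member_le_sum) auto
    then show ?thesis using **[of i] that *(1)[of i j] by auto
  qed (use * in auto)
qed

lemma completion_nonneg:
  assumes c: "sub_coupling t c p q" and pos: "\<And>i. 0 \<le> p i" "\<And>j. 0 \<le> q j"
  shows "0 \<le> completion_density t c p q i j"
proof -
  note A = sub_couplingD[OF c pos] and B = sub_couplingD[OF sub_coupling_swap[OF c] pos(2) pos(1)]
  have "row_sum t c i / p i \<le> 1" "row_sum t (\<lambda>j i. c i j) j / q j \<le> 1"
    using A(5)[of i] B(5)[of j] pos(1)[of i] pos(2)[of j] by (auto simp: divide_le_eq_1)
  then show ?thesis using A pos unfolding completion_density_def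
    by (intro add_nonneg_nonneg divide_nonneg_nonneg mult_nonneg_nonneg) (auto simp: less_imp_le)
qed

text \<open>With m the total mass, the matched part contributes row_i / p_i and the residual part (1
  - row_i / p_i)(1 - m)/(1 - m); these add up to 1. The other marginal follows through
  \<open>completion_swap\<close>.\<close>

lemma nn_integral_completion:
  assumes "prob_space \<nu>" and [measurable]: "idx \<in> \<nu> \<rightarrow>\<^sub>M count_space UNIV"
    and c: "sub_coupling t c p (cell \<nu> idx)" and p: "\<And>i. 0 \<le> p i" "0 < p i"
  shows "(\<integral>\<^sup>+v. ennreal (completion_density t c p (cell \<nu> idx) i (idx v)) \<partial>\<nu>) = 1"
proof -
  interpret prob_space \<nu> by fact
  let ?q = "cell \<nu> idx" and ?m = "\<Sum>i<t. row_sum t c i"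
  note A = sub_couplingD[OF c p(1) cell_nonneg]
    and B = sub_couplingD[OF sub_coupling_swap[OF c] cell_nonneg p(1)]
  have c0: "?q j = 0 \<Longrightarrow> c i j = 0" "?q j = 0 \<Longrightarrow> row_sum t (\<lambda>j i. c i j) j = 0" for i j
    using B(8)[of j] by (auto simp: row_sum_def)
  note i1 = cell_integrable[OF assms(1,2), of t "\<lambda>j. c i j"] cell_integral_eq[OF assms(1,2), of t "\<lambda>j. c i j"]
  note i2 = cell_integrable[OF assms(1,2), of t "row_sum t (\<lambda>j i. c i j)"]
    cell_integral_eq[OF assms(1,2), of t "row_sum t (\<lambda>j i. c i j)"]
  note I1 = i1[OF A(3) c0(1)] and I2 = i2[OF B(6) c0(2)]
  define f1 where "f1 v = c i (idx v) / ?q (idx v)" for v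
  define f2 where "f2 v = row_sum t (\<lambda>j i. c i j) (idx v) / ?q (idx v)" for v
  have f: "integrable \<nu> f1" "integrable \<nu> f2" "integral\<^sup>L \<nu> f1 = row_sum t c i" "integral\<^sup>L \<nu> f2 = ?m"
    using I1 I2 unfolding f1_def f2_def by (auto simp: row_sum_def[of t c i] sum_row_sum_swap[of t c])
  have eq: "completion_density t c p ?q i (idx v) = (1 / p i) * f1 v
      + ((1 - row_sum t c i / p i) / (1 - ?m)) * (1 - f2 v)" for v
    by (simp add: completion_density_def f1_def f2_def)
  have I: "integrable \<nu> (\<lambda>v. completion_density t c p ?q i (idx v))"
    unfolding eq using f
    by (intro Bochner_Integration.integrable_add integrable_mult_right Bochner_Integration.integrable_diff) auto
  have "(\<integral>v. completion_density t c p ?q i (idx v) \<partial>\<nu>) = (1 / p i) * row_sum t c i + ((1 - row_sum t c i / p i) / (1 - ?m)) * (1 - ?m)"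
    unfolding eq using f by (simp add: prob_space)
  also have "\<dots> = 1" using A(7) by simp
  finally show ?thesis
    using I completion_nonneg[OF c p(1) cell_nonneg] by (subst nn_integral_eq_integral) auto
qed

section \<open>Cost of completed sub-couplings\<close>

text \<open>The matched part costs exactly the sum of D i j against c. On the residual part D is
  dominated by 2 (e i + e j), and under an independent coupling such a sum sees only the two
  marginals; hence the error is twice the part of the \<open>e\<close>-moments that c fails to
  capture.\<close>

lemma nn_integral_completion_cost_le:
  fixes D :: "nat \<Rightarrow> nat \<Rightarrow> real" and e :: "nat \<Rightarrow> real"
  assumes \<mu>: "prob_space \<mu>" and [measurable]: "idx \<in> \<mu> \<rightarrow>\<^sub>M count_space UNIV"
    and \<nu>: "prob_space \<nu>" and [measurable]: "idx \<in> \<nu> \<rightarrow>\<^sub>M count_space UNIV"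
    and c: "sub_coupling t c (cell \<mu> idx) (cell \<nu> idx)"
    and D: "\<And>i j. 0 \<le> D i j" "\<And>i j. D i j \<le> 2 * (e i + e j)" and e: "\<And>i. 0 \<le> e i"
    and int: "integrable \<mu> (\<lambda>u. e (idx u))" "integrable \<nu> (\<lambda>v. e (idx v))"
  shows "(\<integral>\<^sup>+u. \<integral>\<^sup>+v. ennreal (D (idx u) (idx v) * completion_density t c (cell \<mu> idx) (cell \<nu> idx) (idx u) (idx v)) \<partial>\<nu> \<partial>\<mu>)
    \<le> ennreal ((\<Sum>i<t. \<Sum>j<t. D i j * c i j) +
        2 * (((\<integral>u. e (idx u) \<partial>\<mu>) - (\<Sum>i<t. e i * row_sum t c i))
           + ((\<integral>v. e (idx v) \<partial>\<nu>) - (\<Sum>j<t. e j * row_sum t (\<lambda>j i. c i j) j))))"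
proof -
  interpret \<mu>: prob_space \<mu> by fact
  interpret \<nu>: prob_space \<nu> by fact
  let ?p = "cell \<mu> idx" and ?q = "cell \<nu> idx" and ?m = "\<Sum>i<t. row_sum t c i"
  let ?row = "row_sum t c" and ?col = "row_sum t (\<lambda>j i. c i j)"
  note A = sub_couplingD[OF c cell_nonneg cell_nonneg]
    and B = sub_couplingD[OF sub_coupling_swap[OF c] cell_nonneg cell_nonneg]
  define \<kappa> where "\<kappa> = 1 / (1 - ?m)"
  have \<kappa>: "0 \<le> \<kappa>" "\<kappa> * (1 - ?m) = 1" using A(7) by (auto simp: \<kappa>_def)
  \<comment> \<open>The part of the \<open>e\<close>-moment of \<nu> left over by the column sums of
    c.\<close>
  define X where "X = (\<integral>v. e (idx v) \<partial>\<nu>) - (\<Sum>j<t. e j * ?col j)"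
  define f2 where "f2 v = ?col (idx v) / ?q (idx v)" for v
  define f3 where "f3 v = e (idx v) * ?col (idx v) / ?q (idx v)" for v
  have f2: "integrable \<nu> f2" "integral\<^sup>L \<nu> f2 = ?m"
    unfolding f2_def using cell_integrable[OF \<nu> assms(4), of t ?col] cell_integral_eq[OF \<nu> assms(4), of t ?col] B(6,8)
    by (auto simp: row_sum_def sum_row_sum_swap[of t c, unfolded row_sum_def])
  have f3: "integrable \<nu> f3" "integral\<^sup>L \<nu> f3 = (\<Sum>j<t. e j * ?col j)"
    unfolding f3_def using cell_integrable[OF \<nu> assms(4), of t "\<lambda>j. e j * ?col j"]
      cell_integral_eq[OF \<nu> assms(4), of t "\<lambda>j. e j * ?col j"] B(6,8)
    by (auto simp: row_sum_def)
  define g1 where "g1 u = (\<Sum>j<t. D (idx u) j * c (idx u) j) / ?p (idx u)" for u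
  define g2 where "g2 u = ?row (idx u) / ?p (idx u)" for u
  define g3 where "g3 u = e (idx u) * ?row (idx u) / ?p (idx u)" for u
  have g1: "integrable \<mu> g1" "integral\<^sup>L \<mu> g1 = (\<Sum>i<t. \<Sum>j<t. D i j * c i j)"
    unfolding g1_def using cell_integrable[OF \<mu> assms(2), of t "\<lambda>i. \<Sum>j<t. D i j * c i j"]
      cell_integral_eq[OF \<mu> assms(2), of t "\<lambda>i. \<Sum>j<t. D i j * c i j"] A(2,8)
    by auto
  have g2: "integrable \<mu> g2" "integral\<^sup>L \<mu> g2 = ?m"
    unfolding g2_def using cell_integrable[OF \<mu> assms(2), of t ?row] cell_integral_eq[OF \<mu> assms(2), of t ?row] A(6,8)
    by (auto simp: row_sum_def)
  have g3: "integrable \<mu> g3" "integral\<^sup>L \<mu> g3 = (\<Sum>i<t. e i * ?row i)"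
    unfolding g3_def using cell_integrable[OF \<mu> assms(2), of t "\<lambda>j. e j * ?row j"]
      cell_integral_eq[OF \<mu> assms(2), of t "\<lambda>j. e j * ?row j"] A(6,8)
    by (auto simp: row_sum_def)
  define G where "G u = g1 u + 2 * ((e (idx u) - g3 u) + \<kappa> * X * (1 - g2 u))" for u
  have G: "integrable \<mu> G" "integral\<^sup>L \<mu> G = (\<Sum>i<t. \<Sum>j<t. D i j * c i j)
      + 2 * (((\<integral>u. e (idx u) \<partial>\<mu>) - (\<Sum>i<t. e i * ?row i)) + \<kappa> * X * (1 - ?m))"
    unfolding G_def using g1 g2 g3 int by (auto simp: \<mu>.prob_space)
  have inner: "AE u in \<mu>. (\<integral>\<^sup>+v. ennreal (D (idx u) (idx v) * completion_density t c ?p ?q (idx u) (idx v)) \<partial>\<nu>) \<le> ennreal (G u) \<and> 0 \<le> G u"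
    using AE_cell_pos[OF \<mu> assms(2)]
  proof eventually_elim
    fix u assume u: "0 < ?p (idx u)"
    define i where "i = idx u"
    define f1 where "f1 v = D i (idx v) * c i (idx v) / ?q (idx v)" for v
    have f1: "integrable \<nu> f1" "integral\<^sup>L \<nu> f1 = (\<Sum>j<t. D i j * c i j)"
      unfolding f1_def using cell_integrable[OF \<nu> assms(4), of t "\<lambda>j. D i j * c i j"]
      cell_integral_eq[OF \<nu> assms(4), of t "\<lambda>j. D i j * c i j"] A(3) B(8) by auto
    \<comment> \<open>Majorant of the integrand for a fixed u: the matched cost is kept, and D is
      replaced by its bound on the residual part. It splits into functions of v whose integrals are
      known, giving \<open>G u\<close>.\<close>
    define h where "h v = (1 / ?p i) * f1 v + 2 * \<kappa> * (1 - g2 u) * (e i * (1 - f2 v) + (e (idx v) - f3 v))" for v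
    have h: "integrable \<nu> h"
      unfolding h_def using f1 f2 f3 int by simp
    have "integral\<^sup>L \<nu> h = (1 / ?p i) * (\<Sum>j<t. D i j * c i j) + 2 * \<kappa> * (1 - g2 u) * (e i * (1 - ?m) + X)"
      unfolding h_def X_def using f1 f2 f3 int by (simp add: \<nu>.prob_space)
    also have "\<dots> = g1 u + 2 * ((\<kappa> * (1 - ?m)) * (1 - g2 u) * e i + \<kappa> * X * (1 - g2 u))"
      by (simp add: g1_def i_def algebra_simps)
    also have "\<dots> = G u"
      unfolding \<kappa>(2) G_def by (simp add: g2_def g3_def i_def algebra_simps)
    finally have hG: "integral\<^sup>L \<nu> h = G u" .
    have le: "D i (idx v) * completion_density t c ?p ?q i (idx v) \<le> h v" for v
    proof -
      have "0 \<le> \<kappa> * (1 - g2 u) * (1 - f2 v)"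
        using \<kappa>(1) A(5)[of i] B(5)[of "idx v"] cell_nonneg[of \<nu> idx "idx v"] u
        by (intro mult_nonneg_nonneg) (auto simp: g2_def f2_def i_def divide_le_eq_1 less_le simp del: cell_nonneg)
      then have "D i (idx v) * (\<kappa> * (1 - g2 u) * (1 - f2 v)) \<le> 2 * (e i + e (idx v)) * (\<kappa> * (1 - g2 u) * (1 - f2 v))"
        by (intro mult_right_mono D)
      moreover have "completion_density t c ?p ?q i (idx v) = c i (idx v) / (?p i * ?q (idx v)) + \<kappa> * (1 - g2 u) * (1 - f2 v)"
        by (simp add: completion_density_def f2_def g2_def \<kappa>_def i_def)
      moreover have "f3 v = e (idx v) * f2 v" by (simp add: f3_def f2_def)
      then have "h v = D i (idx v) * (c i (idx v) / (?p i * ?q (idx v))) + 2 * (e i + e (idx v)) * (\<kappa> * (1 - g2 u) * (1 - f2 v))"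
        by (simp add: h_def f1_def right_diff_distrib left_diff_distrib distrib_left distrib_right mult_ac)
      ultimately show ?thesis by (simp add: distrib_left)
    qed
    have pos: "0 \<le> h v" for v
      using le[of v] D(1)[of i "idx v"] completion_nonneg[OF c cell_nonneg cell_nonneg, of i "idx v"]
      by (meson mult_nonneg_nonneg order_trans)
    have "(\<integral>\<^sup>+v. ennreal (D i (idx v) * completion_density t c ?p ?q i (idx v)) \<partial>\<nu>) \<le> (\<integral>\<^sup>+v. ennreal (h v) \<partial>\<nu>)"
      by (intro nn_integral_mono ennreal_leI le)
    also have "\<dots> = ennreal (G u)"
      using h pos hG by (subst nn_integral_eq_integral) auto
    finally show "(\<integral>\<^sup>+v. ennreal (D (idx u) (idx v) * completion_density t c ?p ?q (idx u) (idx v)) \<partial>\<nu>) \<le> ennreal (G u) \<and> 0 \<le> G u"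
      using Bochner_Integration.integral_nonneg[of \<nu> h] hG pos by (auto simp: i_def)
  qed
  then have "(\<integral>\<^sup>+u. \<integral>\<^sup>+v. ennreal (D (idx u) (idx v) * completion_density t c ?p ?q (idx u) (idx v)) \<partial>\<nu> \<partial>\<mu>) \<le> (\<integral>\<^sup>+u. ennreal (G u) \<partial>\<mu>)"
    by (intro nn_integral_mono_AE) (auto elim!: eventually_mono)
  also have "\<dots> = ennreal (integral\<^sup>L \<mu> G)"
    using G(1) inner by (intro nn_integral_eq_integral) (auto elim!: eventually_mono)
  also have "\<kappa> * X * (1 - ?m) = X" using \<kappa>(2) by (simp add: mult.commute mult.left_commute)
  then have "integral\<^sup>L \<mu> G = (\<Sum>i<t. \<Sum>j<t. D i j * c i j) + 2 * (((\<integral>u. e (idx u) \<partial>\<mu>) - (\<Sum>i<t. e i * ?row i)) + X)"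
    using G(2) by simp
  finally show ?thesis by (simp add: X_def)
qed

text \<open>Encoding entries by lists of naturals over the common denominator t + 1 makes the index
  (t, L) range over a countable type, as \<open>kernel_almost_minimal_choice\<close>
  requires.\<close>

definition lattice_matrix :: "nat \<Rightarrow> nat list list \<Rightarrow> nat \<Rightarrow> nat \<Rightarrow> real" where
  "lattice_matrix t L i j = (if i < t \<and> j < t then real (L ! i ! j) / real (Suc t) else 0)"

text \<open>Truncating and rounding down gives sub-couplings converging pointwise to C, and
  dominated convergence upgrades this to the \<open>e\<close>-moments. The last conclusion says that
  the uncaptured moment, which controls the residual cost, is at most \<epsilon>.\<close>

lemma lattice_matrix_approx:
  fixes C :: "(nat \<times> nat) pmf" and e :: "nat \<Rightarrow> real"
  assumes e: "\<And>i. 0 \<le> e i" and int: "integrable C (\<lambda>z. e (fst z))" "integrable C (\<lambda>z. e (snd z))"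
    and eps: "0 < (\<epsilon>::real)"
  obtains t L where "sub_coupling t (lattice_matrix t L) (pmf (map_pmf fst C)) (pmf (map_pmf snd C))"
    "\<And>i j. lattice_matrix t L i j \<le> pmf C (i, j)"
    "(\<integral>z. e (fst z) + e (snd z) \<partial>C) - \<epsilon> \<le> (\<Sum>i<t. \<Sum>j<t. (e i + e j) * lattice_matrix t L i j)"
proof -
  \<comment> \<open>Rounding t C(i, j) down but dividing by t + 1 leaves at most t/(t + 1) of the
    mass, which yields the strict inequality in \<open>sub_coupling\<close>.\<close>
  define L where "L t = map (\<lambda>i. map (\<lambda>j. nat \<lfloor>real t * pmf C (i, j)\<rfloor>) [0..<t]) [0..<t]" for t
  define c where "c t = lattice_matrix t (L t)" for t
  have c_eq: "c t i j = (if i < t \<and> j < t then real_of_int \<lfloor>real t * pmf C (i, j)\<rfloor> / real (Suc t) else 0)" for t i j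
    by (auto simp: c_def lattice_matrix_def L_def)
  have c_nonneg: "0 \<le> c t i j" for t i j
    by (simp add: c_eq)
  have c_le': "c t i j \<le> real t / real (Suc t) * pmf C (i, j)" for t i j
    by (auto simp: c_eq intro!: divide_right_mono)
  have c_le: "c t i j \<le> pmf C (i, j)" for t i j
  proof -
    have "real t / real (Suc t) * pmf C (i, j) \<le> 1 * pmf C (i, j)" by (intro mult_right_mono) auto
    then show ?thesis using c_le'[of t i j] by simp
  qed
  have finite_sum: "(\<Sum>z\<in>A. pmf C z) = measure C A" if "finite A" for A
    using that by (simp add: measure_measure_pmf_finite)
  have row: "row_sum t (c t) i \<le> pmf (map_pmf fst C) i" for t i
  proof -
    have "row_sum t (c t) i \<le> (\<Sum>j<t. pmf C (i, j))"
      unfolding row_sum_def by (intro sum_mono c_le)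
    also have "\<dots> = (\<Sum>z\<in>{i} \<times> {..<t}. pmf C z)"
      by (intro sum.reindex_bij_witness[of _ snd "Pair i"]) auto
    also have "\<dots> \<le> measure C (fst -` {i})"
      by (subst finite_sum) (auto intro!: measure_pmf.finite_measure_mono)
    finally show ?thesis by (simp add: pmf_map)
  qed
  have col: "row_sum t (\<lambda>j i. c t i j) j \<le> pmf (map_pmf snd C) j" for t j
  proof -
    have "row_sum t (\<lambda>j i. c t i j) j \<le> (\<Sum>i<t. pmf C (i, j))"
      unfolding row_sum_def by (intro sum_mono c_le)
    also have "\<dots> = (\<Sum>z\<in>{..<t} \<times> {j}. pmf C z)"
      by (intro sum.reindex_bij_witness[of _ fst "\<lambda>i. (i, j)"]) auto
    also have "\<dots> \<le> measure C (snd -` {j})"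
      by (subst finite_sum) (auto intro!: measure_pmf.finite_measure_mono)
    finally show ?thesis by (simp add: pmf_map)
  qed
  have mass: "(\<Sum>i<t. row_sum t (c t) i) < 1" for t
  proof -
    have "(\<Sum>i<t. row_sum t (c t) i) \<le> (\<Sum>i<t. \<Sum>j<t. real t / real (Suc t) * pmf C (i, j))"
      unfolding row_sum_def by (intro sum_mono c_le')
    also have "\<dots> = real t / real (Suc t) * (\<Sum>z\<in>{..<t} \<times> {..<t}. pmf C z)"
      by (simp add: sum_distrib_left sum.cartesian_product split_beta)
    also have "\<dots> \<le> real t / real (Suc t) * 1"
      by (intro mult_left_mono) (auto simp: finite_sum)
    also have "\<dots> < 1" by simp
    finally show ?thesis .
  qed
  have sub: "sub_coupling t (c t) (pmf (map_pmf fst C)) (pmf (map_pmf snd C))" for t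
    using row col mass c_nonneg by (auto simp: sub_coupling_def c_eq)
  let ?F = "\<lambda>z. e (fst z) + e (snd z)"
  \<comment> \<open>The fraction of C(z) captured at stage t; it lies in [0, 1] and tends to 1 on
    the support of C, so the \<open>e\<close>-weight itself is the dominating function.\<close>
  define \<theta> where "\<theta> t z = c t (fst z) (snd z) / pmf C z" for t z
  have th: "(\<Sum>i<t. \<Sum>j<t. (e i + e j) * c t i j) = (\<integral>z. ?F z * \<theta> t z \<partial>C)" for t
  proof -
    have "(\<integral>z. ?F z * \<theta> t z \<partial>C) = (\<Sum>z\<in>{..<t} \<times> {..<t}. (?F z * \<theta> t z) * pmf C z)"
      by (rule integral_measure_pmf_real) (auto simp: \<theta>_def c_eq split: if_splits)
    also have "\<dots> = (\<Sum>z\<in>{..<t} \<times> {..<t}. ?F z * c t (fst z) (snd z))"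
    proof (intro sum.cong refl)
      fix z show "?F z * \<theta> t z * pmf C z = ?F z * c t (fst z) (snd z)"
        using c_le[of t "fst z" "snd z"] c_nonneg[of t "fst z" "snd z"] by (auto simp: \<theta>_def)
    qed
    finally show ?thesis by (simp add: sum.cartesian_product split_beta)
  qed
  have "(\<lambda>t. \<integral>z. ?F z * \<theta> t z \<partial>C) \<longlonglongrightarrow> (\<integral>z. ?F z \<partial>C)"
  proof (rule integral_dominated_convergence)
    show "AE z in C. (\<lambda>t. ?F z * \<theta> t z) \<longlonglongrightarrow> ?F z"
    proof (rule AE_pmfI)
      fix z assume "z \<in> set_pmf C"
      then have x: "0 < pmf C z" by (simp add: pmf_positive)
      have "(\<lambda>t. \<theta> t z) \<longlonglongrightarrow> 1"
      proof (rule tendsto_sandwich)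
        have "\<forall>\<^sub>F t in sequentially. fst z < t \<and> snd z < t"
          by (intro eventually_conj eventually_gt_at_top)
        then show "\<forall>\<^sub>F t in sequentially. (real t * pmf C z - 1) / real (Suc t) / pmf C z \<le> \<theta> t z"
          by eventually_elim (use x in \<open>auto simp: \<theta>_def c_eq intro!: divide_right_mono\<close>, linarith?)
        show "\<forall>\<^sub>F t in sequentially. \<theta> t z \<le> 1"
          using c_le[of _ "fst z" "snd z"] x by (auto simp: \<theta>_def divide_le_eq_1)
        have "(\<lambda>t. (real t * y - 1) / real (Suc t) / y) \<longlonglongrightarrow> 1" if "0 < y" for y :: real
          using that by real_asymp
        from this[OF x] show "(\<lambda>t. (real t * pmf C z - 1) / real (Suc t) / pmf C z) \<longlonglongrightarrow> 1" .
      qed auto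
      then show "(\<lambda>t. ?F z * \<theta> t z) \<longlonglongrightarrow> ?F z"
        using tendsto_mult[OF tendsto_const, of "\<lambda>t. \<theta> t z" 1 _ "?F z"] by simp
    qed
    show "integrable C ?F" using int by auto
    show "AE z in C. norm (?F z * \<theta> t z) \<le> ?F z" for t
    proof (rule AE_I2)
      fix z
      have "0 \<le> \<theta> t z" "\<theta> t z \<le> 1"
        using c_le[of t "fst z" "snd z"] c_nonneg[of t "fst z" "snd z"]
        by (auto simp: \<theta>_def divide_le_eq_1 less_le)
      then show "norm (?F z * \<theta> t z) \<le> ?F z"
        using e[of "fst z"] e[of "snd z"] by (simp add: abs_mult mult_left_le)
    qed
  qed auto
  then have "\<forall>\<^sub>F t in sequentially. (\<integral>z. ?F z \<partial>C) - \<epsilon> < (\<integral>z. ?F z * \<theta> t z \<partial>C)"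
    using eps by (intro order_tendstoD) auto
  then obtain t where "(\<integral>z. ?F z \<partial>C) - \<epsilon> < (\<integral>z. ?F z * \<theta> t z \<partial>C)"
    by (auto simp: eventually_sequentially)
  then show ?thesis
    using sub[of t] c_le[of t] th[of t] by (intro that[of t "L t"]) (auto simp: c_def)
qed

section \<open>Measurable choice of almost optimal couplings\<close>

abbreviation transport_cost :: "real \<Rightarrow> ('a::metric_space \<times> 'a) measure \<Rightarrow> ennreal" where
  "transport_cost s \<pi> \<equiv> \<integral>\<^sup>+z. ennreal (dist (fst z) (snd z) powr s) \<partial>\<pi>"

abbreviation coordinate_cost ::
  "real \<Rightarrow> nat \<Rightarrow> ((nat \<Rightarrow> 'a::metric_space) \<times> (nat \<Rightarrow> 'a)) measure \<Rightarrow> ennreal" where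
  "coordinate_cost s j \<pi> \<equiv> \<integral>\<^sup>+z. ennreal (dist (fst z j) (snd z j) powr s) \<partial>\<pi>"

abbreviation moment :: "real \<Rightarrow> 'a::metric_space \<Rightarrow> 'a measure \<Rightarrow> ennreal" where
  "moment s x \<mu> \<equiv> \<integral>\<^sup>+u. ennreal (dist u x powr s) \<partial>\<mu>"

section \<open>Discretised couplings and their gluing\<close>

lemma countable_prob_space_pmf:
  fixes M :: "'i::countable measure"
  assumes "prob_space M" "sets M = UNIV"
  obtains P where "measure_pmf P = M"
proof -
  interpret prob_space M by fact
  have sp: "space M = UNIV" using assms(2) sets_eq_imp_space_eq[of M "count_space UNIV"] by simp
  have "AE x in M. x = y \<longrightarrow> measure M {x} \<noteq> 0" for y
  proof (cases "measure M {y} = 0")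
    case True
    then have "{y} \<in> null_sets M" using assms(2) by (auto simp: null_sets_def emeasure_eq_measure)
    then show ?thesis by (rule AE_I') (use True in auto)
  qed auto
  then have "AE x in M. \<forall>y. x = y \<longrightarrow> measure M {x} \<noteq> 0"
    by (intro AE_all_countable[THEN iffD2] allI)
  then have "AE x in M. measure M {x} \<noteq> 0" by simp
  then show ?thesis
    using assms by (intro that[of "Abs_pmf M"] Abs_pmf_inverse) auto
qed

lemma pmf_eq_cell:
  assumes "prob_space \<mu>" and idx: "idx \<in> \<mu> \<rightarrow>\<^sub>M count_space UNIV" and "measure_pmf p = distr \<mu> (count_space UNIV) idx"
  shows "pmf p = cell \<mu> idx"
  using assms by (auto simp: fun_eq_iff cell_def pmf.rep_eq measure_distr)

lemma pair_idx_measurable: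
  fixes idx :: "'b \<Rightarrow> nat"
  assumes [measurable]: "idx \<in> N \<rightarrow>\<^sub>M count_space UNIV"
  shows "(\<lambda>z. (idx (fst z), idx (snd z))) \<in> N \<Otimes>\<^sub>M N \<rightarrow>\<^sub>M count_space UNIV"
proof -
  have "(\<lambda>z. (idx (fst z), idx (snd z))) \<in> N \<Otimes>\<^sub>M N \<rightarrow>\<^sub>M count_space UNIV \<Otimes>\<^sub>M count_space UNIV"
    by measurable
  then show ?thesis by (simp add: pair_measure_countable)
qed

lemma coupling_pmf:
  fixes idx :: "'b \<Rightarrow> nat"
  assumes idx[measurable]: "idx \<in> N \<rightarrow>\<^sub>M count_space UNIV" and \<pi>: "\<pi> \<in> couplings N \<mu> \<nu>"
  obtains C where "measure_pmf C = distr \<pi> (count_space UNIV) (\<lambda>z. (idx (fst z), idx (snd z)))"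
    "measure_pmf (map_pmf fst C) = distr \<mu> (count_space UNIV) idx"
    "measure_pmf (map_pmf snd C) = distr \<nu> (count_space UNIV) idx"
proof -
  have *: "prob_space \<pi>" and s[measurable_cong]: "sets \<pi> = sets (N \<Otimes>\<^sub>M N)" and d: "distr \<pi> N fst = \<mu>" "distr \<pi> N snd = \<nu>"
    using \<pi> by (auto simp: couplings_def)
  interpret prob_space \<pi> by fact
  have m[measurable]: "(\<lambda>z. (idx (fst z), idx (snd z))) \<in> \<pi> \<rightarrow>\<^sub>M count_space UNIV"
    using pair_idx_measurable[OF idx] by (simp cong: measurable_cong_sets add: s)
  obtain C where C: "measure_pmf C = distr \<pi> (count_space UNIV) (\<lambda>z. (idx (fst z), idx (snd z)))"
    by (rule countable_prob_space_pmf[of "distr \<pi> (count_space UNIV) (\<lambda>z. (idx (fst z), idx (snd z)))"])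
       (auto intro: prob_space_distr)
  have "measure_pmf (map_pmf fst C) = distr \<pi> (count_space UNIV) (\<lambda>z. idx (fst z))"
    by (simp add: map_pmf_rep_eq C distr_distr comp_def)
  also have "\<dots> = distr \<mu> (count_space UNIV) idx"
    by (simp add: d(1)[symmetric] distr_distr comp_def)
  finally have 1: "measure_pmf (map_pmf fst C) = distr \<mu> (count_space UNIV) idx" .
  have "measure_pmf (map_pmf snd C) = distr \<pi> (count_space UNIV) (\<lambda>z. idx (snd z))"
    by (simp add: map_pmf_rep_eq C distr_distr comp_def)
  also have "\<dots> = distr \<nu> (count_space UNIV) idx"
    by (simp add: d(2)[symmetric] distr_distr comp_def)
  finally show ?thesis using C 1 by (intro that[of C]) auto
qed

text \<open>Draw (i, j) from C1, then k from C2 conditioned on its first coordinate being j. The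
  common middle marginal ensures that every j drawn has positive probability under C2, so the
  conditional law is meaningful.\<close>

lemma pmf_gluing:
  fixes C1 :: "('i \<times> 'j) pmf" and C2 :: "('j \<times> 'k) pmf"
  assumes eq: "map_pmf snd C1 = map_pmf fst C2"
  obtains T where "map_pmf (\<lambda>(i, j, k). (i, j)) T = C1" "map_pmf (\<lambda>(i, j, k). (j, k)) T = C2"
proof -
  define Q where "Q j = cond_pmf C2 {z. fst z = j}" for j
  define T where "T = bind_pmf C1 (\<lambda>z. map_pmf (\<lambda>w. (fst z, snd z, snd w)) (Q (snd z)))"
  have ne: "set_pmf C2 \<inter> {z. fst z = j} \<noteq> {}" if "j \<in> set_pmf (map_pmf fst C2)" for j
    using that by auto
  have 1: "map_pmf (\<lambda>(i, j, k). (i, j)) T = C1"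
    by (simp add: T_def map_bind_pmf map_pmf_comp bind_return_pmf')
  have "map_pmf (\<lambda>(i, j, k). (j, k)) T = bind_pmf C1 (\<lambda>z. map_pmf (\<lambda>w. (snd z, snd w)) (Q (snd z)))"
    by (simp add: T_def map_bind_pmf map_pmf_comp)
  also have "\<dots> = bind_pmf (map_pmf snd C1) (\<lambda>j. map_pmf (\<lambda>w. (j, snd w)) (Q j))"
    by (simp add: bind_map_pmf)
  also have "\<dots> = bind_pmf (map_pmf fst C2) (\<lambda>j. Q j)"
    unfolding eq
  proof (intro bind_pmf_cong refl)
    fix j assume "j \<in> set_pmf (map_pmf fst C2)"
    from set_cond_pmf[OF ne[OF this]]
    have "map_pmf (\<lambda>w. (j, snd w)) (Q j) = map_pmf id (Q j)"
      unfolding Q_def by (intro map_pmf_cong) auto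
    then show "map_pmf (\<lambda>w. (j, snd w)) (Q j) = Q j" by simp
  qed
  also have "\<dots> = C2"
    unfolding Q_def
  proof (rule bind_cond_pmf_cancel)
    fix j :: 'j and z :: "'j \<times> 'k" assume "fst z = j"
    then show "measure C2 {y. fst y = j} = measure (map_pmf fst C2) {x. fst z = x}"
      by (auto simp: measure_map_pmf vimage_def intro!: arg_cong[where f="measure _"])
  qed auto
  finally show ?thesis using 1 by (rule that[rotated])
qed

section \<open>Meshes and the countable family of mesh kernels\<close>

text \<open>Taking the least index makes the balls around the points \<open>a i\<close> disjoint:
  cell i is the i-th ball minus the earlier ones.\<close>

definition mesh :: "(nat \<Rightarrow> 'a::metric_space) \<Rightarrow> real \<Rightarrow> 'a \<Rightarrow> nat" where
  "mesh a \<delta> u = (LEAST i. dist u (a i) < \<delta>)"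

lemma mesh_measurable [measurable]:
  fixes a :: "nat \<Rightarrow> 'a::{metric_space, second_countable_topology}"
  shows "mesh a \<delta> \<in> borel \<rightarrow>\<^sub>M count_space UNIV"
  unfolding mesh_def by measurable

lemma dense_sequence:
  obtains a :: "nat \<Rightarrow> 'a::{metric_space, second_countable_topology}"
  where "\<And>u \<delta>. 0 < \<delta> \<Longrightarrow> dist u (a (mesh a \<delta> u)) < \<delta>"
proof -
  obtain D :: "'a set" where D: "countable D" "\<And>X. open X \<Longrightarrow> X \<noteq> {} \<Longrightarrow> \<exists>d\<in>D. d \<in> X"
    using countable_dense_setE by blast
  have "D \<noteq> {}" using D(2)[of UNIV] by auto
  define a where "a = from_nat_into D"
  have "dist u (a (mesh a \<delta> u)) < \<delta>" if "0 < \<delta>" for u \<delta>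
  proof -
    have "ball u \<delta> \<noteq> {}" using that by simp
    then obtain d where "d \<in> D" "d \<in> ball u \<delta>" using D(2)[OF open_ball] by blast
    then have "\<exists>i. dist u (a i) < \<delta>"
      unfolding a_def using from_nat_into_surj[OF D(1), of d] by auto
    then show ?thesis unfolding mesh_def by (rule LeastI_ex)
  qed
  then show ?thesis using that by blast
qed

text \<open>A matrix may be a sub-coupling for some pairs of laws and not for others. The fallback
  density 1, the independent coupling, makes every index produce a coupling for every pair.\<close>

definition mesh_density ::
  "nat \<Rightarrow> nat list list \<Rightarrow> (nat \<Rightarrow> real) \<Rightarrow> (nat \<Rightarrow> real) \<Rightarrow> nat \<times> nat \<Rightarrow> ennreal" where
  "mesh_density t L p q k = (let c = lattice_matrix t L in
     if sub_coupling t c p q then ennreal (completion_density t c p q (fst k) (snd k)) else 1)"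

definition mesh_kernel ::
  "(nat \<Rightarrow> 'a::metric_space) \<Rightarrow> real \<Rightarrow> nat \<Rightarrow> nat list list \<Rightarrow> 'a measure \<Rightarrow> 'a measure \<Rightarrow> ('a \<times> 'a) measure" where
  "mesh_kernel a \<delta> t L \<mu> \<nu> = density (\<mu> \<Otimes>\<^sub>M \<nu>) (\<lambda>z.
     mesh_density t L (cell \<mu> (mesh a \<delta>)) (cell \<nu> (mesh a \<delta>)) (mesh a \<delta> (fst z), mesh a \<delta> (snd z)))"

lemma mesh_density_measurable:
  fixes a :: "nat \<Rightarrow> 'a::{metric_space, second_countable_topology}"
  shows "(\<lambda>z. mesh_density t L p q (mesh a \<delta> (fst z), mesh a \<delta> (snd z))) \<in> borel_measurable (borel \<Otimes>\<^sub>M borel)"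
  by (rule measurable_compose[OF pair_idx_measurable]) auto

lemma mesh_kernel_in_couplings:
  fixes \<mu> \<nu> :: "'a::{metric_space, second_countable_topology} measure"
  assumes \<mu>: "prob_space \<mu>" "sets \<mu> = sets borel" and \<nu>: "prob_space \<nu>" "sets \<nu> = sets borel"
  shows "mesh_kernel a \<delta> t L \<mu> \<nu> \<in> couplings borel \<mu> \<nu>"
  unfolding mesh_kernel_def
proof (rule density_in_couplings[OF assms mesh_density_measurable])
  interpret \<mu>: prob_space \<mu> by fact
  interpret \<nu>: prob_space \<nu> by fact
  let ?c = "lattice_matrix t L" and ?i = "mesh a \<delta>"
  let ?d = "mesh_density t L (cell \<mu> ?i) (cell \<nu> ?i)"
  have m: "?i \<in> \<mu> \<rightarrow>\<^sub>M count_space UNIV" "?i \<in> \<nu> \<rightarrow>\<^sub>M count_space UNIV"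
    using \<mu> \<nu> by (auto cong: measurable_cong_sets)
  show "AE u in \<mu>. (\<integral>\<^sup>+v. ?d (?i (fst (u, v)), ?i (snd (u, v))) \<partial>\<nu>) = 1"
    using AE_cell_pos[OF \<mu>(1) m(1)]
  proof eventually_elim
    fix u assume u: "0 < cell \<mu> ?i (?i u)"
    show "(\<integral>\<^sup>+v. ?d (?i (fst (u, v)), ?i (snd (u, v))) \<partial>\<nu>) = 1"
    proof (cases "sub_coupling t ?c (cell \<mu> ?i) (cell \<nu> ?i)")
      case True
      show ?thesis
        using nn_integral_completion[OF \<nu>(1) m(2) True cell_nonneg u] True by (simp add: mesh_density_def)
    qed (simp add: mesh_density_def \<nu>.emeasure_space_1)
  qed
  show "AE v in \<nu>. (\<integral>\<^sup>+u. ?d (?i (fst (u, v)), ?i (snd (u, v))) \<partial>\<mu>) = 1"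
    using AE_cell_pos[OF \<nu>(1) m(2)]
  proof eventually_elim
    fix v assume v: "0 < cell \<nu> ?i (?i v)"
    show "(\<integral>\<^sup>+u. ?d (?i (fst (u, v)), ?i (snd (u, v))) \<partial>\<mu>) = 1"
    proof (cases "sub_coupling t ?c (cell \<mu> ?i) (cell \<nu> ?i)")
      case True
      show ?thesis
        using nn_integral_completion[OF \<mu>(1) m(1) sub_coupling_swap[OF True] cell_nonneg v] True
        by (simp add: mesh_density_def completion_swap[of t ?c])
    qed (simp add: mesh_density_def \<mu>.emeasure_space_1)
  qed
qed

lemma cell_kernel_measurable:
  assumes \<mu>[measurable]: "\<mu> \<in> M \<rightarrow>\<^sub>M prob_algebra N" and [measurable]: "idx \<in> N \<rightarrow>\<^sub>M count_space UNIV"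
  shows "(\<lambda>z. cell (\<mu> z) idx i) \<in> borel_measurable M"
proof -
  have [measurable]: "idx -` {i} \<inter> space N \<in> sets N" by (rule measurable_sets[OF assms(2)]) simp
  have "(\<lambda>z. measure (\<mu> z) (idx -` {i} \<inter> space N)) \<in> borel_measurable M"
    by (rule measurable_compose[OF \<mu> measurable_measure_prob_algebra]) simp
  then show ?thesis
    by (rule measurable_cong[THEN iffD1, rotated]) (simp add: cell_def prob_kernelD(3)[OF \<mu>])
qed

lemma mesh_kernel_measurable:
  fixes \<mu> \<nu> :: "'z \<Rightarrow> 'a::{metric_space, second_countable_topology} measure"
  assumes \<mu>[measurable]: "\<mu> \<in> M \<rightarrow>\<^sub>M prob_algebra borel" and \<nu>[measurable]: "\<nu> \<in> M \<rightarrow>\<^sub>M prob_algebra borel"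
  shows "(\<lambda>z. mesh_kernel a \<delta> t L (\<mu> z) (\<nu> z)) \<in> M \<rightarrow>\<^sub>M prob_algebra (borel \<Otimes>\<^sub>M borel)"
  unfolding mesh_kernel_def
proof (rule measurable_density_kernel)
  let ?c = "lattice_matrix t L" and ?i = "mesh a \<delta>"
  let ?d = "\<lambda>z. mesh_density t L (cell (\<mu> z) ?i) (cell (\<nu> z) ?i)"
  note [measurable] = cell_kernel_measurable[OF \<mu> mesh_measurable] cell_kernel_measurable[OF \<nu> mesh_measurable]
  have sc[measurable]: "Measurable.pred M (\<lambda>z. sub_coupling t ?c (cell (\<mu> z) ?i) (cell (\<nu> z) ?i))"
    unfolding sub_coupling_def by measurable
  \<comment> \<open>For a fixed pair of cells k the density is measurable in z, because the cell
    masses are; the countably many pairs are then substituted one by one.\<close>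
  define W where "W k zw = ?d (fst zw) k" for k and zw :: "'z \<times> 'a \<times> 'a"
  have W: "W k \<in> borel_measurable (M \<Otimes>\<^sub>M (borel \<Otimes>\<^sub>M borel))" for k
    unfolding mesh_density_def completion_density_def W_def Let_def by measurable
  have "(\<lambda>zw. W (?i (fst (snd zw)), ?i (snd (snd zw))) zw) \<in> borel_measurable (M \<Otimes>\<^sub>M (borel \<Otimes>\<^sub>M borel))"
    using measurable_compose[OF measurable_snd pair_idx_measurable[OF mesh_measurable[of a \<delta>]], of M]
    by (intro measurable_compose_countable[of W, OF W]) simp
  then show "(\<lambda>(z, w). ?d z (?i (fst w), ?i (snd w))) \<in> borel_measurable (M \<Otimes>\<^sub>M (borel \<Otimes>\<^sub>M borel))"
    by (simp add: split_beta W_def)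
  show "(\<lambda>z. \<mu> z \<Otimes>\<^sub>M \<nu> z) \<in> M \<rightarrow>\<^sub>M prob_algebra (borel \<Otimes>\<^sub>M borel)" by measurable
  fix z assume z: "z \<in> space M"
  have "mesh_kernel a \<delta> t L (\<mu> z) (\<nu> z) \<in> couplings borel (\<mu> z) (\<nu> z)"
    using prob_kernelD[OF \<mu> z] prob_kernelD[OF \<nu> z] by (intro mesh_kernel_in_couplings)
  then have "prob_space (mesh_kernel a \<delta> t L (\<mu> z) (\<nu> z))"
    unfolding couplings_def by blast
  then have "emeasure (mesh_kernel a \<delta> t L (\<mu> z) (\<nu> z)) (space (mesh_kernel a \<delta> t L (\<mu> z) (\<nu> z))) = 1"
    by (rule prob_space.emeasure_space_1)
  moreover have "(\<lambda>w. ?d z (?i (fst w), ?i (snd w))) \<in> borel_measurable (\<mu> z \<Otimes>\<^sub>M \<nu> z)"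
  proof -
    have "sets (\<mu> z \<Otimes>\<^sub>M \<nu> z) = sets (borel \<Otimes>\<^sub>M borel)"
      using prob_kernelD[OF \<mu> z] prob_kernelD[OF \<nu> z] by (intro sets_pair_measure_cong) auto
    then show ?thesis
      using mesh_density_measurable[of t L _ _ a \<delta>] by (simp cong: measurable_cong_sets)
  qed
  ultimately show "(\<integral>\<^sup>+w. ?d z (?i (fst w), ?i (snd w)) \<partial>(\<mu> z \<Otimes>\<^sub>M \<nu> z)) = 1"
    unfolding mesh_kernel_def by (subst (asm) emeasure_density) (auto cong: nn_integral_cong_simp)
qed

lemma integrable_mesh_moment:
  fixes a :: "nat \<Rightarrow> 'a::{metric_space, second_countable_topology}"
  assumes a: "\<And>u. dist u (a (mesh a \<delta> u)) < \<delta>" and \<delta>: "0 < \<delta>" "\<delta> \<le> 1" and s: "1 \<le> s" "s \<le> 2"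
    and \<mu>: "prob_space \<mu>" "sets \<mu> = sets borel" and fin: "moment s x0 \<mu> < \<infinity>"
  shows "integrable \<mu> (\<lambda>u. dist (a (mesh a \<delta> u)) x0 powr s)"
proof -
  interpret prob_space \<mu> by fact
  have m[measurable]: "mesh a \<delta> \<in> \<mu> \<rightarrow>\<^sub>M count_space UNIV" "(\<lambda>u. dist u x0 powr s) \<in> borel_measurable \<mu>"
    using \<mu>(2) by (auto cong: measurable_cong_sets)
  have "integrable \<mu> (\<lambda>u. dist u x0 powr s)"
    using fin by (intro integrableI_nonneg) auto
  then have 1: "integrable \<mu> (\<lambda>u. (1 + \<delta>) * dist u x0 powr s + 2 * \<delta>)"
    by simp
  have 2: "(\<lambda>u. dist (a (mesh a \<delta> u)) x0 powr s) \<in> borel_measurable \<mu>"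
    by (rule measurable_compose[OF m(1)]) simp
  have 3: "dist (a (mesh a \<delta> u)) x0 powr s \<le> (1 + \<delta>) * dist u x0 powr s + 2 * \<delta>" for u
  proof -
    have "dist (a (mesh a \<delta> u)) x0 \<le> dist u x0 + \<delta>"
      using a[of u] dist_triangle[of "a (mesh a \<delta> u)" x0 u] by (simp add: dist_commute)
    then have "dist (a (mesh a \<delta> u)) x0 powr s \<le> (dist u x0 + \<delta>) powr s"
      using s by (intro powr_mono2) auto
    also have "\<dots> \<le> (1 + \<delta>) * dist u x0 powr s + 2 * \<delta>"
      using s \<delta> by (intro powr_add_small) auto
    finally show ?thesis .
  qed
  show ?thesis
    using 3 \<delta> by (intro Bochner_Integration.integrable_bound[OF 1 2] AE_I2) simp
qed

text \<open>Passing from points to cell centres and back changes distances by at most 2 \<delta>,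
  which \<open>powr_add_small\<close> turns into factors 1 + 2 \<delta> and summands 4 \<delta>,
  once for each given coupling and once for the result. The remaining \<delta> is the cost of the
  residual mass. Convexity with parameter \<gamma> is applied to the cell centres, along the glued
  discrete law.\<close>

lemma mesh_kernel_cost:
  fixes a :: "nat \<Rightarrow> 'a::{metric_space, second_countable_topology}"
  assumes a: "\<And>u. dist u (a (mesh a \<delta> u)) < \<delta>" and \<delta>: "0 < \<delta>" "2 * \<delta> \<le> 1" and s: "1 \<le> s" "s \<le> 2"
    and \<mu>: "prob_space \<mu>" "sets \<mu> = sets borel" and \<nu>: "prob_space \<nu>" "sets \<nu> = sets borel"
    and fin: "moment s x0 \<mu> < \<infinity>" "moment s x0 \<nu> < \<infinity>"
    and \<pi>1: "\<pi>1 \<in> couplings borel \<mu> \<kappa>" "transport_cost s \<pi>1 = ennreal c1"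
    and \<pi>2: "\<pi>2 \<in> couplings borel \<kappa> \<nu>" "transport_cost s \<pi>2 = ennreal c2"
    and c: "0 \<le> c1" "0 \<le> c2" and \<gamma>: "0 < \<gamma>"
  obtains t L where "transport_cost s (mesh_kernel a \<delta> t L \<mu> \<nu>)
     \<le> ennreal ((1 + 2 * \<delta>) * ((1 + 1 / \<gamma>) powr (s - 1) * ((1 + 2 * \<delta>) * c1 + 4 * \<delta>)
        + (1 + \<gamma>) powr (s - 1) * ((1 + 2 * \<delta>) * c2 + 4 * \<delta>) + \<delta>) + 4 * \<delta>)"
proof -
  interpret \<mu>: prob_space \<mu> by fact
  interpret \<nu>: prob_space \<nu> by fact
  let ?i = "mesh a \<delta>"
  have m[measurable]: "?i \<in> \<mu> \<rightarrow>\<^sub>M count_space UNIV" "?i \<in> \<nu> \<rightarrow>\<^sub>M count_space UNIV"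
    using \<mu> \<nu> by (auto cong: measurable_cong_sets)
  have pm: "(\<lambda>z. (?i (fst z), ?i (snd z))) \<in> borel \<Otimes>\<^sub>M borel \<rightarrow>\<^sub>M count_space UNIV"
    by (rule pair_idx_measurable) simp
  define D where "D i j = dist (a i) (a j) powr s" for i j
  define e where "e i = dist (a i) x0 powr s" for i
  have D0: "0 \<le> D i j" for i j by (simp add: D_def)
  define l1 l2 where "l1 = (1 + 1 / \<gamma>) powr (s - 1)" and "l2 = (1 + \<gamma>) powr (s - 1)"
  have l: "0 \<le> l1" "0 \<le> l2" by (auto simp: l1_def l2_def)
  have mesh_le: "dist (a (?i u)) (a (?i v)) \<le> dist u v + 2 * \<delta>" "dist u v \<le> dist (a (?i u)) (a (?i v)) + 2 * \<delta>" for u v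
    using a[of u] a[of v] dist_triangle[of "a (?i u)" "a (?i v)" u] dist_triangle[of u "a (?i v)" v]
      dist_triangle[of u v "a (?i u)"] dist_triangle[of "a (?i u)" v "a (?i v)"]
    by (simp_all add: dist_commute)
  have powr_le: "x powr s \<le> (1 + 2 * \<delta>) * y powr s + 4 * \<delta>" if "x \<le> y + 2 * \<delta>" "0 \<le> x" "0 \<le> y" for x y
  proof -
    have "x powr s \<le> (y + 2 * \<delta>) powr s" using that s by (intro powr_mono2) auto
    also have "\<dots> \<le> (1 + 2 * \<delta>) * y powr s + 2 * (2 * \<delta>)" using that s \<delta> by (intro powr_add_small) auto
    finally show ?thesis by simp
  qed
  have cost: "(\<integral>\<^sup>+z. ennreal (D (?i (fst z)) (?i (snd z))) \<partial>\<pi>) \<le> ennreal ((1 + 2 * \<delta>) * c + 4 * \<delta>)"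
    if \<pi>: "\<pi> \<in> couplings borel \<mu>' \<nu>'" "transport_cost s \<pi> = ennreal c" and c: "0 \<le> c"
    for \<pi> :: "('a \<times> 'a) measure" and \<mu>' \<nu>' c
  proof -
    have "prob_space \<pi>" and sp[measurable_cong]: "sets \<pi> = sets (borel \<Otimes>\<^sub>M borel)" using \<pi> by (auto simp: couplings_def)
    interpret prob_space \<pi> by fact
    have "(\<integral>\<^sup>+z. ennreal (D (?i (fst z)) (?i (snd z))) \<partial>\<pi>)
        \<le> (\<integral>\<^sup>+z. ennreal (1 + 2 * \<delta>) * ennreal (dist (fst z) (snd z) powr s) + ennreal (4 * \<delta>) \<partial>\<pi>)"
      unfolding D_def using \<delta>
      by (intro nn_integral_mono) (auto simp: ennreal_mult[symmetric] ennreal_plus[symmetric] simp del: ennreal_plus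
           intro!: ennreal_leI powr_le mesh_le)
    also have "\<dots> = ennreal (1 + 2 * \<delta>) * ennreal c + ennreal (4 * \<delta>)"
      using \<pi>(2) by (subst nn_integral_add) (auto simp: nn_integral_cmult emeasure_space_1)
    also have "\<dots> = ennreal ((1 + 2 * \<delta>) * c + 4 * \<delta>)"
      using \<delta> c by (simp add: ennreal_mult[symmetric] ennreal_plus[symmetric] del: ennreal_plus)
    finally show ?thesis .
  qed
  obtain C1 where C1: "measure_pmf C1 = distr \<pi>1 (count_space UNIV) (\<lambda>z. (?i (fst z), ?i (snd z)))"
    "measure_pmf (map_pmf fst C1) = distr \<mu> (count_space UNIV) ?i"
    "measure_pmf (map_pmf snd C1) = distr \<kappa> (count_space UNIV) ?i"
    using coupling_pmf[OF mesh_measurable \<pi>1(1)] by blast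
  obtain C2 where C2: "measure_pmf C2 = distr \<pi>2 (count_space UNIV) (\<lambda>z. (?i (fst z), ?i (snd z)))"
    "measure_pmf (map_pmf fst C2) = distr \<kappa> (count_space UNIV) ?i"
    "measure_pmf (map_pmf snd C2) = distr \<nu> (count_space UNIV) ?i"
    using coupling_pmf[OF mesh_measurable \<pi>2(1)] by blast
  have pm': "(\<lambda>z. (?i (fst z), ?i (snd z))) \<in> \<pi>1 \<rightarrow>\<^sub>M count_space UNIV" "(\<lambda>z. (?i (fst z), ?i (snd z))) \<in> \<pi>2 \<rightarrow>\<^sub>M count_space UNIV"
    using \<pi>1(1) \<pi>2(1) pm by (auto simp: couplings_def cong: measurable_cong_sets)
  have D1: "(\<integral>\<^sup>+z. ennreal (D (fst z) (snd z)) \<partial>C1) \<le> ennreal ((1 + 2 * \<delta>) * c1 + 4 * \<delta>)"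
    using cost[OF \<pi>1 c(1)] pm' by (simp add: C1(1) nn_integral_distr)
  have D2: "(\<integral>\<^sup>+z. ennreal (D (fst z) (snd z)) \<partial>C2) \<le> ennreal ((1 + 2 * \<delta>) * c2 + 4 * \<delta>)"
    using cost[OF \<pi>2 c(2)] pm' by (simp add: C2(1) nn_integral_distr)
  have "map_pmf snd C1 = map_pmf fst C2"
    using C1(3) C2(2) by (metis measure_pmf_inject)
  then obtain T where T: "map_pmf (\<lambda>(i, j, k). (i, j)) T = C1" "map_pmf (\<lambda>(i, j, k). (j, k)) T = C2"
    by (rule pmf_gluing)
  \<comment> \<open>The middle cell is forgotten: C couples the discretised \<mu> and \<nu>, and its
    cost is bounded by the costs of the two legs.\<close>
  define C where "C = map_pmf (\<lambda>(i, j, k). (i, k)) T"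
  define B where "B = l1 * ((1 + 2 * \<delta>) * c1 + 4 * \<delta>) + l2 * ((1 + 2 * \<delta>) * c2 + 4 * \<delta>)"
  have B: "0 \<le> B" using l c \<delta> by (simp add: B_def)
  have marg: "map_pmf fst C = map_pmf fst C1" "map_pmf snd C = map_pmf snd C2"
    unfolding C_def T[symmetric] by (simp_all add: map_pmf_comp split_beta)
  have "(\<integral>\<^sup>+z. ennreal (D (fst z) (snd z)) \<partial>C) = (\<integral>\<^sup>+(i, j, k). ennreal (D i k) \<partial>T)"
    by (auto simp: C_def split_beta intro!: nn_integral_cong)
  also have "\<dots> \<le> (\<integral>\<^sup>+(i, j, k). ennreal l1 * ennreal (D i j) + ennreal l2 * ennreal (D j k) \<partial>T)"
  proof (intro nn_integral_mono, clarify)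
    fix i j k
    have "D i k \<le> (dist (a i) (a j) + dist (a j) (a k)) powr s"
      unfolding D_def using s by (intro powr_mono2 dist_triangle) auto
    also have "\<dots> \<le> l1 * D i j + l2 * D j k"
      unfolding l1_def l2_def D_def using s \<gamma> by (intro powr_add_split) auto
    finally show "ennreal (D i k) \<le> ennreal l1 * ennreal (D i j) + ennreal l2 * ennreal (D j k)"
      using l D0 by (simp add: ennreal_mult[symmetric] ennreal_plus[symmetric] ennreal_leI del: ennreal_plus)
  qed
  also have "\<dots> = ennreal l1 * (\<integral>\<^sup>+z. ennreal (D (fst z) (snd z)) \<partial>C1) + ennreal l2 * (\<integral>\<^sup>+z. ennreal (D (fst z) (snd z)) \<partial>C2)"
  proof -
    have "(\<integral>\<^sup>+(i, j, k). ennreal l1 * ennreal (D i j) + ennreal l2 * ennreal (D j k) \<partial>T)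
        = (\<integral>\<^sup>+z. ennreal l1 * ennreal (D (fst z) (fst (snd z))) + ennreal l2 * ennreal (D (fst (snd z)) (snd (snd z))) \<partial>T)"
      by (auto intro!: nn_integral_cong)
    also have "\<dots> = ennreal l1 * (\<integral>\<^sup>+z. ennreal (D (fst z) (fst (snd z))) \<partial>T)
        + ennreal l2 * (\<integral>\<^sup>+z. ennreal (D (fst (snd z)) (snd (snd z))) \<partial>T)"
      by (simp add: nn_integral_add nn_integral_cmult)
    finally show ?thesis unfolding T[symmetric] by (simp add: split_beta)
  qed
  also have "\<dots> \<le> ennreal l1 * ennreal ((1 + 2 * \<delta>) * c1 + 4 * \<delta>) + ennreal l2 * ennreal ((1 + 2 * \<delta>) * c2 + 4 * \<delta>)"
    by (intro add_mono mult_left_mono D1 D2) auto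
  also have "\<dots> = ennreal B"
    unfolding B_def using l \<delta> c by (simp add: ennreal_mult[symmetric] ennreal_plus[symmetric] del: ennreal_plus)
  finally have DC: "(\<integral>\<^sup>+z. ennreal (D (fst z) (snd z)) \<partial>C) \<le> ennreal B" .
  then have intD: "integrable C (\<lambda>z. D (fst z) (snd z))"
    using D0 by (intro integrableI_nonneg) (auto intro: le_less_trans simp: less_top[symmetric] top_unique)
  have ED: "(\<integral>z. D (fst z) (snd z) \<partial>C) \<le> B"
    using DC intD D0 B by (subst (asm) nn_integral_eq_integral) auto
  have inte: "integrable \<mu> (\<lambda>u. e (?i u))" "integrable \<nu> (\<lambda>v. e (?i v))"
    unfolding e_def using \<delta> by (intro integrable_mesh_moment[OF a] s \<mu> \<nu> fin; simp)+
  have map_e: "integrable (map_pmf fst C) e" "integral\<^sup>L (map_pmf fst C) e = (\<integral>u. e (?i u) \<partial>\<mu>)"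
    "integrable (map_pmf snd C) e" "integral\<^sup>L (map_pmf snd C) e = (\<integral>u. e (?i u) \<partial>\<nu>)"
    unfolding marg C1(2) C2(3) using inte by (auto simp: integrable_distr_eq integral_distr)
  have int_C: "integrable C (\<lambda>z. e (fst z))" "integrable C (\<lambda>z. e (snd z))"
    using map_e(1,3) by (simp_all add: integrable_map_pmf_eq)
  have E_C: "(\<integral>z. e (fst z) + e (snd z) \<partial>C) = (\<integral>u. e (?i u) \<partial>\<mu>) + (\<integral>u. e (?i u) \<partial>\<nu>)"
    using int_C map_e(2,4) by simp
  \<comment> \<open>The loss is \<delta>/2 because uncaptured moments enter
    \<open>nn_integral_completion_cost_le\<close> with a factor 2.\<close>
  obtain t L where tL: "sub_coupling t (lattice_matrix t L) (pmf (map_pmf fst C)) (pmf (map_pmf snd C))"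
    "\<And>i j. lattice_matrix t L i j \<le> pmf C (i, j)"
    "(\<integral>z. e (fst z) + e (snd z) \<partial>C) - \<delta> / 2 \<le> (\<Sum>i<t. \<Sum>j<t. (e i + e j) * lattice_matrix t L i j)"
    using lattice_matrix_approx[OF _ int_C, of "\<delta> / 2"] \<delta> by (auto simp: e_def)
  let ?c = "lattice_matrix t L"
  have cells: "pmf (map_pmf fst C) = cell \<mu> ?i" "pmf (map_pmf snd C) = cell \<nu> ?i"
    unfolding marg by (intro pmf_eq_cell \<mu> \<nu> m C1 C2)+
  have sub: "sub_coupling t ?c (cell \<mu> ?i) (cell \<nu> ?i)"
    using tL(1) by (simp only: cells)
  have "(\<Sum>i<t. \<Sum>j<t. D i j * ?c i j) \<le> (\<Sum>i<t. \<Sum>j<t. D i j * pmf C (i, j))"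
    by (intro sum_mono mult_left_mono tL(2) D0)
  also have "\<dots> = (\<Sum>z\<in>{..<t} \<times> {..<t}. (D (fst z) (snd z) * indicator ({..<t} \<times> {..<t}) z) * pmf C z)"
    by (simp add: sum.cartesian_product split_beta)
  also have "\<dots> = (\<integral>z. D (fst z) (snd z) * indicator ({..<t} \<times> {..<t}) z \<partial>C)"
    by (rule integral_measure_pmf_real[symmetric]) (auto split: split_indicator_asm)
  also have "\<dots> \<le> (\<integral>z. D (fst z) (snd z) \<partial>C)"
    using intD D0 by (intro integral_mono Bochner_Integration.integrable_bound[OF intD]) (auto split: split_indicator)
  finally have sumD: "(\<Sum>i<t. \<Sum>j<t. D i j * ?c i j) \<le> B" using ED by simp
  let ?X = "(\<Sum>i<t. \<Sum>j<t. D i j * ?c i j) +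
        2 * (((\<integral>u. e (?i u) \<partial>\<mu>) - (\<Sum>i<t. e i * row_sum t ?c i))
           + ((\<integral>v. e (?i v) \<partial>\<nu>) - (\<Sum>j<t. e j * row_sum t (\<lambda>j i. ?c i j) j)))"
  have "(\<Sum>j<t. e j * row_sum t (\<lambda>j i. ?c i j) j) = (\<Sum>i<t. \<Sum>j<t. e j * ?c i j)"
    unfolding row_sum_def sum_distrib_left by (rule sum.swap)
  then have "(\<Sum>i<t. \<Sum>j<t. (e i + e j) * ?c i j) = (\<Sum>i<t. e i * row_sum t ?c i) + (\<Sum>j<t. e j * row_sum t (\<lambda>j i. ?c i j) j)"
    by (simp add: row_sum_def distrib_right sum.distrib sum_distrib_left)
  then have X: "?X \<le> B + \<delta>" using sumD tL(3) E_C by simp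
  \<comment> \<open>The point x0 is used as a relay; the constant 2 comes from 2^(s-1) \<le>
    2.\<close>
  have De: "D i j \<le> 2 * (e i + e j)" for i j
  proof -
    have "D i j \<le> (dist (a i) x0 + dist (a j) x0) powr s"
      unfolding D_def using s by (intro powr_mono2 dist_triangle2) auto
    also have "\<dots> \<le> 2 powr (s - 1) * e i + 2 powr (s - 1) * e j"
      unfolding e_def using powr_add_split[OF s(1), of "dist (a i) x0" "dist (a j) x0" 1] by simp
    also have "\<dots> = 2 powr (s - 1) * (e i + e j)" by (simp add: distrib_left)
    also have "\<dots> \<le> 2 powr 1 * (e i + e j)"
      using s by (intro mult_right_mono powr_mono) (auto simp: e_def)
    finally show ?thesis by simp
  qed
  let ?K = "mesh_kernel a \<delta> t L \<mu> \<nu>"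
  have K: "?K \<in> couplings borel \<mu> \<nu>" by (rule mesh_kernel_in_couplings[OF \<mu> \<nu>])
  then have "prob_space ?K" and sK[measurable_cong]: "sets ?K = sets (borel \<Otimes>\<^sub>M borel)" by (auto simp: couplings_def)
  interpret K: prob_space ?K by fact
  have s\<mu>\<nu>: "sets (\<mu> \<Otimes>\<^sub>M \<nu>) = sets (borel \<Otimes>\<^sub>M borel)"
    using \<mu> \<nu> by (intro sets_pair_measure_cong) auto
  have pm\<mu>\<nu>: "(\<lambda>z. (?i (fst z), ?i (snd z))) \<in> \<mu> \<Otimes>\<^sub>M \<nu> \<rightarrow>\<^sub>M count_space UNIV"
    using pm s\<mu>\<nu> by (simp cong: measurable_cong_sets)
  let ?w = "\<lambda>i j. completion_density t ?c (cell \<mu> ?i) (cell \<nu> ?i) i j"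
  have w_m: "(\<lambda>z. f (?i (fst z)) (?i (snd z))) \<in> borel_measurable (\<mu> \<Otimes>\<^sub>M \<nu>)" for f :: "nat \<Rightarrow> nat \<Rightarrow> ennreal"
    using measurable_compose[OF pm\<mu>\<nu>, of "\<lambda>(i, j). f i j" borel] by simp
  have D_m: "(\<lambda>z. f (?i (fst z)) (?i (snd z))) \<in> borel_measurable ?K" for f :: "nat \<Rightarrow> nat \<Rightarrow> ennreal"
    using measurable_compose[OF pm, of "\<lambda>(i, j). f i j" borel] sK by (simp cong: measurable_cong_sets)
  have "(\<integral>\<^sup>+z. ennreal (D (?i (fst z)) (?i (snd z))) \<partial>?K)
      = (\<integral>\<^sup>+z. ennreal (?w (?i (fst z)) (?i (snd z))) * ennreal (D (?i (fst z)) (?i (snd z))) \<partial>(\<mu> \<Otimes>\<^sub>M \<nu>))"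
    unfolding mesh_kernel_def mesh_density_def Let_def using sub w_m[of "\<lambda>i j. ennreal (?w i j)"] w_m[of "\<lambda>i j. ennreal (D i j)"]
    by (simp add: nn_integral_density)
  also have "\<dots> = (\<integral>\<^sup>+z. ennreal (D (?i (fst z)) (?i (snd z)) * ?w (?i (fst z)) (?i (snd z))) \<partial>(\<mu> \<Otimes>\<^sub>M \<nu>))"
    using D0 completion_nonneg[OF sub cell_nonneg cell_nonneg]
    by (intro nn_integral_cong) (simp add: ennreal_mult[symmetric] mult.commute)
  also have "\<dots> = (\<integral>\<^sup>+u. \<integral>\<^sup>+v. ennreal (D (?i u) (?i v) * ?w (?i u) (?i v)) \<partial>\<nu> \<partial>\<mu>)"
    using w_m[of "\<lambda>i j. ennreal (D i j * ?w i j)"] by (subst \<nu>.nn_integral_fst[symmetric]) auto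
  also have "\<dots> \<le> ennreal ?X"
    using nn_integral_completion_cost_le[OF \<mu>(1) m(1) \<nu>(1) m(2) sub, of D e, OF D0 De _ inte] by (simp add: e_def)
  also have "\<dots> \<le> ennreal (B + \<delta>)" by (intro ennreal_leI X)
  finally have KD: "(\<integral>\<^sup>+z. ennreal (D (?i (fst z)) (?i (snd z))) \<partial>?K) \<le> ennreal (B + \<delta>)" .
  have "transport_cost s ?K
      \<le> (\<integral>\<^sup>+z. ennreal (1 + 2 * \<delta>) * ennreal (D (?i (fst z)) (?i (snd z))) + ennreal (4 * \<delta>) \<partial>?K)"
    unfolding D_def using \<delta>
    by (intro nn_integral_mono) (auto simp: ennreal_mult[symmetric] ennreal_plus[symmetric] simp del: ennreal_plus
         intro!: ennreal_leI powr_le mesh_le)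
  also have "\<dots> = ennreal (1 + 2 * \<delta>) * (\<integral>\<^sup>+z. ennreal (D (?i (fst z)) (?i (snd z))) \<partial>?K) + ennreal (4 * \<delta>)"
    using D_m[of "\<lambda>i j. ennreal (D i j)"] D_m[of "\<lambda>i j. ennreal (1 + 2 * \<delta>) * ennreal (D i j)"]
    by (subst nn_integral_add) (auto simp: nn_integral_cmult K.emeasure_space_1)
  also have "\<dots> \<le> ennreal (1 + 2 * \<delta>) * ennreal (B + \<delta>) + ennreal (4 * \<delta>)"
    by (intro add_mono mult_left_mono KD) auto
  also have "\<dots> = ennreal ((1 + 2 * \<delta>) * (B + \<delta>) + 4 * \<delta>)"
    using B \<delta> by (simp add: ennreal_mult[symmetric] ennreal_plus[symmetric] del: ennreal_plus)
  finally show ?thesis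
    by (intro that[of t L]) (simp add: B_def l1_def l2_def)
qed

text \<open>Stands in for a measurable selection theorem combined with the triangle inequality for \<open>W\<^sub>s\<close>.\<close>

lemma kernel_coupling_selection:
  fixes \<mu> \<nu> :: "'z \<Rightarrow> 'a::{metric_space, second_countable_topology} measure"
  assumes \<mu>: "\<mu> \<in> M \<rightarrow>\<^sub>M prob_algebra borel" and \<nu>: "\<nu> \<in> M \<rightarrow>\<^sub>M prob_algebra borel"
    and s: "1 \<le> s" "s \<le> 2" and \<epsilon>: "0 < (\<epsilon>::real)"
  obtains K where "K \<in> M \<rightarrow>\<^sub>M prob_algebra (borel \<Otimes>\<^sub>M borel)"
    "\<And>z. z \<in> space M \<Longrightarrow> K z \<in> couplings borel (\<mu> z) (\<nu> z)"
    "\<And>z x0 \<kappa> \<pi>1 \<pi>2 c1 c2 \<gamma>. z \<in> space M \<Longrightarrow>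
      moment s x0 (\<mu> z) < \<infinity> \<Longrightarrow> moment s x0 (\<nu> z) < \<infinity> \<Longrightarrow>
      \<pi>1 \<in> couplings borel (\<mu> z) \<kappa> \<Longrightarrow> transport_cost s \<pi>1 = ennreal c1 \<Longrightarrow>
      \<pi>2 \<in> couplings borel \<kappa> (\<nu> z) \<Longrightarrow> transport_cost s \<pi>2 = ennreal c2 \<Longrightarrow>
      0 \<le> c1 \<Longrightarrow> 0 \<le> c2 \<Longrightarrow> 0 < \<gamma> \<Longrightarrow>
      transport_cost s (K z)
        \<le> ennreal ((1 + 1 / \<gamma>) powr (s - 1) * c1 + (1 + \<gamma>) powr (s - 1) * c2 + \<epsilon>)"
proof -
  obtain a :: "nat \<Rightarrow> 'a" where a: "\<And>u \<delta>. 0 < \<delta> \<Longrightarrow> dist u (a (mesh a \<delta> u)) < \<delta>"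
    using dense_sequence by blast
  define \<delta> where "\<delta> m = 1 / (2 * real (Suc m))" for m
  have \<delta>: "0 < \<delta> m" "2 * \<delta> m \<le> 1" for m by (auto simp: \<delta>_def)
  \<comment> \<open>The mesh size belongs to the countable index as well. The choice is therefore
    almost minimal over all refinements at once, and one kernel serves all intermediate laws, all
    couplings and all \<gamma>.\<close>
  define F where "F i z = (case i of (m, t, L) \<Rightarrow> mesh_kernel a (\<delta> m) t L (\<mu> z) (\<nu> z))" for i z
  have F: "F i \<in> M \<rightarrow>\<^sub>M prob_algebra (borel \<Otimes>\<^sub>M borel)" for i
    unfolding F_def by (cases i) (use mesh_kernel_measurable[OF \<mu> \<nu>] in simp)
  have m: "(\<lambda>w. ennreal (dist (fst w) (snd w) powr s)) \<in> borel_measurable (borel \<Otimes>\<^sub>M (borel :: 'a measure))"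
    by measurable
  have e2: "0 < \<epsilon> / 2" using \<epsilon> by simp
  obtain \<iota> where \<iota>: "(\<lambda>z. F (\<iota> z) z) \<in> M \<rightarrow>\<^sub>M prob_algebra (borel \<Otimes>\<^sub>M borel)"
    "\<And>z i. z \<in> space M \<Longrightarrow> transport_cost s (F (\<iota> z) z)
        \<le> transport_cost s (F i z) + ennreal (\<epsilon> / 2)"
    by (rule kernel_almost_minimal_choice[where K = F, OF F m e2]) (rule that)
  show ?thesis
  proof (rule that[OF \<iota>(1)])
    fix z assume z: "z \<in> space M"
    note \<mu>z = prob_kernelD(1,2)[OF \<mu> z] and \<nu>z = prob_kernelD(1,2)[OF \<nu> z]
    show "F (\<iota> z) z \<in> couplings borel (\<mu> z) (\<nu> z)"
      unfolding F_def by (cases "\<iota> z") (simp add: mesh_kernel_in_couplings[OF \<mu>z \<nu>z])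
    fix x0 \<kappa> \<pi>1 \<pi>2 c1 c2 and \<gamma> :: real
    assume fin: "moment s x0 (\<mu> z) < \<infinity>" "moment s x0 (\<nu> z) < \<infinity>"
      and \<pi>1: "\<pi>1 \<in> couplings borel (\<mu> z) \<kappa>" "transport_cost s \<pi>1 = ennreal c1"
      and \<pi>2: "\<pi>2 \<in> couplings borel \<kappa> (\<nu> z)" "transport_cost s \<pi>2 = ennreal c2"
      and c: "0 \<le> c1" "0 \<le> c2" and \<gamma>: "0 < \<gamma>"
    define l1 l2 where "l1 = (1 + 1 / \<gamma>) powr (s - 1)" and "l2 = (1 + \<gamma>) powr (s - 1)"
    define G where "G d = (1 + 2 * d) * (l1 * ((1 + 2 * d) * c1 + 4 * d) + l2 * ((1 + 2 * d) * c2 + 4 * d) + d) + 4 * d" for d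
    have "\<delta> \<longlonglongrightarrow> 0" unfolding \<delta>_def by real_asymp
    then have "(\<lambda>m. G (\<delta> m)) \<longlonglongrightarrow> (1 + 2 * 0) * (l1 * ((1 + 2 * 0) * c1 + 4 * 0) + l2 * ((1 + 2 * 0) * c2 + 4 * 0) + 0) + 4 * 0"
      unfolding G_def by (intro tendsto_intros)
    then have "\<forall>\<^sub>F m in sequentially. G (\<delta> m) < l1 * c1 + l2 * c2 + \<epsilon> / 2"
      using e2 by (intro order_tendstoD) auto
    then obtain m where m: "G (\<delta> m) < l1 * c1 + l2 * c2 + \<epsilon> / 2"
      by (auto simp: eventually_sequentially)
    obtain t L where "transport_cost s (F (m, t, L) z) \<le> ennreal (G (\<delta> m))"
    proof (rule mesh_kernel_cost[OF a[OF \<delta>(1)] \<delta> s \<mu>z \<nu>z fin \<pi>1 \<pi>2 c \<gamma>, of m])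
      fix t L assume "transport_cost s (mesh_kernel a (\<delta> m) t L (\<mu> z) (\<nu> z))
        \<le> ennreal ((1 + 2 * \<delta> m) * ((1 + 1 / \<gamma>) powr (s - 1) * ((1 + 2 * \<delta> m) * c1 + 4 * \<delta> m)
        + (1 + \<gamma>) powr (s - 1) * ((1 + 2 * \<delta> m) * c2 + 4 * \<delta> m) + \<delta> m) + 4 * \<delta> m)"
      then show thesis by (intro that[of t L]) (simp add: F_def G_def l1_def l2_def)
    qed
    then have "transport_cost s (F (\<iota> z) z) \<le> ennreal (l1 * c1 + l2 * c2 + \<epsilon> / 2) + ennreal (\<epsilon> / 2)"
      using \<iota>(2)[OF z, of "(m, t, L)"] ennreal_leI[OF less_imp_le[OF m]]
      by (meson add_right_mono order_trans)
    also have "\<dots> = ennreal (l1 * c1 + l2 * c2 + \<epsilon>)"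
      using c e2 by (subst ennreal_plus[symmetric]) (auto simp: l1_def l2_def)
    finally show "transport_cost s (F (\<iota> z) z)
        \<le> ennreal ((1 + 1 / \<gamma>) powr (s - 1) * c1 + (1 + \<gamma>) powr (s - 1) * c2 + \<epsilon>)"
      by (simp add: l1_def l2_def)
  qed
qed

section \<open>Entropy of densities\<close>

text \<open>Adding \<open>1 - t\<close> does not change the entropy of a probability density but makes the integrand nonnegative.\<close>

definition phi :: "real \<Rightarrow> real" where
  "phi t = t * ln t - t + 1"

lemma phi_nonneg: "0 \<le> t \<Longrightarrow> 0 \<le> phi t"
proof (cases "t = 0")
  case False
  assume "0 \<le> t"
  with False have t: "0 < t" by simp
  have "ln (1 / t) \<le> 1 / t - 1" using t by (intro ln_le_minus_one) simp
  then have "t * (- ln t) \<le> t * (1 / t - 1)" using t by (intro mult_left_mono) (auto simp: ln_div)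
  then show ?thesis using t by (simp add: phi_def algebra_simps)
qed (simp add: phi_def)

text \<open>Pointwise chain rule for a product of densities, arranged without subtraction so that it
  can be integrated in \<open>ennreal\<close> even when entropies are infinite.\<close>

lemma phi_mult:
  assumes "0 \<le> a" "0 \<le> b"
  shows "phi (a * b) + a + b = b * phi a + a * phi b + 1 + a * b"
proof (cases "a = 0 \<or> b = 0")
  case False
  then show ?thesis using assms by (simp add: phi_def ln_mult algebra_simps)
qed (auto simp: phi_def)

lemma phi_measurable [measurable]: "phi \<in> borel_measurable borel"
  unfolding phi_def by measurable

text \<open>Since the integral of 1 - f under P is 0, the functions f ln f and \<open>phi\<close> of
  f have the same integral. As \<open>phi\<close> is nonnegative, integrability in the definition of
  \<open>Ent\<close> becomes finiteness of a nonnegative integral.\<close>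

lemma Ent_density:
  assumes P: "prob_space P" and f[measurable]: "f \<in> borel_measurable P" and nn: "\<And>x. 0 \<le> f x"
    and D: "prob_space (density P (\<lambda>x. ennreal (f x)))"
  shows "Ent (density P (\<lambda>x. ennreal (f x))) P =
    (if (\<integral>\<^sup>+x. ennreal (phi (f x)) \<partial>P) < \<infinity> then ereal (enn2real (\<integral>\<^sup>+x. ennreal (phi (f x)) \<partial>P)) else \<infinity>)"
proof -
  interpret prob_space P by fact
  interpret D: prob_space "density P (\<lambda>x. ennreal (f x))" by fact
  let ?D = "density P (\<lambda>x. ennreal (f x))"
  have "(\<integral>\<^sup>+x. ennreal (f x) \<partial>P) = 1"
    using D.emeasure_space_1 by (simp add: emeasure_density cong: nn_integral_cong_simp)
  then have f1: "integrable P f" "integral\<^sup>L P f = 1"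
    using nn integral_eq_nn_integral[of f P] by (auto intro!: integrableI_nonneg)
  have "AE x in P. ennreal (f x) = RN_deriv P ?D x"
    by (rule RN_deriv_unique) auto
  then have "AE x in P. enn2real (RN_deriv P ?D x) = f x"
    by eventually_elim (metis enn2real_ennreal nn)
  then have RN: "AE x in ?D. ln (enn2real (RN_deriv P ?D x)) = ln (f x)"
    by (subst AE_density) (auto elim!: eventually_mono)
  have eq: "phi (f x) = f x * ln (f x) - f x + 1" for x by (simp add: phi_def)
  have i1: "integrable ?D (\<lambda>x. ln (enn2real (RN_deriv P ?D x))) \<longleftrightarrow> integrable P (\<lambda>x. f x * ln (f x))"
    using integrable_cong_AE[OF _ _ RN] nn by (subst integrable_cong_AE[OF _ _ RN]) (auto simp: integrable_density)
  have i2: "integrable P (\<lambda>x. f x * ln (f x)) \<longleftrightarrow> integrable P (\<lambda>x. phi (f x))"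
  proof
    assume "integrable P (\<lambda>x. phi (f x))"
    then have "integrable P (\<lambda>x. phi (f x) + f x - 1)" using f1 by simp
    then show "integrable P (\<lambda>x. f x * ln (f x))" by (simp add: eq)
  qed (use f1 in \<open>simp add: eq\<close>)
  have i3: "integrable P (\<lambda>x. phi (f x)) \<longleftrightarrow> (\<integral>\<^sup>+x. ennreal (phi (f x)) \<partial>P) < \<infinity>"
    using phi_nonneg[OF nn] by (simp add: integrable_iff_bounded)
  have ac: "absolutely_continuous P ?D"
    by (auto simp: absolutely_continuousI_density)
  have "(\<integral>x. ln (enn2real (RN_deriv P ?D x)) \<partial>?D) = enn2real (\<integral>\<^sup>+x. ennreal (phi (f x)) \<partial>P)"
    if "integrable P (\<lambda>x. phi (f x))"
  proof -
    have "(\<integral>x. ln (enn2real (RN_deriv P ?D x)) \<partial>?D) = (\<integral>x. ln (f x) \<partial>?D)"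
      by (rule integral_cong_AE[OF _ _ RN]) auto
    also have "\<dots> = (\<integral>x. f x * ln (f x) \<partial>P)" using nn by (simp add: integral_density)
    also have "\<dots> = (\<integral>x. phi (f x) \<partial>P)"
      unfolding eq using that i2 f1 by (simp add: prob_space)
    also have "\<dots> = enn2real (\<integral>\<^sup>+x. ennreal (phi (f x)) \<partial>P)"
      using phi_nonneg[OF nn] by (intro integral_eq_nn_integral) auto
    finally show ?thesis .
  qed
  then show ?thesis
    unfolding Ent_def using i1 i2 i3 ac by auto
qed

lemma finite_Ent_density:
  assumes P: "prob_space P" and \<nu>: "prob_space \<nu>" "sets \<nu> = sets P" and fin: "Ent \<nu> P \<noteq> \<infinity>"
  obtains f where "f \<in> borel_measurable P" "\<And>x. 0 \<le> f x" "\<nu> = density P (\<lambda>x. ennreal (f x))"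
proof -
  interpret prob_space P by fact
  have ac: "absolutely_continuous P \<nu>" using fin by (auto simp: Ent_def split: if_splits)
  have "finite_measure \<nu>" using \<nu>(1) by (simp add: prob_space.finite_measure)
  from real_RN_deriv[OF this ac \<nu>(2)] obtain D where D: "D \<in> borel_measurable P" "AE x in P. RN_deriv P \<nu> x = ennreal (D x)" "\<And>x. 0 \<le> D x"
    by metis
  have "\<nu> = density P (RN_deriv P \<nu>)" using ac \<nu>(2) by (simp add: density_RN_deriv)
  also have "\<dots> = density P (\<lambda>x. ennreal (D x))" using D by (intro density_cong) auto
  finally show ?thesis using D by (intro that[of D]) auto
qed

text \<open>The conditional laws of a measure with density \<open>F\<close> are the densities \<open>g x\<close> with respect to \<open>q x\<close>,
  so that no disintegration theorem is needed. The last conclusion is the chain rule for the entropy.\<close>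

lemma kernel_density_disintegration:
  fixes F :: "'x \<Rightarrow> 'a \<Rightarrow> real"
  assumes P: "prob_space P" "sets P = sets A" and q[measurable]: "q \<in> A \<rightarrow>\<^sub>M prob_algebra N"
    and F: "(\<lambda>(x, y). F x y) \<in> borel_measurable (A \<Otimes>\<^sub>M N)" and nn: "\<And>x y. 0 \<le> F x y"
    and F1: "(\<integral>\<^sup>+x. \<integral>\<^sup>+y. ennreal (F x y) \<partial>q x \<partial>P) = 1"
  obtains f g where "f \<in> borel_measurable A" "\<And>x. 0 \<le> f x" "(\<integral>\<^sup>+x. ennreal (f x) \<partial>P) = 1"
    "(\<lambda>(x, y). g x y) \<in> borel_measurable (A \<Otimes>\<^sub>M N)" "\<And>x y. 0 \<le> g x y"
    "\<And>x. x \<in> space A \<Longrightarrow> (\<integral>\<^sup>+y. ennreal (g x y) \<partial>q x) = 1"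
    "AE x in P. AE y in q x. F x y = f x * g x y"
    "(\<integral>\<^sup>+x. \<integral>\<^sup>+y. ennreal (phi (F x y)) \<partial>q x \<partial>P)
      = (\<integral>\<^sup>+x. ennreal (phi (f x)) \<partial>P) + (\<integral>\<^sup>+x. ennreal (f x) * (\<integral>\<^sup>+y. ennreal (phi (g x y)) \<partial>q x) \<partial>P)"
proof -
  note [measurable] = F
  note [measurable_cong] = P(2)
  interpret prob_space P by fact
  have sp: "space P = space A" using P(2) by (rule sets_eq_imp_space_eq)
  define I where "I x = (\<integral>\<^sup>+y. ennreal (F x y) \<partial>q x)" for x
  have [measurable]: "I \<in> borel_measurable A" unfolding I_def by measurable
  define f where "f x = enn2real (I x)" for x
  have f[measurable]: "f \<in> borel_measurable A" unfolding f_def by measurable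
  have f0: "0 \<le> f x" for x by (simp add: f_def)
  \<comment> \<open>The default 1 where f x = 0 makes g x a probability density for every x, so that
    the conditional laws form a kernel on the whole space.\<close>
  define g where "g x y = (if 0 < f x then F x y / f x else 1)" for x y
  have g: "(\<lambda>(x, y). g x y) \<in> borel_measurable (A \<Otimes>\<^sub>M N)" unfolding g_def by measurable
  have g0: "0 \<le> g x y" for x y using nn by (simp add: g_def)
  have Ifin: "AE x in P. I x \<noteq> \<infinity>"
    using F1 unfolding I_def[symmetric] by (intro nn_integral_PInf_AE) auto
  have slice: "h x \<in> borel_measurable (q x)" if "(\<lambda>(x, y). h x y) \<in> borel_measurable (A \<Otimes>\<^sub>M N)" "x \<in> space A"
    for h :: "'x \<Rightarrow> 'a \<Rightarrow> real" and x
  proof -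
    have "(\<lambda>y. case (x, y) of (x, y) \<Rightarrow> h x y) \<in> borel_measurable N"
      using that by (intro measurable_compose[OF _ that(1)]) auto
    then show ?thesis using prob_kernelD[OF q that(2)] by (simp cong: measurable_cong_sets)
  qed
  have g1: "(\<integral>\<^sup>+y. ennreal (g x y) \<partial>q x) = 1" if x: "x \<in> space A" for x
  proof (cases "0 < f x")
    case True
    then have Ix: "I x = ennreal (f x)" by (auto simp: f_def enn2real_positive_iff)
    note [measurable] = slice[OF F x]
    have "(\<integral>\<^sup>+y. ennreal (g x y) \<partial>q x) = (\<integral>\<^sup>+y. ennreal (1 / f x) * ennreal (F x y) \<partial>q x)"
      using True nn by (intro nn_integral_cong) (simp add: g_def ennreal_mult[symmetric])
    also have "\<dots> = ennreal (1 / f x) * I x" unfolding I_def by (rule nn_integral_cmult) measurable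
    also have "\<dots> = 1" using True by (simp add: Ix ennreal_mult[symmetric])
    finally show ?thesis .
  next
    case False
    then show ?thesis
      using prob_space.emeasure_space_1[OF prob_kernelD(1)[OF q x]] by (simp add: g_def)
  qed
  \<comment> \<open>Two defects are absorbed: the null set where I x is infinite, and slices with I
    x = 0, on which F x vanishes only q x-almost everywhere.\<close>
  have fg: "AE x in P. AE y in q x. F x y = f x * g x y"
    using Ifin AE_space
  proof eventually_elim
    fix x assume fin: "I x \<noteq> \<infinity>" and "x \<in> space P"
    then have x: "x \<in> space A" by (simp add: sp)
    show "AE y in q x. F x y = f x * g x y"
    proof (cases "0 < f x")
      case False
      then have "I x = 0" using fin by (cases "I x") (auto simp: f_def)
      note [measurable] = slice[OF F x]
      have "AE y in q x. ennreal (F x y) = 0"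
        using \<open>I x = 0\<close> unfolding I_def by (subst (asm) nn_integral_0_iff_AE) auto
      then show ?thesis using False f0[of x] nn by (auto elim!: eventually_mono)
    qed (simp add: g_def)
  qed
  have If: "(\<integral>\<^sup>+x. ennreal (f x) \<partial>P) = 1"
  proof -
    have "(\<integral>\<^sup>+x. ennreal (f x) \<partial>P) = (\<integral>\<^sup>+x. I x \<partial>P)"
      using Ifin by (intro nn_integral_cong_AE) (auto elim!: eventually_mono simp: f_def less_top)
    then show ?thesis using F1 by (simp add: I_def)
  qed
  have "(\<integral>\<^sup>+x. \<integral>\<^sup>+y. ennreal (phi (F x y)) \<partial>q x \<partial>P)
      = (\<integral>\<^sup>+x. ennreal (phi (f x)) + ennreal (f x) * (\<integral>\<^sup>+y. ennreal (phi (g x y)) \<partial>q x) \<partial>P)"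
  proof (rule nn_integral_cong_AE)
    show "AE x in P. (\<integral>\<^sup>+y. ennreal (phi (F x y)) \<partial>q x) = ennreal (phi (f x)) + ennreal (f x) * (\<integral>\<^sup>+y. ennreal (phi (g x y)) \<partial>q x)"
      using fg AE_space
    proof eventually_elim
      fix x assume ae: "AE y in q x. F x y = f x * g x y" and "x \<in> space P"
      then have x: "x \<in> space A" by (simp add: sp)
      interpret qx: prob_space "q x" by (rule prob_kernelD(1)[OF q x])
      note [measurable] = slice[OF F x] slice[OF g x]
      define H where "H = (\<integral>\<^sup>+y. ennreal (phi (f x * g x y)) \<partial>q x)"
      \<comment> \<open>The finite term f x + 1 is added so that \<open>phi_mult\<close> can be
        integrated term by term; it is cancelled at the end.\<close>
      have "H + ennreal (f x) + 1 = (\<integral>\<^sup>+y. ennreal (phi (f x * g x y)) + ennreal (f x) + ennreal (g x y) \<partial>q x)"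
        using g1[OF x] unfolding H_def by (simp add: nn_integral_add qx.emeasure_space_1)
      also have "\<dots> = (\<integral>\<^sup>+y. ennreal (phi (f x)) * ennreal (g x y) + ennreal (f x) * ennreal (phi (g x y)) + 1 + ennreal (f x) * ennreal (g x y) \<partial>q x)"
      proof (intro nn_integral_cong)
        fix y
        have "0 \<le> phi (f x * g x y)" "0 \<le> phi (f x)" "0 \<le> phi (g x y)" "0 \<le> f x * g x y"
          using f0 g0 by (auto intro!: phi_nonneg)
        then show "ennreal (phi (f x * g x y)) + ennreal (f x) + ennreal (g x y)
          = ennreal (phi (f x)) * ennreal (g x y) + ennreal (f x) * ennreal (phi (g x y)) + 1 + ennreal (f x) * ennreal (g x y)"
          using phi_mult[OF f0[of x] g0[of x y]] f0 g0
          by (simp add: ennreal_mult[symmetric] ennreal_plus[symmetric] ennreal_1[symmetric] mult.commute del: ennreal_plus ennreal_1)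
      qed
      also have "\<dots> = ennreal (phi (f x)) + ennreal (f x) * (\<integral>\<^sup>+y. ennreal (phi (g x y)) \<partial>q x) + 1 + ennreal (f x)"
        using g1[OF x] by (simp add: nn_integral_add nn_integral_cmult qx.emeasure_space_1)
      finally have "(ennreal (f x) + 1) + H = (ennreal (f x) + 1) + (ennreal (phi (f x)) + ennreal (f x) * (\<integral>\<^sup>+y. ennreal (phi (g x y)) \<partial>q x))"
        by (simp add: ac_simps)
      then have "H = ennreal (phi (f x)) + ennreal (f x) * (\<integral>\<^sup>+y. ennreal (phi (g x y)) \<partial>q x)"
        by (subst (asm) ennreal_add_left_cancel) auto
      moreover have "(\<integral>\<^sup>+y. ennreal (phi (F x y)) \<partial>q x) = H"
        unfolding H_def using ae by (intro nn_integral_cong_AE) (auto elim!: eventually_mono)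
      ultimately show "(\<integral>\<^sup>+y. ennreal (phi (F x y)) \<partial>q x) = ennreal (phi (f x)) + ennreal (f x) * (\<integral>\<^sup>+y. ennreal (phi (g x y)) \<partial>q x)"
        by simp
    qed
  qed
  also have "\<dots> = (\<integral>\<^sup>+x. ennreal (phi (f x)) \<partial>P) + (\<integral>\<^sup>+x. ennreal (f x) * (\<integral>\<^sup>+y. ennreal (phi (g x y)) \<partial>q x) \<partial>P)"
  proof -
    note [measurable] = g
    have "(\<lambda>x. ennreal (f x) * (\<integral>\<^sup>+y. ennreal (phi (g x y)) \<partial>q x)) \<in> borel_measurable A" by measurable
    then show ?thesis by (intro nn_integral_add) (auto cong: measurable_cong_sets simp: P(2))
  qed
  finally show ?thesis by - (rule that[OF f f0 If g g0 g1 fg])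
qed

section \<open>Extending couplings by one coordinate\<close>

abbreviation path_moment :: "real \<Rightarrow> (nat \<Rightarrow> 'a::metric_space) \<Rightarrow> nat \<Rightarrow> (nat \<Rightarrow> 'a) measure \<Rightarrow> ennreal" where
  "path_moment s x0 k \<mu> \<equiv> \<integral>\<^sup>+x. ennreal (\<Sum>j=1..k. dist (x j) (x0 j) powr s) \<partial>\<mu>"

lemma space_Xsp: "space (Xsp k :: (nat \<Rightarrow> 'a::topological_space) measure) = PiE {1..k} (\<lambda>_. UNIV)"
  by (simp add: Xsp_def space_PiM)

lemma measurable_Xsp_component [measurable]:
  "j \<in> {1..k} \<Longrightarrow> (\<lambda>x. x j) \<in> Xsp k \<rightarrow>\<^sub>M (borel :: 'a::topological_space measure)"
  unfolding Xsp_def by (rule measurable_component_singleton)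

lemma measurable_Xsp_extend [measurable]:
  "(\<lambda>(x, y). x(Suc k := y)) \<in> Xsp k \<Otimes>\<^sub>M borel \<rightarrow>\<^sub>M (Xsp (Suc k) :: (nat \<Rightarrow> 'a::topological_space) measure)"
proof -
  have "{1..Suc k} = insert (Suc k) {1..k}" by auto
  then show ?thesis
    using measurable_add_dim[of "Suc k" "{1..k}" "\<lambda>_. borel :: 'a measure"] by (simp add: Xsp_def)
qed

definition extend_law ::
  "nat \<Rightarrow> (nat \<Rightarrow> 'a::topological_space) measure \<Rightarrow> ((nat \<Rightarrow> 'a) \<Rightarrow> 'a measure) \<Rightarrow> (nat \<Rightarrow> 'a) measure" where
  "extend_law k P q = P \<bind> (\<lambda>x. distr (q x) (Xsp (Suc k)) (\<lambda>y. x(Suc k := y)))"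

lemma extend_kernel_measurable:
  fixes q :: "(nat \<Rightarrow> 'a::topological_space) \<Rightarrow> 'a measure"
  assumes [measurable]: "q \<in> Xsp k \<rightarrow>\<^sub>M prob_algebra borel"
  shows "(\<lambda>x. distr (q x) (Xsp (Suc k)) (\<lambda>y. x(Suc k := y))) \<in> Xsp k \<rightarrow>\<^sub>M prob_algebra (Xsp (Suc k))"
  by (rule measurable_distr_prob_space2[where M = borel]) measurable

lemma nn_integral_bind_distr_kernel:
  assumes M: "sets M = sets A" and K: "K \<in> A \<rightarrow>\<^sub>M prob_algebra N"
    and U: "(\<lambda>(x, y). U x y) \<in> A \<Otimes>\<^sub>M N \<rightarrow>\<^sub>M S" and h: "h \<in> borel_measurable S"
  shows "(\<integral>\<^sup>+z. h z \<partial>(M \<bind> (\<lambda>x. distr (K x) S (U x)))) = (\<integral>\<^sup>+x. \<integral>\<^sup>+y. h (U x y) \<partial>K x \<partial>M)"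
proof -
  have "(\<lambda>x. distr (K x) S (U x)) \<in> A \<rightarrow>\<^sub>M prob_algebra S"
    by (rule measurable_distr_prob_space2[OF K U])
  then have "(\<lambda>x. distr (K x) S (U x)) \<in> M \<rightarrow>\<^sub>M subprob_algebra S"
    using M by (intro measurable_prob_algebraD) (simp cong: measurable_cong_sets)
  then have "(\<integral>\<^sup>+z. h z \<partial>(M \<bind> (\<lambda>x. distr (K x) S (U x)))) = (\<integral>\<^sup>+x. \<integral>\<^sup>+z. h z \<partial>distr (K x) S (U x) \<partial>M)"
    by (rule nn_integral_bind[OF h])
  also have "\<dots> = (\<integral>\<^sup>+x. \<integral>\<^sup>+y. h (U x y) \<partial>K x \<partial>M)"
  proof (intro nn_integral_cong)
    fix x assume "x \<in> space M"
    then have x: "x \<in> space A" using sets_eq_imp_space_eq[OF M] by simp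
    have "(\<lambda>y. case (x, y) of (x, y) \<Rightarrow> U x y) \<in> N \<rightarrow>\<^sub>M S"
      using x by (intro measurable_compose[OF _ U]) auto
    then have "U x \<in> K x \<rightarrow>\<^sub>M S" using prob_kernelD[OF K x] by (simp cong: measurable_cong_sets)
    then show "(\<integral>\<^sup>+z. h z \<partial>distr (K x) S (U x)) = (\<integral>\<^sup>+y. h (U x y) \<partial>K x)"
      by (rule nn_integral_distr) (simp add: h)
  qed
  finally show ?thesis .
qed

lemma prob_bind_distr_kernel:
  assumes M: "prob_space M" "sets M = sets A" and K: "K \<in> A \<rightarrow>\<^sub>M prob_algebra N"
    and U: "(\<lambda>(x, y). U x y) \<in> A \<Otimes>\<^sub>M N \<rightarrow>\<^sub>M S"
  shows "prob_space (M \<bind> (\<lambda>x. distr (K x) S (U x)))" "sets (M \<bind> (\<lambda>x. distr (K x) S (U x))) = sets S"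
proof -
  have k: "(\<lambda>x. distr (K x) S (U x)) \<in> A \<rightarrow>\<^sub>M prob_algebra S"
    by (rule measurable_distr_prob_space2[OF K U])
  have M': "M \<in> space (prob_algebra A)" using M by (simp add: space_prob_algebra)
  show "prob_space (M \<bind> (\<lambda>x. distr (K x) S (U x)))" by (rule prob_space_bind'[OF M' k])
  show "sets (M \<bind> (\<lambda>x. distr (K x) S (U x))) = sets S" by (rule sets_bind'[OF M' k])
qed

lemma extend_law:
  fixes P :: "(nat \<Rightarrow> 'a::topological_space) measure"
  assumes P: "prob_space P" "sets P = sets (Xsp k)" and q: "q \<in> Xsp k \<rightarrow>\<^sub>M prob_algebra borel"
  shows prob_extend_law: "prob_space (extend_law k P q)" and sets_extend_law: "sets (extend_law k P q) = sets (Xsp (Suc k))"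
    and nn_integral_extend_law: "\<And>h. h \<in> borel_measurable (Xsp (Suc k)) \<Longrightarrow>
      (\<integral>\<^sup>+z. h z \<partial>extend_law k P q) = (\<integral>\<^sup>+x. \<integral>\<^sup>+y. h (x(Suc k := y)) \<partial>q x \<partial>P)"
  unfolding extend_law_def
  using prob_bind_distr_kernel[OF P q measurable_Xsp_extend] nn_integral_bind_distr_kernel[OF P(2) q measurable_Xsp_extend]
  by auto

definition extend_coupling ::
  "nat \<Rightarrow> ((nat \<Rightarrow> 'a::topological_space) \<times> (nat \<Rightarrow> 'a)) measure \<Rightarrow> ((nat \<Rightarrow> 'a) \<times> (nat \<Rightarrow> 'a) \<Rightarrow> ('a \<times> 'a) measure)
     \<Rightarrow> ((nat \<Rightarrow> 'a) \<times> (nat \<Rightarrow> 'a)) measure" where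
  "extend_coupling k \<pi> K = \<pi> \<bind> (\<lambda>z. distr (K z) (Xsp (Suc k) \<Otimes>\<^sub>M Xsp (Suc k))
     (\<lambda>w. ((fst z)(Suc k := fst w), (snd z)(Suc k := snd w))))"

text \<open>Each marginal of K z depends on only one of the two pasts. Projecting the extended
  coupling to one path therefore forgets the other past and leaves precisely the extension of that
  marginal by its own kernel.\<close>

lemma extend_coupling:
  fixes \<nu> P :: "(nat \<Rightarrow> 'a::topological_space) measure"
  assumes \<pi>: "\<pi> \<in> couplings (Xsp k) \<nu> P" and K: "K \<in> Xsp k \<Otimes>\<^sub>M Xsp k \<rightarrow>\<^sub>M prob_algebra (borel \<Otimes>\<^sub>M borel)"
    and r: "r \<in> Xsp k \<rightarrow>\<^sub>M prob_algebra borel" and q: "q \<in> Xsp k \<rightarrow>\<^sub>M prob_algebra borel"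
    and Kc: "\<And>z. z \<in> space (Xsp k \<Otimes>\<^sub>M Xsp k) \<Longrightarrow> K z \<in> couplings borel (r (fst z)) (q (snd z))"
  shows nn_integral_extend_coupling: "\<And>h. h \<in> borel_measurable (Xsp (Suc k) \<Otimes>\<^sub>M Xsp (Suc k)) \<Longrightarrow>
      (\<integral>\<^sup>+z. h z \<partial>extend_coupling k \<pi> K)
        = (\<integral>\<^sup>+z. \<integral>\<^sup>+w. h ((fst z)(Suc k := fst w), (snd z)(Suc k := snd w)) \<partial>K z \<partial>\<pi>)"
    and extend_coupling_in_couplings: "extend_coupling k \<pi> K \<in> couplings (Xsp (Suc k)) (extend_law k \<nu> r) (extend_law k P q)"
proof -
  let ?S = "Xsp (Suc k) :: (nat \<Rightarrow> 'a) measure"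
  have \<pi>': "prob_space \<pi>" "sets \<pi> = sets (Xsp k \<Otimes>\<^sub>M Xsp k)" "distr \<pi> (Xsp k) fst = \<nu>" "distr \<pi> (Xsp k) snd = P"
    using \<pi> by (auto simp: couplings_def)
  interpret \<pi>: prob_space \<pi> by fact
  have sp: "space \<pi> = space (Xsp k \<Otimes>\<^sub>M Xsp k)" using \<pi>'(2) by (rule sets_eq_imp_space_eq)
  have fst_m: "fst \<in> \<pi> \<rightarrow>\<^sub>M Xsp k" and snd_m: "snd \<in> \<pi> \<rightarrow>\<^sub>M Xsp k"
    using \<pi>'(2) by (simp_all cong: measurable_cong_sets)
  have \<nu>: "prob_space \<nu>" "sets \<nu> = sets (Xsp k)" and P: "prob_space P" "sets P = sets (Xsp k)"
    using \<pi>.prob_space_distr[OF fst_m] \<pi>.prob_space_distr[OF snd_m] \<pi>'(3,4) by auto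
  have "(\<lambda>zw. (\<lambda>(x, y). x(Suc k := y)) (fst (fst zw), fst (snd zw)))
     \<in> (Xsp k \<Otimes>\<^sub>M Xsp k) \<Otimes>\<^sub>M (borel \<Otimes>\<^sub>M borel) \<rightarrow>\<^sub>M ?S"
    by (rule measurable_compose[OF _ measurable_Xsp_extend]) measurable
  moreover have "(\<lambda>zw. (\<lambda>(x, y). x(Suc k := y)) (snd (fst zw), snd (snd zw)))
     \<in> (Xsp k \<Otimes>\<^sub>M Xsp k) \<Otimes>\<^sub>M (borel \<Otimes>\<^sub>M borel) \<rightarrow>\<^sub>M ?S"
    by (rule measurable_compose[OF _ measurable_Xsp_extend]) measurable
  ultimately have "(\<lambda>zw. ((fst (fst zw))(Suc k := fst (snd zw)), (snd (fst zw))(Suc k := snd (snd zw))))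
     \<in> (Xsp k \<Otimes>\<^sub>M Xsp k) \<Otimes>\<^sub>M (borel \<Otimes>\<^sub>M borel) \<rightarrow>\<^sub>M ?S \<Otimes>\<^sub>M ?S"
    by (simp add: measurable_Pair)
  then have U: "(\<lambda>(z, w). ((fst z)(Suc k := fst w), (snd z)(Suc k := snd w)))
     \<in> (Xsp k \<Otimes>\<^sub>M Xsp k) \<Otimes>\<^sub>M (borel \<Otimes>\<^sub>M borel) \<rightarrow>\<^sub>M ?S \<Otimes>\<^sub>M ?S"
    by (simp add: split_beta)
  show nn: "(\<integral>\<^sup>+z. h z \<partial>extend_coupling k \<pi> K)
        = (\<integral>\<^sup>+z. \<integral>\<^sup>+w. h ((fst z)(Suc k := fst w), (snd z)(Suc k := snd w)) \<partial>K z \<partial>\<pi>)"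
    if "h \<in> borel_measurable (?S \<Otimes>\<^sub>M ?S)" for h
    unfolding extend_coupling_def by (rule nn_integral_bind_distr_kernel[OF \<pi>'(2) K U that])
  have ext: "prob_space (extend_coupling k \<pi> K)" "sets (extend_coupling k \<pi> K) = sets (?S \<Otimes>\<^sub>M ?S)"
    unfolding extend_coupling_def by (rule prob_bind_distr_kernel[OF \<pi>'(1,2) K U])+
  have upd: "(\<lambda>y. indicator B (x(Suc k := y)) :: ennreal) \<in> borel_measurable borel"
    if "x \<in> space (Xsp k)" and B[measurable]: "B \<in> sets ?S" for x B
  proof -
    have "(\<lambda>y. (\<lambda>(x, y). x(Suc k := y)) (x, y)) \<in> borel \<rightarrow>\<^sub>M ?S"
      using that(1) by (intro measurable_compose[OF _ measurable_Xsp_extend]) auto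
    then have [measurable]: "(\<lambda>y. x(Suc k := y)) \<in> borel \<rightarrow>\<^sub>M ?S" by simp
    show ?thesis by measurable
  qed
  have upd2: "(\<lambda>x. \<integral>\<^sup>+y. indicator B (x(Suc k := y)) \<partial>r' x) \<in> borel_measurable (Xsp k)"
    if [measurable]: "B \<in> sets ?S" "r' \<in> Xsp k \<rightarrow>\<^sub>M prob_algebra borel" for B and r' :: "(nat \<Rightarrow> 'a) \<Rightarrow> 'a measure"
    by measurable
  \<comment> \<open>One argument for both sides: \<open>pr\<close> is the projection of pairs of
    paths and \<open>co\<close> the matching projection of the new coordinates.\<close>
  have marginal: "distr (extend_coupling k \<pi> K) ?S pr = extend_law k \<mu> r'"
    if pr: "pr \<in> ?S \<Otimes>\<^sub>M ?S \<rightarrow>\<^sub>M ?S" "pr \<in> \<pi> \<rightarrow>\<^sub>M Xsp k" "distr \<pi> (Xsp k) pr = \<mu>"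
      and co: "co \<in> borel \<Otimes>\<^sub>M borel \<rightarrow>\<^sub>M borel"
      and upd_pr: "\<And>z w. pr ((fst z)(Suc k := fst w), (snd z)(Suc k := snd w)) = (pr z)(Suc k := co w)"
      and r': "r' \<in> Xsp k \<rightarrow>\<^sub>M prob_algebra borel" and \<mu>: "prob_space \<mu>" "sets \<mu> = sets (Xsp k)"
      and K_pr: "\<And>z. z \<in> space \<pi> \<Longrightarrow> distr (K z) borel co = r' (pr z)"
    for pr co \<mu> and r' :: "(nat \<Rightarrow> 'a) \<Rightarrow> 'a measure"
  proof (rule measure_eqI)
    let ?E = "extend_coupling k \<pi> K"
    fix B assume "B \<in> sets (distr ?E ?S pr)"
    then have B[measurable]: "B \<in> sets ?S" by simp
    note [measurable] = pr(1)
    have "emeasure (distr ?E ?S pr) B = (\<integral>\<^sup>+z. indicator B z \<partial>distr ?E ?S pr)" by simp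
    also have "\<dots> = (\<integral>\<^sup>+z. indicator B (pr z) \<partial>?E)"
      using ext pr(1) by (intro nn_integral_distr) (auto cong: measurable_cong_sets)
    also have "\<dots> = (\<integral>\<^sup>+z. \<integral>\<^sup>+w. indicator B ((pr z)(Suc k := co w)) \<partial>K z \<partial>\<pi>)"
      by (subst nn) (auto simp: upd_pr)
    also have "\<dots> = (\<integral>\<^sup>+z. \<integral>\<^sup>+y. indicator B ((pr z)(Suc k := y)) \<partial>r' (pr z) \<partial>\<pi>)"
    proof (rule nn_integral_cong)
      fix z assume z: "z \<in> space \<pi>"
      have "sets (K z) = sets (borel \<Otimes>\<^sub>M borel)"
        using Kc z by (auto simp: couplings_def sp)
      then show "(\<integral>\<^sup>+w. indicator B ((pr z)(Suc k := co w)) \<partial>K z) = (\<integral>\<^sup>+y. indicator B ((pr z)(Suc k := y)) \<partial>r' (pr z))"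
        unfolding K_pr[OF z, symmetric] using co measurable_space[OF pr(2) z]
        by (subst nn_integral_distr) (auto cong: measurable_cong_sets intro!: upd)
    qed
    also have "\<dots> = (\<integral>\<^sup>+x. \<integral>\<^sup>+y. indicator B (x(Suc k := y)) \<partial>r' x \<partial>\<mu>)"
      unfolding pr(3)[symmetric] using pr(2) upd2[OF B r'] by (subst nn_integral_distr) auto
    also have "\<dots> = (\<integral>\<^sup>+z. indicator B z \<partial>extend_law k \<mu> r')"
      using nn_integral_extend_law[OF \<mu> r', of "indicator B"] by simp
    finally show "emeasure (distr ?E ?S pr) B = emeasure (extend_law k \<mu> r') B"
      using sets_extend_law[OF \<mu> r'] by simp
  qed (simp add: sets_extend_law[OF \<mu> r'])
  have 1: "distr (extend_coupling k \<pi> K) ?S fst = extend_law k \<nu> r"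
    using Kc by (intro marginal[of fst \<nu> fst r, OF _ fst_m \<pi>'(3) _ _ r \<nu>]) (auto simp: couplings_def sp)
  have 2: "distr (extend_coupling k \<pi> K) ?S snd = extend_law k P q"
    using Kc by (intro marginal[of snd P snd q, OF _ snd_m \<pi>'(4) _ _ q P]) (auto simp: couplings_def sp)
  show "extend_coupling k \<pi> K \<in> couplings (Xsp (Suc k)) (extend_law k \<nu> r) (extend_law k P q)"
    using ext 1 2 by (simp add: couplings_def)
qed

section \<open>From transport bounds to couplings, and the inductive step\<close>

lemma Wcost_le_of_Wass_le:
  assumes "Wass Mb d s \<mu> \<nu> \<le> ereal r" "0 < s"
  shows "Wcost Mb d s \<mu> \<nu> \<le> ennreal (r powr s)"
proof -
  define w where "w = enn2real (Wcost Mb d s \<mu> \<nu>)"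
  have fin: "Wcost Mb d s \<mu> \<nu> \<noteq> \<infinity>" using assms(1) by (auto simp: Wass_def split: if_splits)
  then have "w powr (1 / s) \<le> r" using assms(1) by (auto simp: Wass_def w_def)
  then have "(w powr (1 / s)) powr s \<le> r powr s" using assms(2) by (intro powr_mono2) auto
  moreover have "0 \<le> w" by (simp add: w_def)
  ultimately have "w \<le> r powr s" using assms(2) by (simp add: powr_powr)
  then show ?thesis using fin unfolding w_def
    by (cases "Wcost Mb d s \<mu> \<nu>") (auto intro: ennreal_leI)
qed

lemma Wcost_le_of_epowr_Wass_le:
  assumes "epowr (Wass Mb d s \<mu> \<nu>) s \<le> ereal b" "0 < s"
  shows "Wcost Mb d s \<mu> \<nu> \<le> ennreal b"
proof -
  define w where "w = enn2real (Wcost Mb d s \<mu> \<nu>)"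
  have fin: "Wcost Mb d s \<mu> \<nu> \<noteq> \<infinity>" using assms(1) by (auto simp: Wass_def epowr_def split: if_splits)
  then have "(w powr (1 / s)) powr s \<le> b" using assms(1) by (auto simp: Wass_def w_def epowr_def)
  moreover have "0 \<le> w" by (simp add: w_def)
  ultimately have "w \<le> b" using assms(2) by (simp add: powr_powr)
  then show ?thesis using fin unfolding w_def
    by (cases "Wcost Mb d s \<mu> \<nu>") (auto intro: ennreal_leI)
qed

lemma almost_optimal_coupling:
  assumes "Wcost Mb d s \<mu> \<nu> \<le> ennreal b" "0 \<le> b" "0 < (\<epsilon>::real)"
  obtains \<pi> c where "\<pi> \<in> couplings Mb \<mu> \<nu>" "(\<integral>\<^sup>+z. ennreal (d (fst z) (snd z) powr s) \<partial>\<pi>) = ennreal c"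
    "0 \<le> c" "c \<le> b + \<epsilon>"
proof -
  have "Wcost Mb d s \<mu> \<nu> < ennreal (b + \<epsilon>)"
    using assms by (intro le_less_trans[OF assms(1)]) (simp add: ennreal_lessI)
  then obtain \<pi> where \<pi>: "\<pi> \<in> couplings Mb \<mu> \<nu>" "(\<integral>\<^sup>+z. ennreal (d (fst z) (snd z) powr s) \<partial>\<pi>) < ennreal (b + \<epsilon>)"
    unfolding Wcost_def INF_less_iff by auto
  let ?I = "\<integral>\<^sup>+z. ennreal (d (fst z) (snd z) powr s) \<partial>\<pi>"
  have "?I = ennreal (enn2real ?I)" using less_trans[OF \<pi>(2) ennreal_less_top] by (intro ennreal_enn2real[symmetric])
  moreover have "enn2real ?I \<le> b + \<epsilon>"
    using less_imp_le[OF \<pi>(2)] assms(2,3) by (intro enn2real_leI) auto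
  ultimately show ?thesis using \<pi>(1) by (intro that[of \<pi> "enn2real ?I"]) auto
qed

text \<open>Triangle inequality and convexity along the coupling. This is how the kernels obtain
  finite moments from the conditional laws of \<nu>.\<close>

lemma moment_coupling:
  fixes \<mu> \<nu> :: "'a::{metric_space, second_countable_topology} measure"
  assumes \<pi>: "\<pi> \<in> couplings borel \<mu> \<nu>" and fin: "transport_cost s \<pi> < \<infinity>"
    "moment s x0 \<mu> < \<infinity>" and s: "1 \<le> s"
  shows "moment s x0 \<nu> < \<infinity>"
proof -
  have sp[measurable_cong]: "sets \<pi> = sets (borel \<Otimes>\<^sub>M borel)" and d: "distr \<pi> borel fst = \<mu>" "distr \<pi> borel snd = \<nu>"
    using \<pi> by (auto simp: couplings_def)
  define c where "c = (2::real) powr (s - 1)"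
  have "moment s x0 \<nu> = (\<integral>\<^sup>+z. ennreal (dist (snd z) x0 powr s) \<partial>\<pi>)"
    unfolding d(2)[symmetric] by (subst nn_integral_distr) auto
  also have "\<dots> \<le> (\<integral>\<^sup>+z. ennreal c * ennreal (dist (fst z) (snd z) powr s) + ennreal c * ennreal (dist (fst z) x0 powr s) \<partial>\<pi>)"
  proof (rule nn_integral_mono)
    fix z
    have "dist (snd z) x0 powr s \<le> (dist (fst z) (snd z) + dist (fst z) x0) powr s"
      using s dist_triangle3[of "snd z" x0 "fst z"] by (intro powr_mono2) auto
    also have "\<dots> \<le> c * dist (fst z) (snd z) powr s + c * dist (fst z) x0 powr s"
      using powr_add_split[OF s, of "dist (fst z) (snd z)" "dist (fst z) x0" 1] by (simp add: c_def)
    finally show "ennreal (dist (snd z) x0 powr s) \<le> ennreal c * ennreal (dist (fst z) (snd z) powr s) + ennreal c * ennreal (dist (fst z) x0 powr s)"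
      by (simp add: c_def ennreal_mult[symmetric] ennreal_plus[symmetric] ennreal_leI del: ennreal_plus)
  qed
  also have "\<dots> = ennreal c * transport_cost s \<pi> + ennreal c * moment s x0 \<mu>"
    unfolding d(1)[symmetric] by (subst nn_integral_distr) (auto simp: nn_integral_add nn_integral_cmult)
  also have "\<dots> < \<infinity>" using fin by (auto simp: ennreal_mult_less_top)
  finally show ?thesis .
qed

text \<open>Jensen for t^\<theta>, integrating the tangent at h; the case h = 0 is separate because
  the tangent bound needs a positive base point.\<close>

lemma nn_integral_powr_le:
  assumes \<mu>: "prob_space \<mu>" and [measurable]: "e \<in> borel_measurable \<mu>" and e: "\<And>x. 0 \<le> (e x::real)"
    and h: "(\<integral>\<^sup>+x. ennreal (e x) \<partial>\<mu>) \<le> ennreal h" "0 \<le> h" and \<theta>: "0 < \<theta>" "\<theta> \<le> 1"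
  shows "(\<integral>\<^sup>+x. ennreal (e x powr \<theta>) \<partial>\<mu>) \<le> ennreal (h powr \<theta>)"
proof (cases "h = 0")
  case True
  then have "(\<integral>\<^sup>+x. ennreal (e x) \<partial>\<mu>) = 0" using h by simp
  then have "AE x in \<mu>. e x = 0"
    using e by (subst (asm) nn_integral_0_iff_AE) (auto elim!: eventually_mono intro: antisym)
  then have "(\<integral>\<^sup>+x. ennreal (e x powr \<theta>) \<partial>\<mu>) = (\<integral>\<^sup>+x. 0 \<partial>\<mu>)"
    by (intro nn_integral_cong_AE) (auto elim!: eventually_mono)
  then show ?thesis by simp
next
  case False
  interpret prob_space \<mu> by fact
  have hp: "0 < h" using False h by simp
  have "(\<integral>\<^sup>+x. ennreal (e x powr \<theta>) \<partial>\<mu>) \<le> (\<integral>\<^sup>+x. ennreal (h powr \<theta> * \<theta> / h) * ennreal (e x) + ennreal (h powr \<theta> * (1 - \<theta>)) \<partial>\<mu>)"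
  proof (rule nn_integral_mono)
    fix x
    have "e x powr \<theta> \<le> h powr \<theta> * \<theta> / h * e x + h powr \<theta> * (1 - \<theta>)"
      using powr_weighted_le[OF e[of x] hp \<theta>] by (simp add: distrib_left)
    then show "ennreal (e x powr \<theta>) \<le> ennreal (h powr \<theta> * \<theta> / h) * ennreal (e x) + ennreal (h powr \<theta> * (1 - \<theta>))"
      using e[of x] hp \<theta> by (simp add: ennreal_mult[symmetric] ennreal_plus[symmetric] ennreal_leI del: ennreal_plus)
  qed
  also have "\<dots> = ennreal (h powr \<theta> * \<theta> / h) * (\<integral>\<^sup>+x. ennreal (e x) \<partial>\<mu>) + ennreal (h powr \<theta> * (1 - \<theta>))"
    by (simp add: nn_integral_add nn_integral_cmult emeasure_space_1)
  also have "\<dots> \<le> ennreal (h powr \<theta> * \<theta> / h) * ennreal h + ennreal (h powr \<theta> * (1 - \<theta>))"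
    by (intro add_mono mult_left_mono h) auto
  also have "\<dots> = ennreal (h powr \<theta>)"
    using hp \<theta> by (simp add: ennreal_mult[symmetric] ennreal_plus[symmetric] right_diff_distrib del: ennreal_plus)
  finally show ?thesis .
qed

text \<open>The first leg comes from the transport inequality for Q applied to a law with density g,
  the second from the assumed cost bound between Q and Q'. Finite moments travel the same way: from
  the density to Q, and on to Q'.\<close>

lemma couplings_along_detour:
  fixes Q Q' :: "'a::{metric_space, second_countable_topology} measure"
  assumes Q: "prob_space Q" "sets Q = sets borel" and g: "g \<in> borel_measurable Q" "\<And>y. 0 \<le> g y"
    and r: "prob_space (density Q (\<lambda>y. ennreal (g y)))" and s: "1 \<le> s" and \<alpha>: "0 < \<alpha>"
    and T: "T_ineq borel dist s \<alpha> Q" and ent: "(\<integral>\<^sup>+y. ennreal (phi (g y)) \<partial>Q) = ennreal e" "0 \<le> e"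
    and mom: "moment s x0 (density Q (\<lambda>y. ennreal (g y))) < \<infinity>"
    and W: "Wcost borel dist s Q Q' \<le> ennreal b" "0 \<le> b" and \<eta>: "0 < (\<eta>::real)"
  obtains \<pi>1 c1 \<pi>2 c2 where
    "\<pi>1 \<in> couplings borel (density Q (\<lambda>y. ennreal (g y))) Q" "transport_cost s \<pi>1 = ennreal c1"
    "\<pi>2 \<in> couplings borel Q Q'" "transport_cost s \<pi>2 = ennreal c2"
    "0 \<le> c1" "0 \<le> c2" "c1 \<le> (2 / \<alpha> * e) powr (s / 2) + \<eta>" "c2 \<le> b + \<eta>"
    "moment s x0 Q' < \<infinity>"
proof -
  let ?r = "density Q (\<lambda>y. ennreal (g y))"
  have E: "Ent ?r Q = ereal e"
    using Ent_density[OF Q(1) g r] ent by simp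
  have "?r \<in> Prob_s borel dist s"
    using r Q(2) mom by (auto simp: Prob_s_def)
  then have "Wass borel dist s ?r Q \<le> ereal ((2 / \<alpha> * e) powr (1 / 2))"
    using T E by (force simp: T_ineq_def epowr_def)
  then have "Wcost borel dist s ?r Q \<le> ennreal (((2 / \<alpha> * e) powr (1 / 2)) powr s)"
    using s by (intro Wcost_le_of_Wass_le) auto
  then have "Wcost borel dist s ?r Q \<le> ennreal ((2 / \<alpha> * e) powr (s / 2))"
    by (simp add: powr_powr)
  then obtain \<pi>1 c1 where 1: "\<pi>1 \<in> couplings borel ?r Q" "transport_cost s \<pi>1 = ennreal c1"
    "0 \<le> c1" "c1 \<le> (2 / \<alpha> * e) powr (s / 2) + \<eta>"
    by (rule almost_optimal_coupling[OF _ _ \<eta>]) auto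
  obtain \<pi>2 c2 where 2: "\<pi>2 \<in> couplings borel Q Q'" "transport_cost s \<pi>2 = ennreal c2"
    "0 \<le> c2" "c2 \<le> b + \<eta>"
    by (rule almost_optimal_coupling[OF W \<eta>])
  have "moment s x0 Q < \<infinity>"
    by (rule moment_coupling[OF 1(1) _ mom s]) (simp add: 1(2))
  then have "moment s x0 Q' < \<infinity>"
    by (intro moment_coupling[OF 2(1) _ _ s]) (simp_all add: 2(2))
  then show ?thesis using 1 2 by (intro that[of \<pi>1 c1 \<pi>2 c2]) auto
qed

text \<open>The density f of the shorter path and the split H = H1 + h must be fixed before a
  coupling of the shorter paths is available, since the induction hypothesis is applied to f and H1.
  Hence the last conclusion speaks of all couplings \<pi> and their costs.\<close>

lemma coupling_step:
  fixes J :: "(nat \<Rightarrow> 'a::{metric_space, second_countable_topology}) measure"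
    and q :: "(nat \<Rightarrow> 'a) \<Rightarrow> 'a measure" and F :: "(nat \<Rightarrow> 'a) \<Rightarrow> real"
  assumes J: "prob_space J" "sets J = sets (Xsp k)" and q[measurable]: "q \<in> Xsp k \<rightarrow>\<^sub>M prob_algebra borel"
    and s: "1 \<le> s" "s \<le> 2" and \<alpha>: "0 < \<alpha>" and \<gamma>: "0 < \<gamma>" and \<epsilon>: "0 < (\<epsilon>::real)"
    and T: "\<And>x. x \<in> space (Xsp k) \<Longrightarrow> T_ineq borel dist s \<alpha> (q x)"
    and L: "\<And>x y. x \<in> space (Xsp k) \<Longrightarrow> y \<in> space (Xsp k) \<Longrightarrow>
        Wcost borel dist s (q x) (q y) \<le> ennreal (\<Sum>j=1..k. w j * dist (x j) (y j) powr s)"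
    and w: "\<And>j. j \<in> {1..k} \<Longrightarrow> 0 \<le> w j"
    and F[measurable]: "F \<in> borel_measurable (Xsp (Suc k))" and F0: "\<And>x. 0 \<le> F x"
    and F1: "(\<integral>\<^sup>+x. ennreal (F x) \<partial>extend_law k J q) = 1"
    and mom: "path_moment s x0 (Suc k) (density (extend_law k J q) (\<lambda>x. ennreal (F x))) < \<infinity>"
    and ent: "(\<integral>\<^sup>+x. ennreal (phi (F x)) \<partial>extend_law k J q) = ennreal H" "0 \<le> H"
  obtains f H1 h where "f \<in> borel_measurable (Xsp k)" "\<And>x. 0 \<le> (f x :: real)" "(\<integral>\<^sup>+x. ennreal (f x) \<partial>J) = 1"
    "path_moment s x0 k (density J (\<lambda>x. ennreal (f x))) < \<infinity>"
    "(\<integral>\<^sup>+x. ennreal (phi (f x)) \<partial>J) = ennreal H1" "0 \<le> H1" "0 \<le> h" "H1 + h = H"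
    "\<forall>\<pi> a. \<pi> \<in> couplings (Xsp k) (density J (\<lambda>x. ennreal (f x))) J \<longrightarrow>
      (\<forall>j\<in>{1..k}. 0 \<le> a j \<and> coordinate_cost s j \<pi> = ennreal (a j)) \<longrightarrow>
      (\<exists>\<pi>'\<in>couplings (Xsp (Suc k)) (density (extend_law k J q) (\<lambda>x. ennreal (F x))) (extend_law k J q).
        (\<forall>j\<in>{1..k}. coordinate_cost s j \<pi>' = ennreal (a j)) \<and>
        (\<exists>a'\<ge>0. coordinate_cost s (Suc k) \<pi>' = ennreal a' \<and>
          a' \<le> (1 + \<gamma>) powr (s - 1) * (\<Sum>j=1..k. w j * a j) + (1 + 1 / \<gamma>) powr (s - 1) * (2 / \<alpha> * h) powr (s / 2) + \<epsilon>))"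
proof -
  let ?A = "Xsp k :: (nat \<Rightarrow> 'a) measure" and ?S = "Xsp (Suc k) :: (nat \<Rightarrow> 'a) measure"
  let ?J' = "extend_law k J q"
  interpret J: prob_space J by fact
  have spJ: "space J = space ?A" using J(2) by (rule sets_eq_imp_space_eq)
  note nnJ' = nn_integral_extend_law[OF J q]
  have "(\<lambda>z. F ((\<lambda>(x, y). x(Suc k := y)) z)) \<in> borel_measurable (?A \<Otimes>\<^sub>M borel)"
    by measurable
  then have Fm: "(\<lambda>(x, y). F (x(Suc k := y))) \<in> borel_measurable (?A \<Otimes>\<^sub>M borel)"
    by (simp add: split_beta)
  have F1': "(\<integral>\<^sup>+x. \<integral>\<^sup>+y. ennreal (F (x(Suc k := y))) \<partial>q x \<partial>J) = 1"
    using F1 by (subst (asm) nnJ') auto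
  obtain f g where f[measurable]: "f \<in> borel_measurable ?A" and f0: "\<And>x. 0 \<le> (f x :: real)" and f1: "(\<integral>\<^sup>+x. ennreal (f x) \<partial>J) = 1"
    and g: "(\<lambda>(x, y). g x y) \<in> borel_measurable (?A \<Otimes>\<^sub>M borel)" and g0: "\<And>x y. 0 \<le> (g x y :: real)"
    and g1: "\<And>x. x \<in> space ?A \<Longrightarrow> (\<integral>\<^sup>+y. ennreal (g x y) \<partial>q x) = 1"
    and fg: "AE x in J. AE y in q x. F (x(Suc k := y)) = f x * g x y"
    and chain: "(\<integral>\<^sup>+x. \<integral>\<^sup>+y. ennreal (phi (F (x(Suc k := y)))) \<partial>q x \<partial>J)
      = (\<integral>\<^sup>+x. ennreal (phi (f x)) \<partial>J) + (\<integral>\<^sup>+x. ennreal (f x) * (\<integral>\<^sup>+y. ennreal (phi (g x y)) \<partial>q x) \<partial>J)"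
    by (rule kernel_density_disintegration[OF J q Fm F0 F1']) (rule that; assumption)
  define r where "r x = density (q x) (\<lambda>y. ennreal (g x y))" for x
  note gm = g
  note [measurable] = g
  note [measurable_cong] = J(2)
  have r[measurable]: "r \<in> ?A \<rightarrow>\<^sub>M prob_algebra borel"
    unfolding r_def by (rule measurable_density_kernel[OF _ q g1]) measurable
  have slice: "g x \<in> borel_measurable (q x)" if "x \<in> space ?A" for x
  proof -
    have "(\<lambda>y. case (x, y) of (x, y) \<Rightarrow> g x y) \<in> borel_measurable borel"
      using that by (intro measurable_compose[OF _ gm]) auto
    then show ?thesis using prob_kernelD[OF q that] by (simp cong: measurable_cong_sets)
  qed
  have upd: "(\<lambda>y. x(Suc k := y)) \<in> borel \<rightarrow>\<^sub>M ?S" if "x \<in> space ?A" for x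
  proof -
    have "(\<lambda>y. (\<lambda>(x, y). x(Suc k := y)) (x, y)) \<in> borel \<rightarrow>\<^sub>M ?S"
      using that by (intro measurable_compose[OF _ measurable_Xsp_extend]) auto
    then show ?thesis by simp
  qed
  let ?\<nu> = "density J (\<lambda>x. ennreal (f x))" and ?\<nu>' = "density ?J' (\<lambda>x. ennreal (F x))"
  have \<nu>: "prob_space ?\<nu>" "sets ?\<nu> = sets ?A"
    using f1 J(2) by (auto intro!: prob_spaceI simp: emeasure_density cong: nn_integral_cong_simp)
  have J': "prob_space ?J'" "sets ?J' = sets ?S"
    by (rule prob_extend_law[OF J q] sets_extend_law[OF J q])+
  \<comment> \<open>The measure with density F disintegrates as \<nu> followed by r; in particular
    it is the extension of \<nu> by r.\<close>
  have nn\<nu>': "(\<integral>\<^sup>+x. h x \<partial>?\<nu>') = (\<integral>\<^sup>+x. \<integral>\<^sup>+y. h (x(Suc k := y)) \<partial>r x \<partial>?\<nu>)"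
    if h[measurable]: "h \<in> borel_measurable ?S" for h
  proof -
    have "(\<lambda>z. h ((\<lambda>(x, y). x(Suc k := y)) z)) \<in> borel_measurable (?A \<Otimes>\<^sub>M borel)" by measurable
    then have hm[measurable]: "(\<lambda>(x, y). h (x(Suc k := y))) \<in> borel_measurable (?A \<Otimes>\<^sub>M borel)" by (simp add: split_beta)
    have "(\<integral>\<^sup>+x. h x \<partial>?\<nu>') = (\<integral>\<^sup>+x. ennreal (F x) * h x \<partial>?J')"
      using J'(2) by (intro nn_integral_density) (auto cong: measurable_cong_sets)
    also have "\<dots> = (\<integral>\<^sup>+x. \<integral>\<^sup>+y. ennreal (F (x(Suc k := y))) * h (x(Suc k := y)) \<partial>q x \<partial>J)"
      by (subst nnJ') auto
    also have "\<dots> = (\<integral>\<^sup>+x. ennreal (f x) * (\<integral>\<^sup>+y. h (x(Suc k := y)) \<partial>r x) \<partial>J)"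
    proof (rule nn_integral_cong_AE)
      show "AE x in J. (\<integral>\<^sup>+y. ennreal (F (x(Suc k := y))) * h (x(Suc k := y)) \<partial>q x) = ennreal (f x) * (\<integral>\<^sup>+y. h (x(Suc k := y)) \<partial>r x)"
        using fg AE_space
      proof eventually_elim
        fix x assume ae: "AE y in q x. F (x(Suc k := y)) = f x * g x y" and "x \<in> space J"
        then have x: "x \<in> space ?A" by (simp add: spJ)
        have hx: "(\<lambda>y. h (x(Suc k := y))) \<in> borel_measurable (q x)"
          using measurable_compose[OF upd[OF x] h] prob_kernelD[OF q x] by (simp cong: measurable_cong_sets)
        note [measurable] = slice[OF x] hx
        have "(\<integral>\<^sup>+y. ennreal (F (x(Suc k := y))) * h (x(Suc k := y)) \<partial>q x)
            = (\<integral>\<^sup>+y. ennreal (f x) * (ennreal (g x y) * h (x(Suc k := y))) \<partial>q x)"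
          using ae f0 g0 by (intro nn_integral_cong_AE) (auto elim!: eventually_mono simp: ennreal_mult mult.assoc)
        also have "\<dots> = ennreal (f x) * (\<integral>\<^sup>+y. ennreal (g x y) * h (x(Suc k := y)) \<partial>q x)"
          by (rule nn_integral_cmult) measurable
        also have "(\<integral>\<^sup>+y. ennreal (g x y) * h (x(Suc k := y)) \<partial>q x) = (\<integral>\<^sup>+y. h (x(Suc k := y)) \<partial>r x)"
          unfolding r_def by (rule nn_integral_density[symmetric]) measurable
        finally show "(\<integral>\<^sup>+y. ennreal (F (x(Suc k := y))) * h (x(Suc k := y)) \<partial>q x) = ennreal (f x) * (\<integral>\<^sup>+y. h (x(Suc k := y)) \<partial>r x)" .
      qed
    qed
    also have "\<dots> = (\<integral>\<^sup>+x. \<integral>\<^sup>+y. h (x(Suc k := y)) \<partial>r x \<partial>?\<nu>)"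
      by (rule nn_integral_density[symmetric]) measurable
    finally show ?thesis .
  qed
  have \<nu>'_eq: "?\<nu>' = extend_law k ?\<nu> r"
  proof (rule measure_eqI)
    show "sets ?\<nu>' = sets (extend_law k ?\<nu> r)" using sets_extend_law[OF \<nu> r] J'(2) by simp
    fix B assume "B \<in> sets ?\<nu>'"
    then have B: "B \<in> sets ?S" using J'(2) by simp
    then have "(\<integral>\<^sup>+x. indicator B x \<partial>?\<nu>') = (\<integral>\<^sup>+x. indicator B x \<partial>extend_law k ?\<nu> r)"
      by (subst nn\<nu>', simp, subst nn_integral_extend_law[OF \<nu> r]) auto
    then show "emeasure ?\<nu>' B = emeasure (extend_law k ?\<nu> r) B"
      using B J'(2) sets_extend_law[OF \<nu> r] by simp
  qed
  have momr: "(\<lambda>x. \<integral>\<^sup>+y. ennreal (dist y (x0 (Suc k)) powr s) \<partial>r x) \<in> borel_measurable ?A"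
    by measurable
  have momS: "(\<lambda>x. ennreal (\<Sum>j=1..m. dist (x j) (x0 j) powr s)) \<in> borel_measurable (Xsp m :: (nat \<Rightarrow> 'a) measure)" for m
    by measurable
  have "path_moment s x0 (Suc k) ?\<nu>'
      = (\<integral>\<^sup>+x. \<integral>\<^sup>+y. ennreal (\<Sum>j=1..k. dist (x j) (x0 j) powr s) + ennreal (dist y (x0 (Suc k)) powr s) \<partial>r x \<partial>?\<nu>)"
    by (subst nn\<nu>'[OF momS]) (auto simp: sum_nonneg intro!: nn_integral_cong)
  also have "\<dots> = (\<integral>\<^sup>+x. ennreal (\<Sum>j=1..k. dist (x j) (x0 j) powr s) + moment s (x0 (Suc k)) (r x) \<partial>?\<nu>)"
  proof (rule nn_integral_cong)
    fix x assume "x \<in> space ?\<nu>"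
    then have x: "x \<in> space ?A" by (simp add: spJ)
    note rx = prob_kernelD[OF r x]
    have "(\<lambda>y. ennreal (dist y (x0 (Suc k)) powr s)) \<in> borel_measurable (r x)"
      using rx(2) by (simp cong: measurable_cong_sets)
    then show "(\<integral>\<^sup>+y. ennreal (\<Sum>j=1..k. dist (x j) (x0 j) powr s) + ennreal (dist y (x0 (Suc k)) powr s) \<partial>r x)
      = ennreal (\<Sum>j=1..k. dist (x j) (x0 j) powr s) + moment s (x0 (Suc k)) (r x)"
      using prob_space.emeasure_space_1[OF rx(1)] by (subst nn_integral_add) auto
  qed
  also have "\<dots> = path_moment s x0 k ?\<nu> + (\<integral>\<^sup>+x. \<integral>\<^sup>+y. ennreal (dist y (x0 (Suc k)) powr s) \<partial>r x \<partial>?\<nu>)"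
    using momS[of k] momr \<nu>(2) by (intro nn_integral_add) (simp_all cong: measurable_cong_sets)
  finally have mom_split: "path_moment s x0 k ?\<nu> < \<infinity>"
    "(\<integral>\<^sup>+x. \<integral>\<^sup>+y. ennreal (dist y (x0 (Suc k)) powr s) \<partial>r x \<partial>?\<nu>) < \<infinity>"
    using mom by (auto simp: less_top)
  \<comment> \<open>The entropy of the conditional law r x relative to q x; its average under \<nu>
    is the chain rule summand h.\<close>
  define E where "E x = (\<integral>\<^sup>+y. ennreal (phi (g x y)) \<partial>q x)" for x
  have Em[measurable]: "E \<in> borel_measurable ?A" unfolding E_def by measurable
  have E\<nu>: "(\<integral>\<^sup>+x. ennreal (f x) * E x \<partial>J) = (\<integral>\<^sup>+x. E x \<partial>?\<nu>)"
    by (rule nn_integral_density[symmetric]) measurable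
  have "ennreal H = (\<integral>\<^sup>+x. ennreal (phi (f x)) \<partial>J) + (\<integral>\<^sup>+x. E x \<partial>?\<nu>)"
    unfolding E\<nu>[symmetric] unfolding E_def using ent(1) chain by (subst (asm) nnJ') auto
  then obtain H1 h where H: "(\<integral>\<^sup>+x. ennreal (phi (f x)) \<partial>J) = ennreal H1" "(\<integral>\<^sup>+x. E x \<partial>?\<nu>) = ennreal h"
    "0 \<le> H1" "0 \<le> h" "H1 + h = H"
    by (cases "\<integral>\<^sup>+x. ennreal (phi (f x)) \<partial>J"; cases "\<integral>\<^sup>+x. E x \<partial>?\<nu>")
       (use ent(2) in \<open>auto simp: ennreal_plus[symmetric] simp del: ennreal_plus\<close>)
  \<comment> \<open>Only \<nu>-almost every past has finite conditional entropy and moment.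
    \<open>AEz\<close> later transfers both facts to the coupling through its first marginal, which
    covers the assumptions of \<open>Kbound\<close>.\<close>
  have e_fin: "AE x in ?\<nu>. E x \<noteq> \<infinity>"
    using H(2) \<nu>(2) by (intro nn_integral_PInf_AE) (auto cong: measurable_cong_sets)
  have mom_fin: "AE x in ?\<nu>. moment s (x0 (Suc k)) (r x) \<noteq> \<infinity>"
    using mom_split(2) momr \<nu>(2) by (intro nn_integral_PInf_AE) (auto cong: measurable_cong_sets)
  define l1 l2 where "l1 = (1 + 1 / \<gamma>) powr (s - 1)" and "l2 = (1 + \<gamma>) powr (s - 1)"
  have "0 < 1 + 1 / \<gamma>" "0 < 1 + \<gamma>" using \<gamma> by (auto intro: add_pos_pos)
  then have l: "0 < l1" "0 < l2" by (auto simp: l1_def l2_def)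
  \<comment> \<open>Half of \<epsilon> pays for the selection of K, the other half for the two
    almost optimal couplings, weighted by l1 and l2.\<close>
  define \<eta> where "\<eta> = \<epsilon> / 2 / (l1 + l2)"
  have \<eta>: "0 < \<eta>" using l \<epsilon> by (simp add: \<eta>_def)
  have \<epsilon>2: "0 < \<epsilon> / 2" using \<epsilon> by simp
  have rf: "(\<lambda>z. r (fst z)) \<in> ?A \<Otimes>\<^sub>M ?A \<rightarrow>\<^sub>M prob_algebra borel" and qs: "(\<lambda>z. q (snd z)) \<in> ?A \<Otimes>\<^sub>M ?A \<rightarrow>\<^sub>M prob_algebra borel"
    by measurable
  obtain K where K: "K \<in> ?A \<Otimes>\<^sub>M ?A \<rightarrow>\<^sub>M prob_algebra (borel \<Otimes>\<^sub>M borel)"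
    and Kc: "\<And>z. z \<in> space (?A \<Otimes>\<^sub>M ?A) \<Longrightarrow> K z \<in> couplings borel (r (fst z)) (q (snd z))"
    and Kopt: "\<And>z y0 \<kappa> \<pi>1 \<pi>2 c1 c2 \<gamma>. z \<in> space (?A \<Otimes>\<^sub>M ?A) \<Longrightarrow>
      moment s y0 (r (fst z)) < \<infinity> \<Longrightarrow> moment s y0 (q (snd z)) < \<infinity> \<Longrightarrow>
      \<pi>1 \<in> couplings borel (r (fst z)) \<kappa> \<Longrightarrow> transport_cost s \<pi>1 = ennreal c1 \<Longrightarrow>
      \<pi>2 \<in> couplings borel \<kappa> (q (snd z)) \<Longrightarrow> transport_cost s \<pi>2 = ennreal c2 \<Longrightarrow>
      0 \<le> c1 \<Longrightarrow> 0 \<le> c2 \<Longrightarrow> 0 < \<gamma> \<Longrightarrow>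
      transport_cost s (K z)
        \<le> ennreal ((1 + 1 / \<gamma>) powr (s - 1) * c1 + (1 + \<gamma>) powr (s - 1) * c2 + \<epsilon> / 2)"
    by (rule kernel_coupling_selection[OF rf qs s \<epsilon>2]) (rule that; assumption)
  have Kbound: "transport_cost s (K z)
      \<le> ennreal (l1 * (2 / \<alpha> * enn2real (E (fst z))) powr (s / 2) + l2 * (\<Sum>j=1..k. w j * dist (fst z j) (snd z j) powr s) + \<epsilon>)"
    if z: "z \<in> space (?A \<Otimes>\<^sub>M ?A)" and Efin: "E (fst z) \<noteq> \<infinity>"
      and mfin: "moment s (x0 (Suc k)) (r (fst z)) \<noteq> \<infinity>" for z
  proof -
    have x: "fst z \<in> space ?A" "snd z \<in> space ?A" using z by (auto simp: space_pair_measure)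
    let ?b = "\<Sum>j=1..k. w j * dist (fst z j) (snd z j) powr s"
    have b: "0 \<le> ?b" using w by (intro sum_nonneg) auto
    have Ee: "(\<integral>\<^sup>+y. ennreal (phi (g (fst z) y)) \<partial>q (fst z)) = ennreal (enn2real (E (fst z)))"
      using Efin by (simp add: E_def less_top)
    have mfin': "moment s (x0 (Suc k)) (density (q (fst z)) (\<lambda>y. ennreal (g (fst z) y))) < \<infinity>"
      using mfin by (simp add: r_def less_top)
    obtain \<pi>1 c1 \<pi>2 c2 where d:
      "\<pi>1 \<in> couplings borel (density (q (fst z)) (\<lambda>y. ennreal (g (fst z) y))) (q (fst z))" "transport_cost s \<pi>1 = ennreal c1"
      "\<pi>2 \<in> couplings borel (q (fst z)) (q (snd z))" "transport_cost s \<pi>2 = ennreal c2"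
      "0 \<le> c1" "0 \<le> c2" "c1 \<le> (2 / \<alpha> * enn2real (E (fst z))) powr (s / 2) + \<eta>" "c2 \<le> ?b + \<eta>"
      "moment s (x0 (Suc k)) (q (snd z)) < \<infinity>"
      by (rule couplings_along_detour[OF prob_kernelD(1,2)[OF q x(1)] slice[OF x(1)] g0 prob_kernelD(1)[OF r x(1), unfolded r_def]
            s(1) \<alpha> T[OF x(1)] Ee enn2real_nonneg mfin' L[OF x] b \<eta>])
    have "transport_cost s (K z) \<le> ennreal (l1 * c1 + l2 * c2 + \<epsilon> / 2)"
      unfolding l1_def l2_def using mfin' d by (intro Kopt[OF z _ _ _ _ _ _ _ _ \<gamma>]) (auto simp: r_def)
    also have "\<dots> \<le> ennreal (l1 * ((2 / \<alpha> * enn2real (E (fst z))) powr (s / 2) + \<eta>) + l2 * (?b + \<eta>) + \<epsilon> / 2)"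
      using l d by (intro ennreal_leI add_mono mult_left_mono) auto
    also have "l1 * ((2 / \<alpha> * enn2real (E (fst z))) powr (s / 2) + \<eta>) + l2 * (?b + \<eta>) + \<epsilon> / 2
      = l1 * (2 / \<alpha> * enn2real (E (fst z))) powr (s / 2) + l2 * ?b + (l1 + l2) * \<eta> + \<epsilon> / 2"
      by (simp add: algebra_simps)
    also have "(l1 + l2) * \<eta> = \<epsilon> / 2"
    proof -
      have "L * (X / L) = X" if "0 < L" for L X :: real using that by simp
      then show ?thesis unfolding \<eta>_def using l by (meson add_pos_pos)
    qed
    finally show ?thesis by (simp add: add.assoc)
  qed
  show ?thesis
  proof (rule that[OF f f0 f1 mom_split(1) H(1,3,4,5)], intro allI impI)
    fix \<pi> a assume \<pi>: "\<pi> \<in> couplings ?A ?\<nu> J"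
      and a': "\<forall>j\<in>{1..k}. 0 \<le> a j \<and> coordinate_cost s j \<pi> = ennreal (a j)"
    note a = bspec[OF a']
    have \<pi>': "prob_space \<pi>" and \<pi>s[measurable_cong]: "sets \<pi> = sets (?A \<Otimes>\<^sub>M ?A)" and \<pi>d: "distr \<pi> ?A fst = ?\<nu>"
      using \<pi> by (auto simp: couplings_def)
    interpret \<pi>: prob_space \<pi> by fact
    have sp\<pi>: "space \<pi> = space (?A \<Otimes>\<^sub>M ?A)" using \<pi>s by (rule sets_eq_imp_space_eq)
    let ?\<pi> = "extend_coupling k \<pi> K"
    note nn\<pi> = nn_integral_extend_coupling[OF \<pi> K r q Kc]
    have dm: "(\<lambda>z. ennreal (dist (fst z j) (snd z j) powr s)) \<in> borel_measurable (Xsp m \<Otimes>\<^sub>M (Xsp m :: (nat \<Rightarrow> 'a) measure))"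
      if "j \<in> {1..m}" for j m
      using measurable_compose[OF measurable_fst measurable_Xsp_component[OF that]]
        measurable_compose[OF measurable_snd measurable_Xsp_component[OF that]]
      by measurable
    have Kp: "emeasure (K z) (space (K z)) = 1" if "z \<in> space \<pi>" for z
      using prob_kernelD(1)[OF K] that by (simp add: sp\<pi> prob_space.emeasure_space_1)
    have old: "coordinate_cost s j ?\<pi> = ennreal (a j)" if j: "j \<in> {1..k}" for j
    proof -
      have "coordinate_cost s j ?\<pi>
          = (\<integral>\<^sup>+z. \<integral>\<^sup>+w. ennreal (dist (fst z j) (snd z j) powr s) \<partial>K z \<partial>\<pi>)"
        using j by (subst nn\<pi>[OF _ dm]) auto
      also have "\<dots> = coordinate_cost s j \<pi>"
        by (intro nn_integral_cong) (simp add: Kp)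
      finally show ?thesis using a[OF j] by simp
    qed
    have new: "coordinate_cost s (Suc k) ?\<pi>
        = (\<integral>\<^sup>+z. \<integral>\<^sup>+w. ennreal (dist (fst w) (snd w) powr s) \<partial>K z \<partial>\<pi>)"
      by (subst nn\<pi>[OF _ dm]) auto
    define e where "e x = 2 / \<alpha> * enn2real (E x)" for x
    have e0: "0 \<le> e x" for x using \<alpha> by (simp add: e_def)
    have em[measurable]: "e \<in> borel_measurable ?A" unfolding e_def by measurable
    have "(\<integral>\<^sup>+x. ennreal (e x) \<partial>?\<nu>) = (\<integral>\<^sup>+x. ennreal (2 / \<alpha>) * E x \<partial>?\<nu>)"
    proof (rule nn_integral_cong_AE)
      show "AE x in ?\<nu>. ennreal (e x) = ennreal (2 / \<alpha>) * E x"
        using e_fin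
      proof eventually_elim
        fix x assume "E x \<noteq> \<infinity>"
        then have "E x = ennreal (enn2real (E x))" by (simp add: less_top)
        moreover have "ennreal (2 / \<alpha> * enn2real (E x)) = ennreal (2 / \<alpha>) * ennreal (enn2real (E x))"
          using \<alpha> by (intro ennreal_mult) auto
        ultimately show "ennreal (e x) = ennreal (2 / \<alpha>) * E x" by (simp only: e_def)
      qed
    qed
    also have "\<dots> = ennreal (2 / \<alpha>) * ennreal h"
      using H(2) \<nu>(2) by (subst nn_integral_cmult) (auto cong: measurable_cong_sets)
    also have "\<dots> = ennreal (2 / \<alpha> * h)"
      using \<alpha> H(4) by (intro ennreal_mult[symmetric]) auto
    \<comment> \<open>Jensen with exponent s/2 \<le> 1: averaging the powers of conditional
      entropies gives at most the power of their average.\<close>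
    finally have eh: "(\<integral>\<^sup>+x. ennreal (e x powr (s / 2)) \<partial>?\<nu>) \<le> ennreal ((2 / \<alpha> * h) powr (s / 2))"
      using s \<alpha> H(4) \<nu> em e0 by (intro nn_integral_powr_le) (auto cong: measurable_cong_sets)
    have AEz: "AE z in \<pi>. E (fst z) \<noteq> \<infinity> \<and> moment s (x0 (Suc k)) (r (fst z)) \<noteq> \<infinity>"
    proof (rule AE_distrD[where M' = ?A])
      show "fst \<in> \<pi> \<rightarrow>\<^sub>M ?A" by measurable
      show "AE x in distr \<pi> ?A fst. E x \<noteq> \<infinity> \<and> moment s (x0 (Suc k)) (r x) \<noteq> \<infinity>"
        unfolding \<pi>d using e_fin mom_fin by eventually_elim simp
    qed
    have "(\<integral>\<^sup>+z. \<integral>\<^sup>+w. ennreal (dist (fst w) (snd w) powr s) \<partial>K z \<partial>\<pi>)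
        \<le> (\<integral>\<^sup>+z. ennreal l1 * ennreal (e (fst z) powr (s / 2))
            + ennreal l2 * (\<Sum>j=1..k. ennreal (w j) * ennreal (dist (fst z j) (snd z j) powr s)) + ennreal \<epsilon> \<partial>\<pi>)"
    proof (rule nn_integral_mono_AE)
      show "AE z in \<pi>. transport_cost s (K z)
          \<le> ennreal l1 * ennreal (e (fst z) powr (s / 2))
            + ennreal l2 * (\<Sum>j=1..k. ennreal (w j) * ennreal (dist (fst z j) (snd z j) powr s)) + ennreal \<epsilon>"
        using AEz AE_space
      proof eventually_elim
        fix z assume "E (fst z) \<noteq> \<infinity> \<and> moment s (x0 (Suc k)) (r (fst z)) \<noteq> \<infinity>" "z \<in> space \<pi>"
        then have "transport_cost s (K z)
          \<le> ennreal (l1 * e (fst z) powr (s / 2) + l2 * (\<Sum>j=1..k. w j * dist (fst z j) (snd z j) powr s) + \<epsilon>)"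
          unfolding e_def by (intro Kbound) (auto simp: sp\<pi>)
        also have "\<dots> = ennreal l1 * ennreal (e (fst z) powr (s / 2))
            + ennreal l2 * ennreal (\<Sum>j=1..k. w j * dist (fst z j) (snd z j) powr s) + ennreal \<epsilon>"
        proof -
          have "0 \<le> (\<Sum>j=1..k. w j * dist (fst z j) (snd z j) powr s)" using w by (intro sum_nonneg) auto
          then show ?thesis
            using l \<epsilon> by (simp add: ennreal_mult[symmetric] ennreal_plus[symmetric] del: ennreal_plus)
        qed
        also have "ennreal (\<Sum>j=1..k. w j * dist (fst z j) (snd z j) powr s)
            = (\<Sum>j=1..k. ennreal (w j) * ennreal (dist (fst z j) (snd z j) powr s))"
          using w by (subst sum_ennreal[symmetric]) (auto intro!: sum.cong simp: ennreal_mult)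
        finally show "transport_cost s (K z)
          \<le> ennreal l1 * ennreal (e (fst z) powr (s / 2))
            + ennreal l2 * (\<Sum>j=1..k. ennreal (w j) * ennreal (dist (fst z j) (snd z j) powr s)) + ennreal \<epsilon>" .
      qed
    qed
    also have "\<dots> = ennreal l1 * (\<integral>\<^sup>+z. ennreal (e (fst z) powr (s / 2)) \<partial>\<pi>)
        + ennreal l2 * (\<Sum>j=1..k. ennreal (w j) * coordinate_cost s j \<pi>) + ennreal \<epsilon>"
    proof -
      have dj[measurable]: "(\<lambda>z. ennreal (dist (fst z j) (snd z j) powr s)) \<in> borel_measurable \<pi>" if "j \<in> {1..k}" for j
        using dm[OF that] \<pi>s by (simp cong: measurable_cong_sets)
      have m1: "(\<lambda>z. \<Sum>j=1..k. ennreal (w j) * ennreal (dist (fst z j) (snd z j) powr s)) \<in> borel_measurable \<pi>"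
        by (intro borel_measurable_sum borel_measurable_times_ennreal dj) auto
      have m2: "(\<lambda>z. ennreal (e (fst z) powr (s / 2))) \<in> borel_measurable \<pi>" by measurable
      note [measurable] = m1 m2
      have m3: "(\<integral>\<^sup>+z. (\<Sum>j=1..k. ennreal (w j) * ennreal (dist (fst z j) (snd z j) powr s)) \<partial>\<pi>)
          = (\<Sum>j=1..k. ennreal (w j) * coordinate_cost s j \<pi>)"
        by (subst nn_integral_sum) (auto intro!: sum.cong nn_integral_cmult borel_measurable_times_ennreal dj)
      show ?thesis
        unfolding m3[symmetric] by (simp add: nn_integral_add nn_integral_cmult \<pi>.emeasure_space_1 del: One_nat_def)
    qed
    also have "(\<integral>\<^sup>+z. ennreal (e (fst z) powr (s / 2)) \<partial>\<pi>) = (\<integral>\<^sup>+x. ennreal (e x powr (s / 2)) \<partial>?\<nu>)"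
      unfolding \<pi>d[symmetric] by (subst nn_integral_distr) auto
    also have "(\<Sum>j=1..k. ennreal (w j) * coordinate_cost s j \<pi>) = ennreal (\<Sum>j=1..k. w j * a j)"
      using a w by (subst sum_ennreal[symmetric]) (auto intro!: sum.cong simp: ennreal_mult)
    also have "ennreal l1 * (\<integral>\<^sup>+x. ennreal (e x powr (s / 2)) \<partial>?\<nu>) + ennreal l2 * ennreal (\<Sum>j=1..k. w j * a j) + ennreal \<epsilon>
       \<le> ennreal l1 * ennreal ((2 / \<alpha> * h) powr (s / 2)) + ennreal l2 * ennreal (\<Sum>j=1..k. w j * a j) + ennreal \<epsilon>"
      by (intro add_mono mult_left_mono eh) auto
    also have "\<dots> = ennreal (l2 * (\<Sum>j=1..k. w j * a j) + l1 * (2 / \<alpha> * h) powr (s / 2) + \<epsilon>)"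
    proof -
      have "0 \<le> (\<Sum>j=1..k. w j * a j)" using w a by (intro sum_nonneg) auto
      then show ?thesis
        using l \<epsilon> by (simp add: ennreal_mult[symmetric] ennreal_plus[symmetric] add.commute del: ennreal_plus)
    qed
    finally have bound: "coordinate_cost s (Suc k) ?\<pi>
        \<le> ennreal (l2 * (\<Sum>j=1..k. w j * a j) + l1 * (2 / \<alpha> * h) powr (s / 2) + \<epsilon>)" by (simp only: new)
    have nonneg: "0 \<le> l2 * (\<Sum>j=1..k. w j * a j) + l1 * (2 / \<alpha> * h) powr (s / 2) + \<epsilon>"
      using l \<epsilon> a w by (intro add_nonneg_nonneg mult_nonneg_nonneg sum_nonneg) auto
    let ?a' = "enn2real (coordinate_cost s (Suc k) ?\<pi>)"
    have "coordinate_cost s (Suc k) ?\<pi> = ennreal ?a'"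
      using le_less_trans[OF bound ennreal_less_top] by simp
    moreover have "?a' \<le> l2 * (\<Sum>j=1..k. w j * a j) + l1 * (2 / \<alpha> * h) powr (s / 2) + \<epsilon>"
      by (rule enn2real_leI[OF nonneg bound])
    moreover have "?\<pi> \<in> couplings ?S ?\<nu>' ?J'"
      unfolding \<nu>'_eq by (rule extend_coupling_in_couplings[OF \<pi> K r q Kc])
    ultimately show "\<exists>\<pi>'\<in>couplings ?S ?\<nu>' ?J'.
        (\<forall>j\<in>{1..k}. coordinate_cost s j \<pi>' = ennreal (a j)) \<and>
        (\<exists>a'\<ge>0. coordinate_cost s (Suc k) \<pi>' = ennreal a' \<and>
          a' \<le> (1 + \<gamma>) powr (s - 1) * (\<Sum>j=1..k. w j * a j) + (1 + 1 / \<gamma>) powr (s - 1) * (2 / \<alpha> * h) powr (s / 2) + \<epsilon>)"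
      using old unfolding l1_def l2_def by (intro bexI[of _ ?\<pi>] conjI exI[of _ ?a']) auto
  qed
qed

section \<open>Transport inequality for the joint law\<close>

text \<open>The diagonal coupling. It supplies the dependence bound for the empty past, where the
  sum of distances is empty and both laws are the initial one.\<close>

lemma Wcost_self:
  fixes \<mu> :: "'a::{metric_space, second_countable_topology} measure"
  assumes \<mu>: "prob_space \<mu>" "sets \<mu> = sets borel"
  shows "Wcost borel dist s \<mu> \<mu> = 0"
proof -
  interpret prob_space \<mu> by fact
  note [measurable_cong] = \<mu>(2)
  let ?\<pi> = "distr \<mu> (borel \<Otimes>\<^sub>M borel) (\<lambda>x. (x, x))"
  have m: "(\<lambda>x. (x, x)) \<in> \<mu> \<rightarrow>\<^sub>M borel \<Otimes>\<^sub>M borel"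
    by (intro measurable_Pair) (simp_all add: measurable_ident_sets \<mu>(2))
  have "distr ?\<pi> borel fst = \<mu>" by (simp add: distr_distr[OF measurable_fst m] comp_def distr_id2 \<mu>(2))
  moreover have "distr ?\<pi> borel snd = \<mu>" by (simp add: distr_distr[OF measurable_snd m] comp_def distr_id2 \<mu>(2))
  ultimately have "?\<pi> \<in> couplings borel \<mu> \<mu>"
    using prob_space_distr[OF m] by (simp add: couplings_def)
  then have "Wcost borel dist s \<mu> \<mu> \<le> transport_cost s ?\<pi>"
    unfolding Wcost_def by (rule INF_lower)
  also have "\<dots> = 0" by (subst nn_integral_distr[OF m]) auto
  finally show ?thesis by simp
qed

lemma dS_powr:
  assumes "0 < s"
  shows "dS s n x y powr s = (\<Sum>j=1..n. dist (x j) (y j) powr s)"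
  using assms by (simp add: dS_def powr_powr sum_nonneg)

text \<open>Starting from the one-point space of empty paths makes the initial law an ordinary
  kernel, so that the induction has no special first step.\<close>

primrec kernel_chain :: "(nat \<Rightarrow> (nat \<Rightarrow> 'a::topological_space) \<Rightarrow> 'a measure) \<Rightarrow> nat \<Rightarrow> (nat \<Rightarrow> 'a) measure" where
  "kernel_chain q 0 = return (Xsp 0) (\<lambda>_. undefined)"
| "kernel_chain q (Suc k) = extend_law k (kernel_chain q k) (q (Suc k))"

lemma undefined_in_Xsp_0: "(\<lambda>_. undefined) \<in> space (Xsp 0)"
  by (simp add: space_Xsp)

lemma joint_eq_kernel_chain:
  fixes P1 :: "'a::topological_space measure"
  assumes P1: "prob_space P1" "sets P1 = sets borel"
  shows "joint P1 p (Suc k) = kernel_chain (\<lambda>k x. if k = 1 then P1 else p k x) (Suc k)"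
proof (induction k)
  case 0
  have "(\<lambda>_. P1) \<in> Xsp 0 \<rightarrow>\<^sub>M prob_algebra borel"
    using P1 by (intro measurable_const) (simp add: space_prob_algebra)
  then have "(\<lambda>x. distr P1 (Xsp (Suc 0)) (\<lambda>y. x(Suc 0 := y))) \<in> Xsp 0 \<rightarrow>\<^sub>M prob_algebra (Xsp (Suc 0))"
    by (rule extend_kernel_measurable)
  then have "kernel_chain (\<lambda>k x. if k = 1 then P1 else p k x) (Suc 0) = distr P1 (Xsp (Suc 0)) (\<lambda>y. (\<lambda>_. undefined)(Suc 0 := y))"
    unfolding kernel_chain.simps extend_law_def
    by (simp add: bind_return[OF measurable_prob_algebraD undefined_in_Xsp_0])
  moreover have "(\<lambda>y. (\<lambda>_. undefined)(Suc 0 := y)) = (\<lambda>x. \<lambda>i\<in>{1::nat}. x :: 'a)"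
    by (auto simp: fun_eq_iff restrict_def)
  ultimately show ?case by simp
next
  case (Suc k)
  then show ?case by (simp add: extend_law_def)
qed

text \<open>Hypotheses (i) and (ii) with the initial law included at k = 0. Dependence is stated for
  the cost, the s-th power of the Wasserstein distance, which is the quantity the recurrence
  handles.\<close>

locale weakly_dependent_chain =
  fixes q :: "nat \<Rightarrow> (nat \<Rightarrow> 'a::{metric_space, second_countable_topology}) \<Rightarrow> 'a measure"
    and n :: nat and s \<alpha> :: real and \<rho> :: "nat \<Rightarrow> real"
  assumes n: "1 \<le> n" and s: "1 \<le> s" "s \<le> 2" and \<alpha>: "0 < \<alpha>" and \<rho>: "\<And>l. l \<in> {1..n} \<Longrightarrow> 0 \<le> \<rho> l"
    and kernel: "\<And>k. k < n \<Longrightarrow> q (Suc k) \<in> Xsp k \<rightarrow>\<^sub>M prob_algebra borel"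
    and transport: "\<And>k x. k < n \<Longrightarrow> x \<in> space (Xsp k) \<Longrightarrow> T_ineq borel dist s \<alpha> (q (Suc k) x)"
    and dependence: "\<And>k x y. k < n \<Longrightarrow> x \<in> space (Xsp k) \<Longrightarrow> y \<in> space (Xsp k) \<Longrightarrow>
      Wcost borel dist s (q (Suc k) x) (q (Suc k) y) \<le> ennreal (\<Sum>j=1..k. \<rho> (Suc k - j) * dist (x j) (y j) powr s)"
begin

lemma prob_chain: "k \<le> n \<Longrightarrow> prob_space (kernel_chain q k) \<and> sets (kernel_chain q k) = sets (Xsp k)"
proof (induction k)
  case 0
  show ?case by (simp add: prob_space_return[OF undefined_in_Xsp_0])
next
  case (Suc k)
  then show ?case
    using prob_extend_law[of "kernel_chain q k" k "q (Suc k)"] sets_extend_law[of "kernel_chain q k" k "q (Suc k)"]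
      kernel[of k] by simp
qed

text \<open>F and H vary in the induction: dropping the last coordinate replaces the density by its
  marginal and the entropy by its first chain rule part. The h j are the parts split off along the
  way, and \<epsilon> is shared by all coordinates.\<close>

lemma chain_coupling:
  assumes \<gamma>: "0 < \<gamma>" and \<epsilon>: "0 < (\<epsilon>::real)"
  shows "k \<le> n \<Longrightarrow> F \<in> borel_measurable (Xsp k) \<Longrightarrow> (\<And>x. 0 \<le> (F x :: real)) \<Longrightarrow>
    (\<integral>\<^sup>+x. ennreal (F x) \<partial>kernel_chain q k) = 1 \<Longrightarrow>
    path_moment s x0 k (density (kernel_chain q k) (\<lambda>x. ennreal (F x))) < \<infinity> \<Longrightarrow>
    (\<integral>\<^sup>+x. ennreal (phi (F x)) \<partial>kernel_chain q k) = ennreal H \<Longrightarrow> 0 \<le> H \<Longrightarrow>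
    \<exists>\<pi>\<in>couplings (Xsp k) (density (kernel_chain q k) (\<lambda>x. ennreal (F x))) (kernel_chain q k). \<exists>a h.
      (\<forall>j\<in>{1..k}. 0 \<le> a j \<and> coordinate_cost s j \<pi> = ennreal (a j)) \<and>
      (\<forall>j\<in>{1..k}. 0 \<le> h j \<and> a j \<le> (1 + \<gamma>) powr (s - 1) * (\<Sum>i=1..j-1. \<rho> (j - i) * a i)
          + (1 + 1 / \<gamma>) powr (s - 1) * (2 / \<alpha> * h j) powr (s / 2) + \<epsilon>) \<and>
      (\<Sum>j=1..k. h j) \<le> H"
proof (induction k arbitrary: F H)
  case 0
  let ?J = "kernel_chain q 0" and ?\<nu> = "density (kernel_chain q 0) (\<lambda>x. ennreal (F x))"
  have J: "prob_space ?J" "sets ?J = sets (Xsp 0)" using prob_chain[of 0] by auto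
  have \<nu>: "prob_space ?\<nu>" "sets ?\<nu> = sets (Xsp 0)"
  proof -
    have "F \<in> borel_measurable ?J" using 0(2) J(2) by (simp del: kernel_chain.simps cong: measurable_cong_sets)
    then show "prob_space ?\<nu>"
      using 0(4) by (intro prob_spaceI) (simp add: emeasure_density del: kernel_chain.simps cong: nn_integral_cong_simp)
  qed (use J(2) in simp)
  \<comment> \<open>For empty paths the product coupling serves, written as density 1 to reuse the
    marginal computation.\<close>
  have "density (?\<nu> \<Otimes>\<^sub>M ?J) (\<lambda>_. 1) \<in> couplings (Xsp 0) ?\<nu> ?J"
    using prob_space.emeasure_space_1[OF \<nu>(1)] prob_space.emeasure_space_1[OF J(1)]
    by (intro density_in_couplings \<nu> J) (simp_all del: kernel_chain.simps)
  then show ?case using 0(7) by (intro bexI[of _ "density (?\<nu> \<Otimes>\<^sub>M ?J) (\<lambda>_. 1)"]) simp_all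
next
  case (Suc k)
  have k: "k < n" using Suc.prems by simp
  let ?J = "kernel_chain q k"
  have J: "prob_space ?J" "sets ?J = sets (Xsp k)" using prob_chain[of k] k by auto
  have w: "0 \<le> \<rho> (Suc k - j)" if "j \<in> {1..k}" for j
  proof -
    have "Suc k - j \<in> {1..n}" using that k by auto
    then show ?thesis by (rule \<rho>)
  qed
  obtain f H1 h' where f: "f \<in> borel_measurable (Xsp k)" "\<And>x. 0 \<le> (f x :: real)" "(\<integral>\<^sup>+x. ennreal (f x) \<partial>?J) = 1"
    "path_moment s x0 k (density ?J (\<lambda>x. ennreal (f x))) < \<infinity>"
    "(\<integral>\<^sup>+x. ennreal (phi (f x)) \<partial>?J) = ennreal H1" "0 \<le> H1" "0 \<le> h'" "H1 + h' = H"
    and ext: "\<forall>\<pi> a. \<pi> \<in> couplings (Xsp k) (density ?J (\<lambda>x. ennreal (f x))) ?J \<longrightarrow>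
      (\<forall>j\<in>{1..k}. 0 \<le> a j \<and> coordinate_cost s j \<pi> = ennreal (a j)) \<longrightarrow>
      (\<exists>\<pi>'\<in>couplings (Xsp (Suc k)) (density (extend_law k ?J (q (Suc k))) (\<lambda>x. ennreal (F x))) (extend_law k ?J (q (Suc k))).
        (\<forall>j\<in>{1..k}. coordinate_cost s j \<pi>' = ennreal (a j)) \<and>
        (\<exists>a'\<ge>0. coordinate_cost s (Suc k) \<pi>' = ennreal a' \<and>
          a' \<le> (1 + \<gamma>) powr (s - 1) * (\<Sum>j=1..k. \<rho> (Suc k - j) * a j) + (1 + 1 / \<gamma>) powr (s - 1) * (2 / \<alpha> * h') powr (s / 2) + \<epsilon>))"
    by (rule coupling_step[OF J kernel[OF k] s \<alpha> \<gamma> \<epsilon> transport[OF k] dependence[OF k] w Suc.prems(2,3)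
          Suc.prems(4)[unfolded kernel_chain.simps] Suc.prems(5)[unfolded kernel_chain.simps]
          Suc.prems(6)[unfolded kernel_chain.simps] Suc.prems(7)]) (assumption | (rule that; assumption))+
  obtain \<pi> a h where \<pi>: "\<pi> \<in> couplings (Xsp k) (density ?J (\<lambda>x. ennreal (f x))) ?J"
    and a: "\<forall>j\<in>{1..k}. 0 \<le> a j \<and> coordinate_cost s j \<pi> = ennreal (a j)"
    and h: "\<forall>j\<in>{1..k}. 0 \<le> h j \<and> a j \<le> (1 + \<gamma>) powr (s - 1) * (\<Sum>i=1..j-1. \<rho> (j - i) * a i)
          + (1 + 1 / \<gamma>) powr (s - 1) * (2 / \<alpha> * h j) powr (s / 2) + \<epsilon>" "(\<Sum>j=1..k. h j) \<le> H1"
    using Suc.IH[OF less_imp_le[OF k] f(1-6)] by blast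
  obtain \<pi>' a' where \<pi>': "\<pi>' \<in> couplings (Xsp (Suc k)) (density (kernel_chain q (Suc k)) (\<lambda>x. ennreal (F x))) (kernel_chain q (Suc k))"
    "\<forall>j\<in>{1..k}. coordinate_cost s j \<pi>' = ennreal (a j)"
    "0 \<le> a'" "coordinate_cost s (Suc k) \<pi>' = ennreal a'"
    "a' \<le> (1 + \<gamma>) powr (s - 1) * (\<Sum>j=1..k. \<rho> (Suc k - j) * a j) + (1 + 1 / \<gamma>) powr (s - 1) * (2 / \<alpha> * h') powr (s / 2) + \<epsilon>"
    using ext[rule_format, OF \<pi> a[rule_format]] unfolding kernel_chain.simps by blast
  define a2 h2 where "a2 = a(Suc k := a')" and "h2 = h(Suc k := h')"
  have sums: "(\<Sum>i=1..j-1. \<rho> (j - i) * a2 i) = (\<Sum>i=1..j-1. \<rho> (j - i) * a i)" if "j \<in> {1..Suc k}" for j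
    using that by (intro sum.cong) (auto simp: a2_def)
  have "\<forall>j\<in>{1..Suc k}. 0 \<le> a2 j \<and> coordinate_cost s j \<pi>' = ennreal (a2 j)"
    using a \<pi>'(2,3,4) by (auto simp: a2_def le_Suc_eq)
  moreover have "\<forall>j\<in>{1..Suc k}. 0 \<le> h2 j \<and> a2 j \<le> (1 + \<gamma>) powr (s - 1) * (\<Sum>i=1..j-1. \<rho> (j - i) * a2 i)
          + (1 + 1 / \<gamma>) powr (s - 1) * (2 / \<alpha> * h2 j) powr (s / 2) + \<epsilon>"
  proof
    fix j assume j: "j \<in> {1..Suc k}"
    show "0 \<le> h2 j \<and> a2 j \<le> (1 + \<gamma>) powr (s - 1) * (\<Sum>i=1..j-1. \<rho> (j - i) * a2 i)
          + (1 + 1 / \<gamma>) powr (s - 1) * (2 / \<alpha> * h2 j) powr (s / 2) + \<epsilon>"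
      unfolding sums[OF j] using j h(1) \<pi>'(5) f(7) by (cases "j = Suc k") (auto simp: a2_def h2_def)
  qed
  moreover have "(\<Sum>j=1..Suc k. h2 j) \<le> H"
  proof -
    have "(\<Sum>j=1..k. h2 j) = (\<Sum>j=1..k. h j)" by (intro sum.cong) (auto simp: h2_def)
    then show ?thesis using h(2) f(8) by (simp add: h2_def)
  qed
  ultimately show ?case using \<pi>'(1) by blast
qed

lemma Wcost_le_sum:
  assumes "\<pi> \<in> couplings (Xsp n) \<nu> \<mu>"
    and a: "\<And>j. j \<in> {1..n} \<Longrightarrow> 0 \<le> a j \<and> coordinate_cost s j \<pi> = ennreal (a j)"
  shows "Wcost (Xsp n :: (nat \<Rightarrow> 'a) measure) (dS s n) s \<nu> \<mu> \<le> ennreal (\<Sum>j=1..n. a j)"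
proof -
  have sp: "sets \<pi> = sets (Xsp n \<Otimes>\<^sub>M Xsp n)" using assms(1) by (simp add: couplings_def)
  have dm: "(\<lambda>z. ennreal (dist (fst z j) (snd z j) powr s)) \<in> borel_measurable \<pi>" if "j \<in> {1..n}" for j
  proof -
    have "(\<lambda>z. ennreal (dist (fst z j) (snd z j) powr s)) \<in> borel_measurable (Xsp n \<Otimes>\<^sub>M (Xsp n :: (nat \<Rightarrow> 'a) measure))"
      using measurable_compose[OF measurable_fst measurable_Xsp_component[OF that]]
        measurable_compose[OF measurable_snd measurable_Xsp_component[OF that]]
      by measurable
    then show ?thesis using sp by (simp cong: measurable_cong_sets)
  qed
  have "Wcost (Xsp n) (dS s n) s \<nu> \<mu> \<le> (\<integral>\<^sup>+z. ennreal (dS s n (fst z) (snd z) powr s) \<partial>\<pi>)"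
    unfolding Wcost_def by (rule INF_lower[OF assms(1)])
  also have "\<dots> = (\<integral>\<^sup>+z. (\<Sum>j=1..n. ennreal (dist (fst z j) (snd z j) powr s)) \<partial>\<pi>)"
    using s by (intro nn_integral_cong) (simp add: dS_powr)
  also have "\<dots> = (\<Sum>j=1..n. ennreal (a j))"
    using a dm by (subst nn_integral_sum) auto
  also have "\<dots> = ennreal (\<Sum>j=1..n. a j)"
    using a by (intro sum_ennreal) auto
  finally show ?thesis .
qed

text \<open>Densities of measures in \<open>Prob_s\<close> with finite entropy H relative to the
  chain, the entropy being expressed through \<open>phi\<close>.\<close>

definition admissible :: "((nat \<Rightarrow> 'a) \<Rightarrow> real) \<Rightarrow> real \<Rightarrow> bool" where
  "admissible F H \<longleftrightarrow> F \<in> borel_measurable (Xsp n) \<and> (\<forall>x. 0 \<le> F x) \<and>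
    (\<integral>\<^sup>+x. ennreal (F x) \<partial>kernel_chain q n) = 1 \<and>
    (\<exists>x0. path_moment s x0 n (density (kernel_chain q n) (\<lambda>x. ennreal (F x))) < \<infinity>) \<and>
    (\<integral>\<^sup>+x. ennreal (phi (F x)) \<partial>kernel_chain q n) = ennreal H \<and> 0 \<le> H"

abbreviation W_density :: "((nat \<Rightarrow> 'a) \<Rightarrow> real) \<Rightarrow> ennreal" where
  "W_density F \<equiv> Wcost (Xsp n) (dS s n) s (density (kernel_chain q n) (\<lambda>x. ennreal (F x))) (kernel_chain q n)"

text \<open>An intermediate form of the transport inequality in which the constant enters linearly,
  so that it can be enlarged and passed to limits easily.\<close>

definition cost_bound :: "real \<Rightarrow> bool" where
  "cost_bound Q \<longleftrightarrow> (\<forall>F H. admissible F H \<longrightarrow> W_density F \<le> ennreal (Q * (2 / \<alpha> * H) powr (s / 2)))"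

lemma admissible_recurrence:
  assumes F: "admissible F H" and \<gamma>: "0 < \<gamma>" and \<epsilon>: "0 < (\<epsilon>::real)"
  obtains a h where "W_density F \<le> ennreal (\<Sum>j=1..n. a j)" "\<forall>j\<in>{1..n}. 0 \<le> a j"
    "\<forall>j\<in>{1..n}. 0 \<le> h j \<and> a j \<le> (1 + \<gamma>) powr (s - 1) * (\<Sum>i=1..j-1. \<rho> (j - i) * a i)
          + (1 + 1 / \<gamma>) powr (s - 1) * (2 / \<alpha> * h j) powr (s / 2) + \<epsilon>" "(\<Sum>j=1..n. h j) \<le> H"
proof -
  obtain x0 where F': "F \<in> borel_measurable (Xsp n)" "\<forall>x. 0 \<le> F x" "(\<integral>\<^sup>+x. ennreal (F x) \<partial>kernel_chain q n) = 1"
    "path_moment s x0 n (density (kernel_chain q n) (\<lambda>x. ennreal (F x))) < \<infinity>"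
    "(\<integral>\<^sup>+x. ennreal (phi (F x)) \<partial>kernel_chain q n) = ennreal H" "0 \<le> H"
    using F unfolding admissible_def by blast
  obtain \<pi> a h where \<pi>: "\<pi> \<in> couplings (Xsp n) (density (kernel_chain q n) (\<lambda>x. ennreal (F x))) (kernel_chain q n)"
    and a: "\<forall>j\<in>{1..n}. 0 \<le> a j \<and> coordinate_cost s j \<pi> = ennreal (a j)"
    and h: "\<forall>j\<in>{1..n}. 0 \<le> h j \<and> a j \<le> (1 + \<gamma>) powr (s - 1) * (\<Sum>i=1..j-1. \<rho> (j - i) * a i)
          + (1 + 1 / \<gamma>) powr (s - 1) * (2 / \<alpha> * h j) powr (s / 2) + \<epsilon>" "(\<Sum>j=1..n. h j) \<le> H"
    using chain_coupling[OF \<gamma> \<epsilon> order_refl F'(1) F'(2)[rule_format] F'(3-6)] by blast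
  show ?thesis
    using a by (intro that[OF Wcost_le_sum[OF \<pi> a[rule_format]] _ h]) auto
qed

lemma ennreal_le_of_all_eps:
  assumes "\<And>\<epsilon>::real. 0 < \<epsilon> \<Longrightarrow> W \<le> ennreal (A + C * \<epsilon>)"
  shows "W \<le> ennreal A"
proof -
  have "(\<lambda>m. ennreal (A + C * (1 / real (Suc m)))) \<longlonglongrightarrow> ennreal (A + C * 0)"
    by (intro tendsto_ennrealI tendsto_intros LIMSEQ_inverse_real_of_nat[unfolded inverse_eq_divide])
  moreover have "W \<le> ennreal (A + C * (1 / real (Suc m)))" for m
    by (rule assms) simp
  ultimately have "W \<le> ennreal (A + C * 0)"
    by (intro LIMSEQ_le_const) blast+
  then show ?thesis by simp
qed

text \<open>Each h_k is replaced by the full entropy H, so every step of the recurrence carries the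
  same inhomogeneity and no power of n from concavity appears.\<close>

lemma cost_bound_bounded:
  assumes M: "0 \<le> M" "\<And>l. l \<in> {1..n} \<Longrightarrow> \<rho> l \<le> M" and \<gamma>: "0 < \<gamma>"
  shows "cost_bound ((1 + 1 / \<gamma>) powr (s - 1) * (\<Sum>i<n. (1 + (1 + \<gamma>) powr (s - 1) * M) ^ i))"
  unfolding cost_bound_def
proof (intro allI impI)
  fix F H assume F: "admissible F H"
  define B where "B = (2 / \<alpha> * H) powr (s / 2)"
  define S where "S = (\<Sum>i<n. (1 + (1 + \<gamma>) powr (s - 1) * M) ^ i)"
  have S: "0 \<le> S" using M by (auto simp: S_def intro!: sum_nonneg zero_le_power add_nonneg_nonneg)
  have "W_density F \<le> ennreal ((1 + 1 / \<gamma>) powr (s - 1) * B * S + S * \<epsilon>)" if \<epsilon>: "0 < \<epsilon>" for \<epsilon> :: real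
  proof -
    obtain a h where W: "W_density F \<le> ennreal (\<Sum>j=1..n. a j)" and a: "\<forall>j\<in>{1..n}. 0 \<le> a j"
      and h: "\<forall>j\<in>{1..n}. 0 \<le> h j \<and> a j \<le> (1 + \<gamma>) powr (s - 1) * (\<Sum>i=1..j-1. \<rho> (j - i) * a i)
          + (1 + 1 / \<gamma>) powr (s - 1) * (2 / \<alpha> * h j) powr (s / 2) + \<epsilon>" "(\<Sum>j=1..n. h j) \<le> H"
      by (rule admissible_recurrence[OF F \<gamma> \<epsilon>])
    have hB: "(2 / \<alpha> * h k) powr (s / 2) \<le> B" if k: "k \<in> {1..n}" for k
    proof -
      have "h k \<le> (\<Sum>j=1..n. h j)" using h(1) k by (intro member_le_sum) auto
      then have "h k \<le> H" using h(2) by simp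
      then show ?thesis unfolding B_def using h(1) k \<alpha> s
        by (intro powr_mono2 mult_left_mono mult_nonneg_nonneg) auto
    qed
    have "(\<Sum>k=1..n. a k) \<le> ((1 + 1 / \<gamma>) powr (s - 1) * B + \<epsilon>) * S"
      unfolding S_def
    proof (rule sum_bound_of_bounded_recurrence)
      fix k assume k: "k \<in> {1..n}"
      have "(1 + 1 / \<gamma>) powr (s - 1) * (2 / \<alpha> * h k) powr (s / 2) \<le> (1 + 1 / \<gamma>) powr (s - 1) * B"
        by (intro mult_left_mono hB[OF k]) auto
      then show "a k \<le> (1 + \<gamma>) powr (s - 1) * (\<Sum>j=1..k-1. \<rho> (k - j) * a j) + ((1 + 1 / \<gamma>) powr (s - 1) * B + \<epsilon>)"
        using bspec[OF h(1) k] by linarith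
    qed (use \<rho> M a in auto)
    also have "\<dots> = (1 + 1 / \<gamma>) powr (s - 1) * B * S + S * \<epsilon>" by (simp add: algebra_simps)
    finally show ?thesis
      using W by (meson ennreal_leI order_trans)
  qed
  from ennreal_le_of_all_eps[OF this]
  show "W_density F \<le> ennreal ((1 + 1 / \<gamma>) powr (s - 1) * (\<Sum>i<n. (1 + (1 + \<gamma>) powr (s - 1) * M) ^ i) * (2 / \<alpha> * H) powr (s / 2))"
    unfolding B_def S_def by (simp add: mult_ac)
qed

text \<open>The recurrence only sees the total of the inhomogeneities. Concavity of t^(s/2) bounds
  the sum of the powers of h_k by n^(1 - s/2) times the power of their sum.\<close>

lemma cost_bound_summable:
  assumes R: "(\<Sum>l=1..n. \<rho> l) \<le> R" and \<gamma>: "0 < \<gamma>"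
  shows "cost_bound (real n powr (1 - s / 2) * ((1 + 1 / \<gamma>) powr (s - 1) * (\<Sum>i<n. ((1 + \<gamma>) powr (s - 1) * R) ^ i)))"
  unfolding cost_bound_def
proof (intro allI impI)
  fix F H assume F: "admissible F H"
  have "0 \<le> (\<Sum>l=1..n. \<rho> l)" using \<rho> by (intro sum_nonneg) auto
  then have R0: "0 \<le> R" using R by simp
  define B where "B = (2 / \<alpha> * H) powr (s / 2)"
  define S where "S = (\<Sum>i<n. ((1 + \<gamma>) powr (s - 1) * R) ^ i)"
  define l where "l = (1 + 1 / \<gamma>) powr (s - 1)"
  have l: "0 \<le> l" by (simp add: l_def)
  have S: "0 \<le> S" using R0 by (auto simp: S_def intro!: sum_nonneg zero_le_power)
  have "W_density F \<le> ennreal (l * (real n powr (1 - s / 2) * B) * S + real n * S * \<epsilon>)" if \<epsilon>: "0 < \<epsilon>" for \<epsilon> :: real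
  proof -
    obtain a h where W: "W_density F \<le> ennreal (\<Sum>j=1..n. a j)" and a: "\<forall>j\<in>{1..n}. 0 \<le> a j"
      and h: "\<forall>j\<in>{1..n}. 0 \<le> h j \<and> a j \<le> (1 + \<gamma>) powr (s - 1) * (\<Sum>i=1..j-1. \<rho> (j - i) * a i)
          + (1 + 1 / \<gamma>) powr (s - 1) * (2 / \<alpha> * h j) powr (s / 2) + \<epsilon>" "(\<Sum>j=1..n. h j) \<le> H"
      by (rule admissible_recurrence[OF F \<gamma> \<epsilon>])
    have "(\<Sum>k=1..n. (2 / \<alpha> * h k) powr (s / 2)) \<le> real (card {1..n}) powr (1 - s / 2) * (\<Sum>k=1..n. 2 / \<alpha> * h k) powr (s / 2)"
      using h(1) \<alpha> s by (intro sum_powr_le_powr_sum) auto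
    also have "\<dots> \<le> real n powr (1 - s / 2) * B"
    proof -
      have "(\<Sum>k=1..n. 2 / \<alpha> * h k) = 2 / \<alpha> * (\<Sum>k=1..n. h k)" by (simp add: sum_distrib_left)
      also have "\<dots> \<le> 2 / \<alpha> * H" using h(2) \<alpha> by (intro mult_left_mono) auto
      finally have "(\<Sum>k=1..n. 2 / \<alpha> * h k) powr (s / 2) \<le> B"
        unfolding B_def using h(1) \<alpha> s by (intro powr_mono2) (auto intro!: sum_nonneg)
      then show ?thesis by (simp add: mult_left_mono)
    qed
    finally have hB: "(\<Sum>k=1..n. (2 / \<alpha> * h k) powr (s / 2)) \<le> real n powr (1 - s / 2) * B" .
    have "(\<Sum>k=1..n. a k) \<le> (\<Sum>k=1..n. l * (2 / \<alpha> * h k) powr (s / 2) + \<epsilon>) * S"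
      unfolding S_def
    proof (rule sum_bound_of_summable_recurrence[OF \<rho> _ R])
      fix k assume k: "k \<in> {1..n}"
      show "a k \<le> (1 + \<gamma>) powr (s - 1) * (\<Sum>j=1..k-1. \<rho> (k - j) * a j) + (l * (2 / \<alpha> * h k) powr (s / 2) + \<epsilon>)"
        using bspec[OF h(1) k] unfolding l_def by linarith
    qed (use a l \<epsilon> in auto)
    also have "\<dots> \<le> (l * (real n powr (1 - s / 2) * B) + real n * \<epsilon>) * S"
      using mult_left_mono[OF hB l] S by (intro mult_right_mono) (auto simp: sum.distrib sum_distrib_left)
    also have "\<dots> = l * (real n powr (1 - s / 2) * B) * S + real n * S * \<epsilon>" by (simp add: algebra_simps)
    finally show ?thesis
      using W by (meson ennreal_leI order_trans)
  qed
  from ennreal_le_of_all_eps[OF this]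
  show "W_density F \<le> ennreal (real n powr (1 - s / 2) * ((1 + 1 / \<gamma>) powr (s - 1) * (\<Sum>i<n. ((1 + \<gamma>) powr (s - 1) * R) ^ i)) * (2 / \<alpha> * H) powr (s / 2))"
    unfolding B_def S_def l_def by (simp add: mult_ac)
qed

lemma cost_bound_mono: "cost_bound Q \<Longrightarrow> Q \<le> Q' \<Longrightarrow> cost_bound Q'"
  unfolding cost_bound_def by (meson ennreal_leI mult_right_mono order_trans powr_ge_zero)

text \<open>Allows \<gamma> to tend to infinity, the limiting choice when R = 0.\<close>

lemma cost_bound_tendsto:
  assumes "\<And>m. cost_bound (Q m)" "Q \<longlonglongrightarrow> L"
  shows "cost_bound L"
  unfolding cost_bound_def
proof (intro allI impI)
  fix F H assume F: "admissible F H"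
  have "(\<lambda>m. ennreal (Q m * (2 / \<alpha> * H) powr (s / 2))) \<longlonglongrightarrow> ennreal (L * (2 / \<alpha> * H) powr (s / 2))"
    by (intro tendsto_ennrealI tendsto_intros assms)
  then show "W_density F \<le> ennreal (L * (2 / \<alpha> * H) powr (s / 2))"
    using assms(1) F unfolding cost_bound_def by (intro LIMSEQ_le_const) blast+
qed

text \<open>The factor 1/Z is absorbed into the power: Z^(-1) (2 H / \<alpha>)^(s/2) = (2 H /
  (\<alpha> Z^(2/s)))^(s/2). Taking s-th roots gives the transport inequality.\<close>

lemma T_ineq_of_cost_bound:
  assumes Q: "cost_bound Q" and Z: "0 < Z" "Q \<le> 1 / Z"
  shows "T_ineq (Xsp n) (dS s n) s (\<alpha> * Z powr (2 / s)) (kernel_chain q n)"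
  unfolding T_ineq_def
proof
  fix \<nu> :: "(nat \<Rightarrow> 'a) measure" assume \<nu>: "\<nu> \<in> Prob_s (Xsp n) (dS s n) s"
  let ?J = "kernel_chain q n" and ?\<beta> = "\<alpha> * Z powr (2 / s)"
  have J: "prob_space ?J" "sets ?J = sets (Xsp n)" using prob_chain[of n] by auto
  have \<beta>: "0 < ?\<beta>" using \<alpha> Z by simp
  obtain x0 where \<nu>': "prob_space \<nu>" "sets \<nu> = sets (Xsp n)" "(\<integral>\<^sup>+x. ennreal (dS s n x x0 powr s) \<partial>\<nu>) < \<infinity>"
    using \<nu> by (auto simp: Prob_s_def)
  show "Wass (Xsp n) (dS s n) s \<nu> ?J \<le> epowr (ereal (2 / ?\<beta>) * Ent \<nu> ?J) (1 / 2)"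
  \<comment> \<open>Infinite entropy makes the right side infinite; otherwise \<nu> has an
    admissible density.\<close>
  proof (cases "Ent \<nu> ?J = \<infinity>")
    case True
    then have "ereal (2 / ?\<beta>) * Ent \<nu> ?J = \<infinity>" using \<alpha> Z(1) by simp
    then show ?thesis by (simp only: epowr_def ereal.case) simp
  next
    case False
    obtain F where F: "F \<in> borel_measurable ?J" "\<And>x. 0 \<le> F x" "\<nu> = density ?J (\<lambda>x. ennreal (F x))"
      using finite_Ent_density[OF J(1) \<nu>'(1) _ False] \<nu>'(2) J(2) by auto
    define H where "H = enn2real (\<integral>\<^sup>+x. ennreal (phi (F x)) \<partial>?J)"
    have E: "Ent \<nu> ?J = ereal H" and H: "(\<integral>\<^sup>+x. ennreal (phi (F x)) \<partial>?J) = ennreal H" "0 \<le> H"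
      using Ent_density[OF J(1) F(1,2)] \<nu>'(1) False unfolding F(3) H_def by (auto split: if_splits)
    have F1: "(\<integral>\<^sup>+x. ennreal (F x) \<partial>?J) = 1"
      using prob_space.emeasure_space_1[OF \<nu>'(1)] F(1) unfolding F(3)
      by (simp add: emeasure_density cong: nn_integral_cong_simp)
    have mom: "path_moment s x0 n (density ?J (\<lambda>x. ennreal (F x))) < \<infinity>"
      using \<nu>'(3) s unfolding F(3) by (simp add: dS_powr)
    have Fm: "F \<in> borel_measurable (Xsp n)" using F(1) J(2) by (simp cong: measurable_cong_sets)
    define W where "W = Wcost (Xsp n) (dS s n) s \<nu> ?J"
    have "W \<le> ennreal (Q * (2 / \<alpha> * H) powr (s / 2))"
      using Q Fm F(2) F1 mom H unfolding W_def F(3) cost_bound_def admissible_def by blast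
    also have "\<dots> \<le> ennreal (1 / Z * (2 / \<alpha> * H) powr (s / 2))"
      using Z by (intro ennreal_leI mult_right_mono) auto
    also have "1 / Z * (2 / \<alpha> * H) powr (s / 2) = (2 / ?\<beta> * H) powr (s / 2)"
    proof -
      have "2 / ?\<beta> * H = Z powr (- 2 / s) * (2 / \<alpha> * H)" by (simp add: powr_minus_divide)
      moreover have "(Z powr (- 2 / s) * (2 / \<alpha> * H)) powr (s / 2) = (Z powr (- 2 / s)) powr (s / 2) * (2 / \<alpha> * H) powr (s / 2)"
        by (rule powr_mult)
      ultimately have "(2 / ?\<beta> * H) powr (s / 2) = (Z powr (- 2 / s)) powr (s / 2) * (2 / \<alpha> * H) powr (s / 2)"
        by (simp only:)
      also have "(Z powr (- 2 / s)) powr (s / 2) = Z powr ((- 2 / s) * (s / 2))"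
        by (rule powr_powr)
      also have "(- 2 / s) * (s / 2) = - 1" using s by simp
      also have "Z powr - 1 = 1 / Z" using Z by (simp add: powr_minus_divide)
      finally show ?thesis by simp
    qed
    finally have W: "W \<le> ennreal ((2 / ?\<beta> * H) powr (s / 2))" .
    then have fin: "W \<noteq> \<infinity>" using le_less_trans[OF W ennreal_less_top] by auto
    have "enn2real W \<le> (2 / ?\<beta> * H) powr (s / 2)" by (rule enn2real_leI[OF _ W]) simp
    then have "enn2real W powr (1 / s) \<le> ((2 / ?\<beta> * H) powr (s / 2)) powr (1 / s)"
      using s by (intro powr_mono2) auto
    also have "\<dots> = (2 / ?\<beta> * H) powr (1 / 2)" using s by (simp add: powr_powr)
    finally show ?thesis
      using fin by (simp add: Wass_def W_def[symmetric] E epowr_def)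
  qed
qed

section \<open>The constants of the theorem\<close>

lemma T_ineq_bounded:
  assumes M: "0 < M" "\<And>l. l \<in> {1..n} \<Longrightarrow> \<rho> l \<le> M"
  shows "T_ineq (Xsp n) (dS s n) s (\<alpha> * ((real n * exp 1) powr (1 - s) * M / (1 + M) ^ n) powr (2 / s)) (kernel_chain q n)"
proof -
  obtain \<gamma> where \<gamma>: "0 < \<gamma>" "(1 + 1 / \<gamma>) powr (s - 1) * (\<Sum>i<n. (1 + (1 + \<gamma>) powr (s - 1) * M) ^ i)
       \<le> (real n * exp 1) powr (s - 1) * ((1 + M) ^ n / M)"
    using young_parameter_bounded[OF s(1) n M(1)] by blast
  have "(real n * exp 1) powr (s - 1) * ((1 + M) ^ n / M) = 1 / ((real n * exp 1) powr (1 - s) * M / (1 + M) ^ n)"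
    using n M by (simp add: powr_diff field_simps)
  then show ?thesis
    using n M \<gamma>(2) by (intro T_ineq_of_cost_bound[OF cost_bound_bounded[OF _ M(2) \<gamma>(1)]]) auto
qed

lemma T_ineq_sum_lt_1:
  assumes R: "0 \<le> R" "R < 1" "(\<Sum>l=1..n. \<rho> l) \<le> R"
  shows "T_ineq (Xsp n) (dS s n) s (real n powr (1 - 2 / s) * (1 - R powr (1 / s))\<^sup>2 * \<alpha>) (kernel_chain q n)"
proof -
  have q: "R powr (1 / s) < 1"
    using R s powr_less_mono2[of "1 / s" R 1] by auto
  have bound: "cost_bound (real n powr (1 - s / 2) * (1 - R powr (1 / s)) powr (- s))"
  proof (cases "R = 0")
    case False
    then obtain \<gamma> where \<gamma>: "0 < \<gamma>"
      "(1 + 1 / \<gamma>) powr (s - 1) * (\<Sum>i<n. ((1 + \<gamma>) powr (s - 1) * R) ^ i) \<le> (1 - R powr (1 / s)) powr (- s)"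
      using young_parameter_lt_1[OF s(1), of R n] R by auto
    then show ?thesis
      by (intro cost_bound_mono[OF cost_bound_summable[OF R(3) \<gamma>(1)]] mult_left_mono) auto
  next
    case True
    \<comment> \<open>Since 0^0 = 1, only the term i = 0 survives, whatever \<gamma> is; the
      remaining prefactor tends to 1 as \<gamma> grows.\<close>
    have one: "(\<Sum>i<n. (c * R) ^ i) = 1" for c
      using True n by (cases n) (simp_all add: sum.lessThan_Suc_shift del: sum.lessThan_Suc)
    have "cost_bound (real n powr (1 - s / 2) * (1 + 1 / real (Suc m)) powr (s - 1))" for m
      using cost_bound_summable[OF R(3), of "real (Suc m)"] unfolding one by simp
    moreover have "(\<lambda>m. real n powr (1 - s / 2) * (1 + 1 / real (Suc m)) powr (s - 1)) \<longlonglongrightarrow> real n powr (1 - s / 2) * (1 + 0) powr (s - 1)"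
      by (intro tendsto_intros LIMSEQ_inverse_real_of_nat[unfolded inverse_eq_divide]) auto
    ultimately have "cost_bound (real n powr (1 - s / 2) * (1 + 0) powr (s - 1))"
      by (rule cost_bound_tendsto)
    then show ?thesis using True by simp
  qed
  \<comment> \<open>The reciprocal of the cost constant; the power 2/s turns the exponents s/2 - 1
    and s into 1 - 2/s and 2.\<close>
  define Z where "Z = real n powr (s / 2 - 1) * (1 - R powr (1 / s)) powr s"
  have "1 / Z = real n powr (1 - s / 2) * (1 - R powr (1 / s)) powr (- s)"
    using n q by (simp add: Z_def powr_minus_divide[of _ s] powr_diff)
  moreover have "0 < Z" using n q by (simp add: Z_def)
  ultimately have "T_ineq (Xsp n) (dS s n) s (\<alpha> * Z powr (2 / s)) (kernel_chain q n)"
    by (intro T_ineq_of_cost_bound[OF bound]) simp_all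
  also have "\<alpha> * Z powr (2 / s) = real n powr (1 - 2 / s) * (1 - R powr (1 / s))\<^sup>2 * \<alpha>"
  proof -
    have "Z powr (2 / s) = real n powr ((s / 2 - 1) * (2 / s)) * (1 - R powr (1 / s)) powr 2"
      using n q s by (simp add: Z_def powr_mult powr_powr)
    also have "(s / 2 - 1) * (2 / s) = 1 - 2 / s" using s by (simp add: field_simps)
    finally show ?thesis using q by simp
  qed
  finally show ?thesis .
qed

text \<open>Enlarging n^(1 - s/2) to (n + 1)^(1 - s/2) lets it merge with the factor (n + 1)^(s - 1)
  from the Young parameter into (n + 1)^(s/2).\<close>

lemma cost_bound_ge_1:
  assumes R: "1 \<le> R" "(\<Sum>l=1..n. \<rho> l) \<le> R"
  shows "cost_bound (exp (s - 1) * real (n + 1) powr (s / 2) * (\<Sum>i<n. R ^ i))"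
proof -
  obtain \<gamma> where \<gamma>: "0 < \<gamma>" "(1 + 1 / \<gamma>) powr (s - 1) * (\<Sum>i<n. ((1 + \<gamma>) powr (s - 1) * R) ^ i)
       \<le> real (n + 1) powr (s - 1) * (exp (s - 1) * (\<Sum>i<n. R ^ i))"
    using young_parameter_ge_1[OF s(1) n, of R] R by auto
  have sum0: "0 \<le> exp (s - 1) * (\<Sum>i<n. R ^ i)" using R by (auto intro!: mult_nonneg_nonneg sum_nonneg)
  have "real n powr (1 - s / 2) * ((1 + 1 / \<gamma>) powr (s - 1) * (\<Sum>i<n. ((1 + \<gamma>) powr (s - 1) * R) ^ i))
      \<le> real (n + 1) powr (1 - s / 2) * (real (n + 1) powr (s - 1) * (exp (s - 1) * (\<Sum>i<n. R ^ i)))"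
    using s R by (intro mult_mono[OF powr_mono2 \<gamma>(2)] mult_nonneg_nonneg sum_nonneg) auto
  also have "\<dots> = (real (n + 1) powr (1 - s / 2) * real (n + 1) powr (s - 1)) * (exp (s - 1) * (\<Sum>i<n. R ^ i))"
    by (simp only: mult.assoc)
  also have "real (n + 1) powr (1 - s / 2) * real (n + 1) powr (s - 1) = real (n + 1) powr (s / 2)"
    by (simp add: powr_add[symmetric] field_simps)
  also have "real (n + 1) powr (s / 2) * (exp (s - 1) * (\<Sum>i<n. R ^ i)) = exp (s - 1) * real (n + 1) powr (s / 2) * (\<Sum>i<n. R ^ i)"
    by (simp only: mult_ac)
  finally show ?thesis
    by (rule cost_bound_mono[OF cost_bound_summable[OF R(2) \<gamma>(1)]])
qed

lemma T_ineq_sum_eq_1: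
  assumes R: "(\<Sum>l=1..n. \<rho> l) \<le> 1"
  shows "T_ineq (Xsp n) (dS s n) s (exp (2 / s - 2) * real (n + 1) powr (- (2 / s) - 1) * \<alpha>) (kernel_chain q n)"
proof -
  define Z where "Z = exp (1 - s) * real (n + 1) powr (- 1 - s / 2)"
  have Z: "0 < Z" by (simp add: Z_def)
  \<comment> \<open>For R = 1 the geometric sum is n, enlarged to n + 1 to give a single power of n
    + 1.\<close>
  have "exp (s - 1) * real (n + 1) powr (s / 2) * (\<Sum>i<n. 1 ^ i) \<le> exp (s - 1) * real (n + 1) powr (s / 2) * real (n + 1)"
    by (intro mult_left_mono) auto
  also have "\<dots> = 1 / Z"
  proof -
    have "real (n + 1) powr (- 1 - s / 2) = 1 / (real (n + 1) * real (n + 1) powr (s / 2))"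
      by (simp add: powr_diff powr_minus_divide)
    then show ?thesis by (simp add: Z_def exp_diff)
  qed
  finally have "T_ineq (Xsp n) (dS s n) s (\<alpha> * Z powr (2 / s)) (kernel_chain q n)"
    using R by (intro T_ineq_of_cost_bound[OF cost_bound_ge_1[of 1] Z]) auto
  also have "Z powr (2 / s) = exp ((1 - s) * (2 / s)) * real (n + 1) powr ((- 1 - s / 2) * (2 / s))"
    by (simp add: Z_def powr_mult powr_powr exp_powr_real)
  also have "(1 - s) * (2 / s) = 2 / s - 2" using s by (simp add: field_simps)
  also have "(- 1 - s / 2) * (2 / s) = - (2 / s) - 1" using s by (simp add: field_simps)
  finally show ?thesis by (simp add: mult_ac)
qed

lemma T_ineq_sum_gt_1:
  assumes R: "1 < R" "(\<Sum>l=1..n. \<rho> l) \<le> R"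
  shows "T_ineq (Xsp n) (dS s n) s (((R - 1) / (exp (s - 1) * R ^ n)) powr (2 / s) * \<alpha> / real (n + 1)) (kernel_chain q n)"
proof -
  define Y where "Y = (R - 1) / (exp (s - 1) * R ^ n)"
  define Z where "Z = Y * real (n + 1) powr (- (s / 2))"
  have Y: "0 < Y" using R by (simp add: Y_def)
  then have Z: "0 < Z" by (simp add: Z_def)
  have "exp (s - 1) * real (n + 1) powr (s / 2) * (\<Sum>i<n. R ^ i) \<le> exp (s - 1) * real (n + 1) powr (s / 2) * (R ^ n / (R - 1))"
    using R by (intro mult_left_mono geometric_sum_le) auto
  also have "\<dots> = 1 / Z"
    using R by (simp add: Z_def Y_def powr_minus_divide)
  finally have "T_ineq (Xsp n) (dS s n) s (\<alpha> * Z powr (2 / s)) (kernel_chain q n)"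
    using R by (intro T_ineq_of_cost_bound[OF cost_bound_ge_1[of R] Z]) auto
  also have "Z powr (2 / s) = Y powr (2 / s) * real (n + 1) powr (- 1)"
    using Y s by (simp add: Z_def powr_mult powr_powr)
  finally show ?thesis by (simp add: Y_def powr_minus_divide mult_ac)
qed

end

theorem theorem2p1:
  fixes P1 :: "'a::polish_space measure"
    and p :: "nat \<Rightarrow> (nat \<Rightarrow> 'a) \<Rightarrow> 'a measure"
    and n :: nat and s \<alpha> M :: real and \<rho> :: "nat \<Rightarrow> real"
  assumes n: "n \<ge> 1"
    and s: "1 \<le> s" "s \<le> 2"
    and \<alpha>: "\<alpha> > 0" and M: "M > 0"
    and \<rho>: "\<And>l. l \<in> {1..n} \<Longrightarrow> 0 \<le> \<rho> l \<and> \<rho> l \<le> M"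
    and P1: "prob_space P1" "sets P1 = sets borel"
    and kernel: "\<And>k. k \<in> {2..n} \<Longrightarrow> p k \<in> Xsp (k - 1) \<rightarrow>\<^sub>M prob_algebra borel"
    and T1: "T_ineq borel dist s \<alpha> P1"
    and Tk: "\<And>k x. k \<in> {2..n} \<Longrightarrow> x \<in> space (Xsp (k - 1)) \<Longrightarrow> T_ineq borel dist s \<alpha> (p k x)"
    and Lip: "\<And>k x y. k \<in> {2..n} \<Longrightarrow> x \<in> space (Xsp (k - 1)) \<Longrightarrow> y \<in> space (Xsp (k - 1)) \<Longrightarrow>
               epowr (Wass borel dist s (p k x) (p k y)) s
                 \<le> ereal (\<Sum>j=1..k-1. \<rho> (k - j) * dist (x j) (y j) powr s)"
  shows "T_ineq (Xsp n) (dS s n) s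
           (\<alpha> * ((real n * exp 1) powr (1 - s) * M / (1 + M) ^ n) powr (2 / s))
           (joint P1 p n)
       \<and> (\<forall>R::real. R \<ge> 0 \<longrightarrow> (\<Sum>j=1..n. \<rho> j) \<le> R \<longrightarrow>
           T_ineq (Xsp n) (dS s n) s
             (if R < 1 then real n powr (1 - 2 / s) * (1 - R powr (1 / s))\<^sup>2 * \<alpha>
              else if R = 1 then exp (2 / s - 2) * real (n + 1) powr (- (2 / s) - 1) * \<alpha>
              else ((R - 1) / (exp (s - 1) * R ^ n)) powr (2 / s) * \<alpha> / real (n + 1))
             (joint P1 p n))"
proof -
  have \<rho>_le: "\<And>l. l \<in> {1..n} \<Longrightarrow> \<rho> l \<le> M" using \<rho> by auto
  define q where "q k x = (if k = 1 then P1 else p k x)" for k x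
  interpret weakly_dependent_chain q n s \<alpha> \<rho>
  proof
    fix k assume k: "k < n"
    show "q (Suc k) \<in> Xsp k \<rightarrow>\<^sub>M prob_algebra borel"
    proof (cases "k = 0")
      case True
      have "(\<lambda>_. P1) \<in> Xsp k \<rightarrow>\<^sub>M prob_algebra borel"
        using P1 by (intro measurable_const) (simp add: space_prob_algebra)
      then show ?thesis using True by (simp add: q_def[abs_def])
    next
      case False
      then show ?thesis using kernel[of "Suc k"] k by (simp add: q_def[abs_def])
    qed
    fix x :: "nat \<Rightarrow> 'a" assume x: "x \<in> space (Xsp k)"
    show "T_ineq borel dist s \<alpha> (q (Suc k) x)"
      using T1 Tk[of "Suc k" x] k x by (cases "k = 0") (auto simp: q_def)
    fix y :: "nat \<Rightarrow> 'a" assume y: "y \<in> space (Xsp k)"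
    show "Wcost borel dist s (q (Suc k) x) (q (Suc k) y) \<le> ennreal (\<Sum>j=1..k. \<rho> (Suc k - j) * dist (x j) (y j) powr s)"
    \<comment> \<open>With an empty past both laws are \<open>P1\<close>, so the cost is 0;
      otherwise this is hypothesis (ii) shifted by one.\<close>
    proof (cases "k = 0")
      case True
      then show ?thesis by (simp add: q_def Wcost_self[OF P1])
    next
      case False
      then show ?thesis
        using Lip[of "Suc k" x y] k x y s unfolding q_def by (intro Wcost_le_of_epowr_Wass_le) auto
    qed
  qed (use n s \<alpha> \<rho> in auto)
  have J: "joint P1 p n = kernel_chain q n"
    using joint_eq_kernel_chain[OF P1, of p "n - 1"] n by (simp add: q_def[abs_def])
  show ?thesis
    unfolding J using T_ineq_bounded[OF M \<rho>_le] T_ineq_sum_lt_1 T_ineq_sum_eq_1 T_ineq_sum_gt_1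
    by auto
qed

end
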